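(* Consider a sequence of $T$ updates (insertions and deletions of elements) to a dynamic problem, and suppose we are given an incremental (insertion-only) dynamic algorithm for this problem with worst-case update time $\Gamma$. Assume also that at any point in time we have a prediction on the order of deletions of the current items, such that for the $i$-th inserted item the error $\eta_i$ is the number of elements predicted to be deleted earlier than the $i$-th item that are actually deleted later ($\eta_i=0$ if the prediction is correct or the element is deleted later than predicted). Then there is a fully dynamic algorithm for the problem such that an insertion is performed in $O(\Gamma\log^2 T)$ worst-case time, and the deletion of the $i$-th element is performed in $O((1+\eta_i)\Gamma\log^2 T)$ worst-case time.
   Context: The problem is assumed to be one in which the state of the problem depends only on the current set of elements, not on the order in which they were inserted. The fully dynamic algorithm receives online insertions and deletions; the prediction of the deletion order is available for the items currently present (a predicted deletion time is supplied with each item at its insertion). *)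

theory Defs
  imports Complex_Main "HOL-Library.Extended_Nat"
begin

section \<open>Unit-cost random access machines\<close>

text \<open>
  Cook--Reckhow style RAM: a program is a finite list of instructions working on a memory of
  natural-number cells, every executed instruction costs one unit of time, and a run halts when the
  program counter leaves the program. The instruction operands are cell addresses; \<open>Load a b\<close> and
  \<open>Store a b\<close> are the indirect accesses \<open>M[a] := M[M[b]]\<close> and \<open>M[M[a]] := M[b]\<close>.
  The available unit-cost arithmetic is a parameter \<open>F\<close> (see \<open>uses_arith\<close> below).
\<close>

type_synonym mem = "nat \<Rightarrow> nat"

datatype instr =
    Const nat nat
  | Arith "nat \<Rightarrow> nat \<Rightarrow> nat" nat nat nat
  | Load nat nat
  | Store nat nat
  | Jump nat
  | JumpZero nat nat

type_synonym program = "instr list"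

fun instr_step :: "instr \<Rightarrow> nat \<times> mem \<Rightarrow> nat \<times> mem" where
  "instr_step (Const a n) (pc, M) = (Suc pc, M(a := n))"
| "instr_step (Arith f a b c) (pc, M) = (Suc pc, M(a := f (M b) (M c)))"
| "instr_step (Load a b) (pc, M) = (Suc pc, M(a := M (M b)))"
| "instr_step (Store a b) (pc, M) = (Suc pc, M(M a := M b))"
| "instr_step (Jump l) (pc, M) = (l, M)"
| "instr_step (JumpZero a l) (pc, M) = (if M a = 0 then l else Suc pc, M)"

text \<open>\<open>runs P pc M n M'\<close>: started at \<open>pc\<close> in memory \<open>M\<close>, the program \<open>P\<close> halts after exactly
  \<open>n\<close> steps in memory \<open>M'\<close>.\<close>

inductive runs :: "program \<Rightarrow> nat \<Rightarrow> mem \<Rightarrow> nat \<Rightarrow> mem \<Rightarrow> bool" for P where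
  halt: "length P \<le> pc \<Longrightarrow> runs P pc M 0 M"
| step: "pc < length P \<Longrightarrow> instr_step (P ! pc) (pc, M) = (pc', M') \<Longrightarrow> runs P pc' M' n M''
    \<Longrightarrow> runs P pc M (Suc n) M''"

definition uses_arith :: "(nat \<Rightarrow> nat \<Rightarrow> nat) set \<Rightarrow> program \<Rightarrow> bool" where
  "uses_arith F P \<longleftrightarrow> (\<forall>f a b c. Arith f a b c \<in> set P \<longrightarrow> f \<in> F)"

definition load_args :: "nat list \<Rightarrow> mem \<Rightarrow> mem" where
  "load_args args M = (\<lambda>a. if a < length args then args ! a else M a)"

text \<open>
  A data structure serves a sequence of calls (a program together with its arguments). The memory
  is initially zero and persists between calls; the arguments of a call are placed in cells
  \<open>0, 1, \<dots>\<close>. \<open>Ms ! t\<close> is the memory before the \<open>t\<close>-th call and \<open>ts ! t\<close> the time it takes.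
\<close>

definition trace :: "(program \<times> nat list) list \<Rightarrow> mem list \<Rightarrow> nat list \<Rightarrow> bool" where
  "trace cs Ms ts \<longleftrightarrow>
     length Ms = Suc (length cs) \<and> length ts = length cs \<and> Ms ! 0 = (\<lambda>_. 0) \<and>
     (\<forall>t < length cs. runs (fst (cs ! t)) 0 (load_args (snd (cs ! t)) (Ms ! t)) (ts ! t) (Ms ! Suc t))"

section \<open>Dynamic problems\<close>

text \<open>
  Elements, queries and answers are encoded as single cell contents. The admissible answers to a
  query depend only on the current set of elements.
\<close>

record problem =
  elements :: "nat set"
  queries :: "nat set"
  answers :: "nat set \<Rightarrow> nat \<Rightarrow> nat set"

datatype request = Insert nat | Delete nat | Query nat

fun apply_request :: "nat set \<Rightarrow> request \<Rightarrow> nat set" where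
  "apply_request S (Insert e) = insert e S"
| "apply_request S (Delete e) = S - {e}"
| "apply_request S (Query q) = S"

definition current :: "request list \<Rightarrow> nat \<Rightarrow> nat set" where
  "current xs t = foldl apply_request {} (take t xs)"

definition valid :: "problem \<Rightarrow> request list \<Rightarrow> bool" where
  "valid Pb xs \<longleftrightarrow> (\<forall>t < length xs. case xs ! t of
       Insert e \<Rightarrow> e \<in> elements Pb \<and> e \<notin> current xs t
     | Delete e \<Rightarrow> e \<in> current xs t
     | Query q \<Rightarrow> q \<in> queries Pb)"

fun is_update :: "request \<Rightarrow> bool" where
  "is_update (Query q) = False"
| "is_update _ = True"

definition num_updates :: "request list \<Rightarrow> nat" where
  "num_updates xs = length (filter is_update xs)"

definition answers_correctly :: "problem \<Rightarrow> request list \<Rightarrow> mem list \<Rightarrow> bool" where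
  "answers_correctly Pb xs Ms \<longleftrightarrow>
     (\<forall>t q. t < length xs \<and> xs ! t = Query q \<longrightarrow> (Ms ! Suc t) 0 \<in> answers Pb (current xs t) q)"

section \<open>Incremental algorithms\<close>

record inc_alg =
  inc_insert :: program
  inc_query :: program

text \<open>Deletions never reach an incremental algorithm, so their translation is irrelevant.\<close>

fun inc_call :: "inc_alg \<Rightarrow> request \<Rightarrow> program \<times> nat list" where
  "inc_call A (Insert e) = (inc_insert A, [e])"
| "inc_call A (Query q) = (inc_query A, [q])"
| "inc_call A (Delete e) = ([], [])"

definition incremental_algorithm ::
  "(nat \<Rightarrow> nat \<Rightarrow> nat) set \<Rightarrow> problem \<Rightarrow> nat \<Rightarrow> nat \<Rightarrow> nat \<Rightarrow> inc_alg \<Rightarrow> bool" where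
  "incremental_algorithm F Pb T \<Gamma> \<Gamma>q A \<longleftrightarrow>
     uses_arith F (inc_insert A) \<and> uses_arith F (inc_query A) \<and>
     (\<forall>xs. valid Pb xs \<and> (\<forall>e. Delete e \<notin> set xs) \<and> num_updates xs \<le> T \<longrightarrow>
        (\<exists>Ms ts. trace (map (inc_call A) xs) Ms ts \<and> answers_correctly Pb xs Ms \<and>
           (\<forall>t < length xs. case xs ! t of
               Insert e \<Rightarrow> ts ! t \<le> \<Gamma>
             | Delete e \<Rightarrow> True
             | Query q \<Rightarrow> ts ! t \<le> \<Gamma>q)))"

section \<open>Items and predicted deletion times\<close>

text \<open>
  An item is identified by the position of its insertion in the request sequence, so that an element
  that is inserted again after its deletion gives a new item. A position that holds no insertion has
  deletion time \<open>\<infinity>\<close>, as do items that are never deleted. The predicted deletion time of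
  item \<open>i\<close> is \<open>pred i\<close>; only the order of these numbers matters.
\<close>

definition inserted_items :: "request list \<Rightarrow> nat set" where
  "inserted_items xs = {i. i < length xs \<and> (\<exists>e. xs ! i = Insert e)}"

definition deletion_time :: "request list \<Rightarrow> nat \<Rightarrow> enat" where
  "deletion_time xs i =
     Inf (enat ` {t. i < t \<and> t < length xs \<and> (\<exists>e. xs ! i = Insert e \<and> xs ! t = Delete e)})"

definition coexist :: "request list \<Rightarrow> nat \<Rightarrow> nat \<Rightarrow> bool" where
  "coexist xs i j \<longleftrightarrow> i \<in> inserted_items xs \<and> j \<in> inserted_items xs \<and>
     enat i < deletion_time xs j \<and> enat j < deletion_time xs i"

text \<open>The predictions order the items present at any point in time, i.e. there are no ties.\<close>

definition predicts_order :: "request list \<Rightarrow> (nat \<Rightarrow> nat) \<Rightarrow> bool" where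
  "predicts_order xs pred \<longleftrightarrow> (\<forall>i j. coexist xs i j \<and> i \<noteq> j \<longrightarrow> pred i \<noteq> pred j)"

definition prediction_error :: "request list \<Rightarrow> (nat \<Rightarrow> nat) \<Rightarrow> nat \<Rightarrow> nat" where
  "prediction_error xs pred i =
     card {j. coexist xs i j \<and> pred j < pred i \<and> deletion_time xs i < deletion_time xs j}"

section \<open>Fully dynamic algorithms with predictions\<close>

record dyn_alg =
  dyn_insert :: program
  dyn_delete :: program
  dyn_query :: program

text \<open>The call for the request \<open>r\<close> at position \<open>t\<close>: only insertions carry a prediction.\<close>

fun dyn_call :: "dyn_alg \<Rightarrow> (nat \<Rightarrow> nat) \<Rightarrow> nat \<Rightarrow> request \<Rightarrow> program \<times> nat list" where
  "dyn_call B pred t (Insert e) = (dyn_insert B, [e, pred t])"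
| "dyn_call B pred t (Delete e) = (dyn_delete B, [e])"
| "dyn_call B pred t (Query q) = (dyn_query B, [q])"

definition dyn_calls :: "dyn_alg \<Rightarrow> (nat \<Rightarrow> nat) \<Rightarrow> request list \<Rightarrow> (program \<times> nat list) list" where
  "dyn_calls B pred xs = map (\<lambda>t. dyn_call B pred t (xs ! t)) [0..<length xs]"

text \<open>The deletion bound is a function of the prediction error of the deleted item.\<close>

definition fully_dynamic_algorithm ::
  "(nat \<Rightarrow> nat \<Rightarrow> nat) set \<Rightarrow> problem \<Rightarrow> nat \<Rightarrow> real \<Rightarrow> (nat \<Rightarrow> real) \<Rightarrow> real \<Rightarrow> dyn_alg \<Rightarrow> bool" where
  "fully_dynamic_algorithm F Pb T ins_bound del_bound qry_bound B \<longleftrightarrow>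
     uses_arith F (dyn_insert B) \<and> uses_arith F (dyn_delete B) \<and> uses_arith F (dyn_query B) \<and>
     (\<forall>xs pred. valid Pb xs \<and> num_updates xs = T \<and> predicts_order xs pred \<longrightarrow>
        (\<exists>Ms ts. trace (dyn_calls B pred xs) Ms ts \<and> answers_correctly Pb xs Ms \<and>
           (\<forall>t < length xs. case xs ! t of
               Insert e \<Rightarrow> real (ts ! t) \<le> ins_bound
             | Delete e \<Rightarrow> (\<forall>i. deletion_time xs i = enat t \<longrightarrow>
                              real (ts ! t) \<le> del_bound (prediction_error xs pred i))
             | Query q \<Rightarrow> real (ts ! t) \<le> qry_bound)))"

end

theory Submission
  imports Defs
begin

text \<open>The items predicted to be deleted late are fed to the incremental algorithm first, so that a deletion
  affects only the end of its history. Time is cut at each level \<open>i\<close> into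
  intervals of length \<open>2\<^sup>i\<close>. The node of an interval is a state of the incremental algorithm whose items survive
  the whole interval, because \<open>4 2\<^sup>i\<close> smaller items were present \<open>2 2\<^sup>i\<close> steps earlier; it extends the node of the
  enclosing interval of level \<open>i + 1\<close> and stores only the memory cells that differ. A node is built during the
  last but one interval before its own, at the pace of \<open>O(1)\<close> insertions per operation and level. Each
  memory access walks up the \<open>O(log T)\<close> ancestors, whence the bound \<open>O(\<Gamma> log\<^sup>2 T)\<close>. At any time at most six items are
  missing from the node of level \<open>0\<close>, and they are inserted anew after every operation.

  If an item is deleted while \<open>r\<close> present items are predicted to go first, these are deleted, the item is deleted, and
  they are inserted again; \<open>r\<close> is at most the prediction error.

  A query has to read a memory cell in constant time. For this there is a cache with two values per address and a
  time at which to switch from the first to the second. During each interval every address written by its own,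
  the preceding or the following node of the same level is refreshed, which suffices to keep the cache correct.

  Since there may be a different program for every \<open>T\<close>, each point in time gets its own loop-free program, in which
  all nodes and candidate positions are constants.\<close>

section \<open>Loop-free programs\<close>

text \<open>The incremental algorithm is a black box acting on memory cells, and its insertions have
  to be undone within worst-case bounds. Hence its states are kept as versions along a tree whose
  shape depends on the clock only, never on the data. The life of node \<open>(i, k)\<close> fixes
  the constants: after the snapshot at \<open>(k - 2) 2^i\<close>, interval \<open>k - 2\<close> is
  spent on construction, \<open>k - 1\<close> on bringing its cells into the cache, \<open>k\<close>
  on service. In these \<open>3 * 2^i\<close> steps at most as many minima disappear, so
  \<open>4 * 2^i\<close> smaller items shield its own. Its candidates are the
  \<open>4 * 2^(i+1)\<close> items left out by the parent and at most \<open>3 * 2^i\<close> newer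
  ones: \<open>11 * 2^i\<close> loads and as many extractions, that is 22 commands per step and
  level, each with at most \<open>G\<close> simulated steps of cost \<open>O(L)\<close>. A deletion
  at rank \<open>r\<close> takes \<open>2 r + 1\<close> virtual operations, so at most
  \<open>T (2 T + 1)\<close> occur in all, and \<open>L = O(log T)\<close> is chosen with
  \<open>T (2 T + 1) < 2^L\<close>. The items of a state are not fed in sorted order as a whole;
  answers depend on the set alone.\<close>

datatype sr = Prim instr | Then sr sr | Cond nat sr sr

fun sok :: "sr \<Rightarrow> bool" where
  "sok (Prim i) = (case i of Jump l \<Rightarrow> False | JumpZero a l \<Rightarrow> False | _ \<Rightarrow> True)"
| "sok (Then a b) = (sok a \<and> sok b)"
| "sok (Cond x a b) = (sok a \<and> sok b)"

fun sexec :: "sr \<Rightarrow> mem \<Rightarrow> mem" where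
  "sexec (Prim i) M = snd (instr_step i (0, M))"
| "sexec (Then a b) M = sexec b (sexec a M)"
| "sexec (Cond x a b) M = (if M x = 0 then sexec b M else sexec a M)"

fun stime :: "sr \<Rightarrow> mem \<Rightarrow> nat" where
  "stime (Prim i) M = 1"
| "stime (Then a b) M = stime a M + stime b (sexec a M)"
| "stime (Cond x a b) M = (if M x = 0 then 1 + stime b M else 2 + stime a M)"

fun slen :: "sr \<Rightarrow> nat" where
  "slen (Prim i) = 1"
| "slen (Then a b) = slen a + slen b"
| "slen (Cond x a b) = slen a + slen b + 2"

text \<open>Jumps of the machine are absolute, so the assembler has to know the position
  \<open>p\<close> of the first instruction.\<close>

fun asm :: "nat \<Rightarrow> sr \<Rightarrow> program" where
  "asm p (Prim i) = [i]"
| "asm p (Then a b) = asm p a @ asm (p + slen a) b"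
| "asm p (Cond x a b) = JumpZero x (p + slen a + 2) # asm (p + 1) a @
     Jump (p + slen a + slen b + 2) # asm (p + slen a + 2) b"

fun sarith :: "sr \<Rightarrow> (nat \<Rightarrow> nat \<Rightarrow> nat) set" where
  "sarith (Prim i) = (case i of Arith f a b c \<Rightarrow> {f} | _ \<Rightarrow> {})"
| "sarith (Then a b) = sarith a \<union> sarith b"
| "sarith (Cond x a b) = sarith a \<union> sarith b"

lemma length_asm [simp]: "length (asm p c) = slen c"
  by (induction c arbitrary: p) auto

lemma Arith_in_asm: "Arith f x y z \<in> set (asm p c) \<Longrightarrow> f \<in> sarith c"
  by (induction c arbitrary: p) auto

lemma uses_arith_asm: "sarith c \<subseteq> F \<Longrightarrow> uses_arith F (asm p c)"
  using Arith_in_asm by (fastforce simp: uses_arith_def)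

text \<open>\<open>runs\<close> describes only complete runs up to the halt. The induction therefore
  carries the remaining run, \<open>n\<close> steps starting behind the fragment, as a continuation;
  the whole program is the case where nothing remains.\<close>

lemma runs_asm:
  assumes "sok c" "P = pre @ asm (length pre) c @ post"
    and "runs P (length pre + slen c) (sexec c M) n M'"
  shows "runs P (length pre) M (stime c M + n) M'"
  using assms
proof (induction c arbitrary: pre post M n)
  case (Prim i)
  have i: "P ! length pre = i" "length pre < length P"
    using Prim.prems(2) by auto
  have st: "instr_step (P ! length pre) (length pre, M) = (Suc (length pre), sexec (Prim i) M)"
    using i(1) Prim.prems(1) by (cases i) auto
  show ?case
    using runs.step[OF i(2) st] Prim.prems(3) by simp
next
  case (Then a b)
  have "runs P (length (pre @ asm (length pre) a)) (sexec a M) (stime b (sexec a M) + n) M'"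
    by (rule Then.IH(2)[where post = post]) (use Then.prems in \<open>auto simp: add.assoc\<close>)
  then have "runs P (length pre) M (stime a M + (stime b (sexec a M) + n)) M'"
    by (intro Then.IH(1)[where post = "asm (length pre + slen a) b @ post"]) (use Then.prems in auto)
  then show ?case by (simp add: add.assoc)
next
  case (Cond x a b)
  let ?ja = "JumpZero x (length pre + slen a + 2)"
  let ?jb = "Jump (length pre + slen a + slen b + 2)"
  have i: "P ! length pre = ?ja" "length pre < length P"
    using Cond.prems(2) by auto
  show ?case
  proof (cases "M x = 0")
    case True
    let ?pre = "pre @ ?ja # asm (length pre + 1) a @ [?jb]"
    have "runs P (length ?pre) M (stime b M + n) M'"
      by (rule Cond.IH(2)[where post = post])
        (use Cond.prems True in \<open>auto simp: add.assoc numeral_2_eq_2\<close>)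
    then have "runs P (length pre + slen a + 2) M (stime b M + n) M'"
      by (simp add: numeral_2_eq_2)
    from runs.step[OF i(2) _ this, of M] show ?thesis
      using True i(1) by simp
  next
    case False
    let ?pre = "pre @ [?ja]"
    have e: "P ! (length ?pre + slen a) = ?jb" "length ?pre + slen a < length P"
      using Cond.prems(2) by (auto simp: nth_append)
    have "runs P (length ?pre + slen a) (sexec a M) (Suc n) M'"
      by (rule runs.step[OF e(2)]) (use e(1) Cond.prems False in \<open>auto simp: add.assoc\<close>)
    then have "runs P (length ?pre) M (stime a M + Suc n) M'"
      by (intro Cond.IH(1)[where post = "?jb # asm (length pre + slen a + 2) b @ post"])
        (use Cond.prems in auto)
    then have "runs P (Suc (length pre)) M (stime a M + Suc n) M'"
      by simp
    from runs.step[OF i(2) _ this, of M] show ?thesis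
      using False i(1) by simp
  qed
qed

lemma runs_asm_0: "sok c \<Longrightarrow> runs (asm 0 c) 0 M (stime c M) (sexec c M)"
  using runs_asm[of c "asm 0 c" "[]" "[]" M 0 "sexec c M"] runs.halt[of "asm 0 c" "slen c" "sexec c M"]
  by simp

section \<open>A language with named arrays\<close>

text \<open>The arrays \<open>Q r\<close> are accessed in constant time; an access to one of the many arrays
  \<open>W c i k\<close> costs time \<open>L\<close> unless its index is known in advance (\<open>Vr\<close>, \<open>SetV\<close>).\<close>

datatype nm = Q nat | W nat nat nat

type_synonym st = "nm \<Rightarrow> nat \<Rightarrow> nat"

datatype ex =
    K nat
  | Vr nm nat
  | Rd nat ex
  | Op "nat \<Rightarrow> nat \<Rightarrow> nat" ex ex
  | Find "nm list" ex
  | IfE ex ex ex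

datatype com = Skip | SetV nm nat ex | Set nm ex ex | Seq com com | If ex com com

fun first :: "st \<Rightarrow> nm list \<Rightarrow> nat \<Rightarrow> nat" where
  "first s [] x = 0"
| "first s (n # ns) x = (if s n x = 0 then first s ns x else s n x)"

fun eval :: "ex \<Rightarrow> st \<Rightarrow> nat" where
  "eval (K n) s = n"
| "eval (Vr n x) s = s n x"
| "eval (Rd r e) s = s (Q r) (eval e s)"
| "eval (Op f a b) s = f (eval a s) (eval b s)"
| "eval (Find ns e) s = first s ns (eval e s)"
| "eval (IfE c a b) s = (if eval c s = 0 then eval b s else eval a s)"

definition put :: "st \<Rightarrow> nm \<Rightarrow> nat \<Rightarrow> nat \<Rightarrow> st" where
  "put s n x v = s(n := (s n)(x := v))"

lemma put_apply [simp]: "put s n x v m = (if m = n then (s n)(x := v) else s m)"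
  by (simp add: put_def)

fun exec :: "com \<Rightarrow> st \<Rightarrow> st" where
  "exec Skip s = s"
| "exec (SetV n x e) s = put s n x (eval e s)"
| "exec (Set n i e) s = put s n (eval i s) (eval e s)"
| "exec (Seq a b) s = exec b (exec a s)"
| "exec (If c a b) s = (if eval c s = 0 then exec b s else exec a s)"

fun seqs :: "com list \<Rightarrow> com" where
  "seqs [] = Skip"
| "seqs (c # cs) = Seq c (seqs cs)"

lemma exec_seqs_append [simp]: "exec (seqs (xs @ ys)) s = exec (seqs ys) (exec (seqs xs) s)"
  by (induction xs arbitrary: s) auto

fun wr :: "com \<Rightarrow> nm set" where
  "wr Skip = {}"
| "wr (SetV n x e) = {n}"
| "wr (Set n i e) = {n}"
| "wr (Seq a b) = wr a \<union> wr b"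
| "wr (If c a b) = wr a \<union> wr b"

lemma exec_frame: "n \<notin> wr c \<Longrightarrow> exec c s n = s n"
  by (induction c arbitrary: s) auto

lemma wr_seqs [simp]: "wr (seqs cs) = (\<Union>c\<in>set cs. wr c)"
  by (induction cs) auto

subsection \<open>Translation\<close>

definition code :: "nat \<Rightarrow> nat \<Rightarrow> nat \<Rightarrow> nat \<Rightarrow> nat" where
  "code L c i k = (k * 2 ^ L + i) * 8 + c"

fun shift :: "nat \<Rightarrow> nm \<Rightarrow> nat" where
  "shift L (Q r) = 4"
| "shift L (W c i k) = 2 * L + 9"

fun off :: "nat \<Rightarrow> nm \<Rightarrow> nat" where
  "off L (Q r) = r"
| "off L (W c i k) = 16 * code L c i k + 15"

text \<open>All arrays are interleaved in one memory: residue \<open>r < 15\<close> modulo 16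
  belongs to \<open>Q r\<close>, residue 15 to the \<open>W\<close> arrays, which are told apart by
  \<open>code\<close>, a number below \<open>2^(2L+5)\<close>. Thus \<open>Q 0\<close> and
  \<open>Q 1\<close> at index 0 are the cells 0 and 1, where the arguments arrive, and cell 0 also
  receives the answer.\<close>

definition addr :: "nat \<Rightarrow> nm \<Rightarrow> nat \<Rightarrow> nat" where
  "addr L n x = x * 2 ^ shift L n + off L n"

text \<open>Class 7 is excluded by \<open>okn\<close>, so temporaries collide with no array;
  \<open>d\<close> is the evaluation depth.\<close>

definition tmp :: "nat \<Rightarrow> nat \<Rightarrow> nat" where
  "tmp L d = addr L (W 7 0 0) d"

fun okn :: "nat \<Rightarrow> nm \<Rightarrow> bool" where
  "okn L (Q r) = (r < 15)"
| "okn L (W c i k) = (c < 7 \<and> i < 2 ^ L \<and> k < 2 ^ (L + 2))"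

fun wide :: "nm \<Rightarrow> bool" where
  "wide (Q r) = False" | "wide (W c i k) = True"

fun oke :: "nat \<Rightarrow> (nat \<Rightarrow> nat \<Rightarrow> nat) set \<Rightarrow> ex \<Rightarrow> bool" where
  "oke L F (K n) = True"
| "oke L F (Vr n x) = okn L n"
| "oke L F (Rd r e) = (r < 15 \<and> oke L F e)"
| "oke L F (Op f a b) = (f \<in> F \<and> oke L F a \<and> oke L F b)"
| "oke L F (Find ns e) = ((\<forall>n\<in>set ns. okn L n \<and> wide n) \<and> oke L F e)"
| "oke L F (IfE c a b) = (oke L F c \<and> oke L F a \<and> oke L F b)"

fun okc :: "nat \<Rightarrow> (nat \<Rightarrow> nat \<Rightarrow> nat) set \<Rightarrow> com \<Rightarrow> bool" where
  "okc L F Skip = True"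
| "okc L F (SetV n x e) = (okn L n \<and> oke L F e)"
| "okc L F (Set n i e) = (okn L n \<and> oke L F i \<and> oke L F e)"
| "okc L F (Seq a b) = (okc L F a \<and> okc L F b)"
| "okc L F (If c a b) = (oke L F c \<and> okc L F a \<and> okc L F b)"

lemma okc_seqs [simp]: "okc L F (seqs cs) = (\<forall>c\<in>set cs. okc L F c)"
  by (induction cs) auto

lemma code_less:
  assumes "c < 8" "i < 2 ^ L" "k < 2 ^ (L + 2)"
  shows "code L c i k < 2 ^ (2 * L + 5)"
proof -
  have "k * 2 ^ L + i < 2 ^ (2 * L + 2)"
  proof -
    have "k * 2 ^ L + i < Suc k * 2 ^ L" using assms by simp
    also have "\<dots> \<le> 2 ^ (L + 2) * 2 ^ L" using assms by (intro mult_right_mono) auto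
    also have "\<dots> = (2::nat) ^ (2 * L + 2)" by (simp only: power_add mult_2 mult.assoc mult.commute[of "2 ^ 2"])
    finally show ?thesis .
  qed
  then have "Suc (k * 2 ^ L + i) * 8 \<le> 2 ^ (2 * L + 2) * 8" by (intro mult_right_mono) auto
  moreover have "code L c i k < Suc (k * 2 ^ L + i) * 8" using assms unfolding code_def by simp
  ultimately have "code L c i k < 2 ^ (2 * L + 2) * 8" by (rule less_le_trans[rotated])
  also have "\<dots> = (2::nat) ^ (2 * L + 5)" by (simp add: power_add)
  finally show ?thesis .
qed

lemma mult_add_eq_cancel:
  fixes a b x y m :: nat
  assumes "x < m" "y < m" "a * m + x = b * m + y"
  shows "a = b \<and> x = y"
proof -
  have "a = (a * m + x) div m" using assms(1) by simp
  also have "\<dots> = b" unfolding assms(3) using assms(2) by simp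
  finally show ?thesis using assms(3) by simp
qed

lemma code_inj:
  assumes "code L c i k = code L c' i' k'" "c < 8" "c' < 8" "i < 2 ^ L" "i' < 2 ^ L"
  shows "c = c' \<and> i = i' \<and> k = k'"
proof -
  have "k * 2 ^ L + i = k' * 2 ^ L + i' \<and> c = c'"
    by (rule mult_add_eq_cancel[OF _ _ assms(1)[unfolded code_def]]) (use assms in auto)
  then show ?thesis using mult_add_eq_cancel[of i "2 ^ L" i'] assms by auto
qed

lemma addr_W: "addr L (W c i k) x = (x * 2 ^ (2 * L + 5) + code L c i k) * 16 + 15"
  by (simp add: addr_def power_add algebra_simps)

lemma addr_W_inj:
  assumes "addr L (W c i k) x = addr L (W c' i' k') x'" "c < 8" "c' < 8" "i < 2 ^ L" "i' < 2 ^ L"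
    "k < 2 ^ (L + 2)" "k' < 2 ^ (L + 2)"
  shows "c = c' \<and> i = i' \<and> k = k' \<and> x = x'"
proof -
  have "x * 2 ^ (2 * L + 5) + code L c i k = x' * 2 ^ (2 * L + 5) + code L c' i' k'"
    using assms(1) unfolding addr_W by simp
  then have "x = x' \<and> code L c i k = code L c' i' k'"
    using mult_add_eq_cancel code_less assms by meson
  then show ?thesis using code_inj assms by metis
qed

lemma addr_inj:
  assumes "okn L n" "okn L m" "addr L n x = addr L m y"
  shows "n = m \<and> x = y"
proof -
  have "addr L (Q r) u = addr L (Q r') v \<Longrightarrow> r < 15 \<Longrightarrow> r' < 15 \<Longrightarrow> r = r' \<and> u = v" for r r' u v
    using mult_add_eq_cancel[of r 16 r' u v] by (auto simp: addr_def)
  moreover have "addr L (Q r) u \<noteq> addr L (W c i k) v" if "r < 15" for r u c i k v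
    using mult_add_eq_cancel[of r 16 15 u "v * 2 ^ (2 * L + 5) + code L c i k"] that
    unfolding addr_W by (auto simp: addr_def)
  moreover have "n = m \<and> x = y" if "n = W c i k" "m = W c' i' k'" for c i k c' i' k'
    using addr_W_inj[of L c i k x c' i' k' y] assms that by simp
  ultimately show ?thesis
    using assms by (metis nm.exhaust okn.simps(1))
qed

lemma tmp_inj [simp]: "tmp L d = tmp L d' \<longleftrightarrow> d = d'"
  using addr_W_inj[of L 7 0 0 d 7 0 0 d'] by (auto simp: tmp_def)

lemma addr_neq_tmp:
  assumes "okn L n" shows "addr L n x \<noteq> tmp L d"
proof (cases n)
  case (Q r)
  show ?thesis
  proof
    assume "addr L n x = tmp L d"
    then have "x * 16 + r = (d * 2 ^ (2 * L + 5) + code L 7 0 0) * 16 + 15"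
      unfolding tmp_def addr_W using Q by (simp add: addr_def)
    from mult_add_eq_cancel[OF _ _ this] show False
      using assms Q by auto
  qed
next
  case (W c i k)
  then show ?thesis
    using assms addr_W_inj[of L c i k x 7 0 0 d] by (auto simp: tmp_def)
qed

text \<open>Only addition and subtraction are sure to be available, so a factor \<open>2^m\<close>
  costs \<open>m\<close> doublings. This is why a computed index into a \<open>W\<close> array costs
  time linear in \<open>L\<close>, and into a \<open>Q\<close> array constant time.\<close>

fun rep :: "nat \<Rightarrow> sr \<Rightarrow> sr \<Rightarrow> sr" where
  "rep 0 c r = r" | "rep (Suc n) c r = Then c (rep n c r)"

text \<open>The index arrives already multiplied by the factor that all \<open>W\<close> arrays
  share. Each further array then costs only a constant, and a search through \<open>O(L)\<close>
  ancestors costs \<open>O(L)\<close>, not \<open>O(L^2)\<close>.\<close>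

fun findc :: "nat \<Rightarrow> nat \<Rightarrow> nm list \<Rightarrow> sr" where
  "findc L d [] = Prim (Const (tmp L d) 0)"
| "findc L d (n # ns) =
     Then (Prim (Const (tmp L (d + 1)) (off L n)))
    (Then (Prim (Arith (+) (tmp L (d + 1)) (tmp L d) (tmp L (d + 1))))
    (Then (Prim (Load (tmp L (d + 1)) (tmp L (d + 1))))
    (Cond (tmp L (d + 1)) (Then (Prim (Const (tmp L d) 0)) (Prim (Arith (+) (tmp L d) (tmp L d) (tmp L (d + 1)))))
       (findc L d ns))))"

fun compe :: "nat \<Rightarrow> nat \<Rightarrow> ex \<Rightarrow> sr" where
  "compe L d (K n) = Prim (Const (tmp L d) n)"
| "compe L d (Vr n x) = Then (Prim (Const (tmp L d) (addr L n x))) (Prim (Load (tmp L d) (tmp L d)))"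
| "compe L d (Rd r e) = Then (compe L d e) (rep 4 (Prim (Arith (+) (tmp L d) (tmp L d) (tmp L d)))
     (Then (Prim (Const (tmp L (d + 1)) r))
     (Then (Prim (Arith (+) (tmp L d) (tmp L d) (tmp L (d + 1)))) (Prim (Load (tmp L d) (tmp L d))))))"
| "compe L d (Op f a b) = Then (compe L d a) (Then (compe L (d + 1) b) (Prim (Arith f (tmp L d) (tmp L d) (tmp L (d + 1)))))"
| "compe L d (Find ns e) = Then (compe L d e)
     (rep (2 * L + 9) (Prim (Arith (+) (tmp L d) (tmp L d) (tmp L d))) (findc L d ns))"
| "compe L d (IfE c a b) = Then (compe L d c) (Cond (tmp L d) (compe L d a) (compe L d b))"

fun compc :: "nat \<Rightarrow> com \<Rightarrow> sr" where
  "compc L Skip = Prim (Const (tmp L 0) 0)"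
| "compc L (SetV n x e) = Then (compe L 0 e) (Then (Prim (Const (tmp L 1) (addr L n x))) (Prim (Store (tmp L 1) (tmp L 0))))"
| "compc L (Set n i e) = Then (compe L 0 i) (rep (shift L n) (Prim (Arith (+) (tmp L 0) (tmp L 0) (tmp L 0)))
     (Then (Prim (Const (tmp L 1) (off L n))) (Then (Prim (Arith (+) (tmp L 0) (tmp L 0) (tmp L 1)))
     (Then (compe L 1 e) (Prim (Store (tmp L 0) (tmp L 1)))))))"
| "compc L (Seq a b) = Then (compc L a) (compc L b)"
| "compc L (If c a b) = Then (compe L 0 c) (Cond (tmp L 0) (compc L a) (compc L b))"

fun cost :: "nat \<Rightarrow> ex \<Rightarrow> nat" where
  "cost L (K n) = 1"
| "cost L (Vr n x) = 2"
| "cost L (Rd r e) = cost L e + 7"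
| "cost L (Op f a b) = cost L a + cost L b + 1"
| "cost L (Find ns e) = cost L e + 2 * L + 17 + 4 * length ns"
| "cost L (IfE c a b) = cost L c + 2 + max (cost L a) (cost L b)"

text \<open>Unlike \<open>wc\<close> this follows the branch taken. The distinction matters for
  deletions, whose cost depends on the rank found at run time and not on the depth of the
  code.\<close>

fun time :: "nat \<Rightarrow> com \<Rightarrow> st \<Rightarrow> nat" where
  "time L Skip s = 1"
| "time L (SetV n x e) s = cost L e + 2"
| "time L (Set n i e) s = cost L i + cost L e + shift L n + 3"
| "time L (Seq a b) s = time L a s + time L b (exec a s)"
| "time L (If c a b) s = cost L c + 2 + (if eval c s = 0 then time L b s else time L a s)"

fun wc :: "nat \<Rightarrow> com \<Rightarrow> nat" where
  "wc L Skip = 1"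
| "wc L (SetV n x e) = cost L e + 2"
| "wc L (Set n i e) = cost L i + cost L e + shift L n + 3"
| "wc L (Seq a b) = wc L a + wc L b"
| "wc L (If c a b) = cost L c + 2 + max (wc L a) (wc L b)"

lemma time_le_wc: "time L c s \<le> wc L c"
  by (induction c arbitrary: s) (simp_all add: add_mono le_max_iff_disj)

definition rel :: "nat \<Rightarrow> st \<Rightarrow> mem \<Rightarrow> bool" where
  "rel L s M \<longleftrightarrow> (\<forall>n x. okn L n \<longrightarrow> M (addr L n x) = s n x)"

lemma rel_tmp [simp]: "rel L s (M(tmp L d := v)) = rel L s M"
  by (auto simp: rel_def addr_neq_tmp)

lemma rel_put: "rel L s M \<Longrightarrow> okn L n \<Longrightarrow> rel L (put s n x v) (M(addr L n x := v))"
  by (auto simp: rel_def put_def dest: addr_inj)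

lemma rep_double:
  "sexec (rep m (Prim (Arith (+) t t t)) c) M = sexec c (M(t := M t * 2 ^ m))"
  "stime (rep m (Prim (Arith (+) t t t)) c) M = m + stime c (M(t := M t * 2 ^ m))"
  by (induction m arbitrary: M) (auto simp: mult.assoc mult_2[symmetric] mult.left_commute)

declare fun_upd_apply [simp del] put_apply [simp del] fun_upd_same [simp] fun_upd_other [simp]

lemma findc:
  assumes "rel L s M" "\<forall>n\<in>set ns. okn L n \<and> wide n" "M (tmp L d) = x * 2 ^ (2 * L + 9)"
  shows "rel L s (sexec (findc L d ns) M) \<and> sexec (findc L d ns) M (tmp L d) = first s ns x \<and>
    (\<forall>d'<d. sexec (findc L d ns) M (tmp L d') = M (tmp L d')) \<and>
    stime (findc L d ns) M \<le> 8 + 4 * length ns"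
  using assms
proof (induction ns arbitrary: M)
  case Nil
  then show ?case by simp
next
  case (Cons n ns)
  have a: "x * 2 ^ (2 * L + 9) + off L n = addr L n x"
    using Cons.prems by (cases n) (auto simp: addr_def)
  have M: "M (addr L n x) = s n x" using Cons.prems by (auto simp: rel_def)
  have [simp]: "addr L n x \<noteq> tmp L d'" for d' using Cons.prems addr_neq_tmp by auto
  show ?case
  proof (cases "s n x = 0")
    case True
    then show ?thesis
      using Cons.IH[of "M(tmp L (Suc d) := 0)"] Cons.prems M by (auto simp: a)
  next
    case False
    then show ?thesis using Cons.prems M by (auto simp: a)
  qed
qed

lemma compe:
  assumes "rel L s M" "oke L F e"
  shows "rel L s (sexec (compe L d e) M) \<and> sexec (compe L d e) M (tmp L d) = eval e s \<and>
    (\<forall>d'<d. sexec (compe L d e) M (tmp L d') = M (tmp L d')) \<and> stime (compe L d e) M \<le> cost L e"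
  using assms
proof (induction e arbitrary: d M)
  case (K n)
  then show ?case by simp
next
  case (Vr n x)
  then show ?case by (auto simp: rel_def addr_neq_tmp)
next
  case (Rd r e)
  let ?M = "sexec (compe L d e) M"
  have IH: "rel L s ?M" "?M (tmp L d) = eval e s" "\<forall>d'<d. ?M (tmp L d') = M (tmp L d')"
    "stime (compe L d e) M \<le> cost L e"
    using Rd.IH[of M d] Rd.prems by auto
  have a: "eval e s * 16 + r = addr L (Q r) (eval e s)" by (simp add: addr_def)
  have [simp]: "addr L (Q r) x \<noteq> tmp L d'" for x d' using Rd.prems addr_neq_tmp by auto
  have M: "?M (addr L (Q r) (eval e s)) = s (Q r) (eval e s)"
    using IH(1) Rd.prems by (auto simp: rel_def)
  show ?case
    using IH M by (auto simp: rep_double a simp del: rep.simps)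
next
  case (Op f a b)
  let ?M = "sexec (compe L d a) M" and ?N = "sexec (compe L (d + 1) b) (sexec (compe L d a) M)"
  have 1: "rel L s ?M" "?M (tmp L d) = eval a s" "\<forall>d'<d. ?M (tmp L d') = M (tmp L d')"
    "stime (compe L d a) M \<le> cost L a"
    using Op.IH(1)[of M d] Op.prems by auto
  have 2: "rel L s ?N" "?N (tmp L (d + 1)) = eval b s" "\<forall>d'<d + 1. ?N (tmp L d') = ?M (tmp L d')"
    "stime (compe L (d + 1) b) ?M \<le> cost L b"
    using Op.IH(2)[of ?M "d + 1"] Op.prems 1 by auto
  show ?case using 1 2 by auto
next
  case (Find ns e)
  let ?M = "sexec (compe L d e) M"
  let ?N = "?M(tmp L d := ?M (tmp L d) * 2 ^ (2 * L + 9))"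
  have IH: "rel L s ?M" "?M (tmp L d) = eval e s" "\<forall>d'<d. ?M (tmp L d') = M (tmp L d')"
    "stime (compe L d e) M \<le> cost L e"
    using Find.IH[of M d] Find.prems by auto
  have "rel L s ?N" "?N (tmp L d) = eval e s * 2 ^ (2 * L + 9)"
    using IH by auto
  from findc[OF this(1) _ this(2), of ns] Find.prems show ?case
    using IH by (auto simp: rep_double simp del: rep.simps)
next
  case (IfE c a b)
  let ?M = "sexec (compe L d c) M"
  have 1: "rel L s ?M" "?M (tmp L d) = eval c s" "\<forall>d'<d. ?M (tmp L d') = M (tmp L d')"
    "stime (compe L d c) M \<le> cost L c"
    using IfE.IH(1)[of M d] IfE.prems by auto
  show ?case
    using 1 IfE.IH(2,3)[of ?M d] IfE.prems by (fastforce simp: le_max_iff_disj)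
qed

lemma compc:
  assumes "rel L s M" "okc L F c"
  shows "rel L (exec c s) (sexec (compc L c) M) \<and> stime (compc L c) M \<le> time L c s"
  using assms
proof (induction c arbitrary: s M)
  case Skip
  then show ?case by simp
next
  case (SetV n x e)
  let ?M = "sexec (compe L 0 e) M"
  have 1: "rel L s ?M" "?M (tmp L 0) = eval e s" "stime (compe L 0 e) M \<le> cost L e"
    using compe[of L s M F e 0] SetV.prems by auto
  then have "rel L (put s n x (eval e s)) ((?M(tmp L 1 := addr L n x))(addr L n x := eval e s))"
    using SetV.prems by (intro rel_put) auto
  then show ?case using 1 by simp
next
  case (Set n i e)
  let ?M = "sexec (compe L 0 i) M"
  have 1: "rel L s ?M" "?M (tmp L 0) = eval i s" "stime (compe L 0 i) M \<le> cost L i"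
    using compe[of L s M F i 0] Set.prems by auto
  define N where "N = ?M(tmp L 0 := addr L n (eval i s), tmp L 1 := off L n)"
  have N: "rel L s N" "N (tmp L 0) = addr L n (eval i s)" using 1 by (auto simp: N_def)
  have 2: "rel L s (sexec (compe L 1 e) N)" "sexec (compe L 1 e) N (tmp L 1) = eval e s"
    "sexec (compe L 1 e) N (tmp L 0) = addr L n (eval i s)"
    "stime (compe L 1 e) N \<le> cost L e"
    using compe[of L s N F e 1] Set.prems N by auto
  have a: "eval i s * 2 ^ shift L n + off L n = addr L n (eval i s)" by (simp add: addr_def)
  have eq: "(?M(tmp L 0 := eval i s * 2 ^ shift L n, tmp L 1 := off L n, tmp L 0 := addr L n (eval i s))) = N"
    by (auto simp: N_def fun_eq_iff fun_upd_apply)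
  have "rel L (put s n (eval i s) (eval e s)) ((sexec (compe L 1 e) N)(addr L n (eval i s) := eval e s))"
    using Set.prems 2 by (intro rel_put) auto
  then show ?case using 1 2 by (simp add: rep_double a eq[simplified] del: rep.simps)
next
  case (Seq a b)
  from Seq.IH(1)[of s M] Seq.IH(2)[of "exec a s" "sexec (compc L a) M"] Seq.prems
  show ?case by auto
next
  case (If c a b)
  let ?M = "sexec (compe L 0 c) M"
  have 1: "rel L s ?M" "?M (tmp L 0) = eval c s" "stime (compe L 0 c) M \<le> cost L c"
    using compe[of L s M F c 0] If.prems by auto
  show ?case
    using 1 If.IH[of s ?M] If.prems by (fastforce)
qed

declare fun_upd_apply [simp] put_apply [simp] fun_upd_same [simp del] fun_upd_other [simp del]

lemma sok_compe: "sok (compe L d e)"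
proof -
  have r: "sok (rep m (Prim i) c) \<longleftrightarrow> m = 0 \<and> sok c \<or> sok (Prim i) \<and> sok c" for m i c
    by (induction m) auto
  have "sok (findc L d ns)" for d ns by (induction ns) auto
  then show ?thesis by (induction e arbitrary: d) (auto simp: r simp del: rep.simps)
qed

lemma sok_compc: "sok (compc L c)"
proof -
  have r: "sok (rep m (Prim i) c) \<longleftrightarrow> m = 0 \<and> sok c \<or> sok (Prim i) \<and> sok c" for m i c
    by (induction m) auto
  show ?thesis by (induction c) (auto simp: sok_compe r)
qed

lemma sarith_compe: "oke L F e \<Longrightarrow> (+) \<in> F \<Longrightarrow> sarith (compe L d e) \<subseteq> F"
proof -
  assume p: "(+) \<in> F" "oke L F e"
  have r: "sarith (rep m (Prim i) c) \<subseteq> F" if "sarith (Prim i) \<subseteq> F" "sarith c \<subseteq> F" for m i c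
    using that by (induction m) auto
  have "sarith (findc L d ns) \<subseteq> F" for d ns by (induction ns) (use p in auto)
  then show ?thesis using p(2)
    by (induction e arbitrary: d) (use p(1) in \<open>simp_all add: r del: rep.simps\<close>)
qed

lemma sarith_compc: "okc L F c \<Longrightarrow> (+) \<in> F \<Longrightarrow> sarith (compc L c) \<subseteq> F"
proof -
  assume p: "(+) \<in> F" "okc L F c"
  have r: "sarith (rep m (Prim i) c) \<subseteq> F" if "sarith (Prim i) \<subseteq> F" "sarith c \<subseteq> F" for m i c
    using that by (induction m) auto
  show ?thesis using p(2)
    by (induction c) (use p(1) in \<open>simp_all add: r sarith_compe del: rep.simps\<close>)
qed

definition prog :: "nat \<Rightarrow> com \<Rightarrow> program" where
  "prog L c = asm 0 (compc L c)"

lemma uses_arith_prog: "okc L F c \<Longrightarrow> (+) \<in> F \<Longrightarrow> uses_arith F (prog L c)"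
  unfolding prog_def by (intro uses_arith_asm sarith_compc)

lemma runs_prog:
  assumes "rel L s M" "okc L F c"
  obtains n M' where "runs (prog L c) 0 M n M'" "rel L (exec c s) M'" "n \<le> time L c s"
  using runs_asm_0[OF sok_compc, of L c M] compc[OF assms] unfolding prog_def by blast

section \<open>Simulation of a program with bounded running time\<close>

text \<open>Fuel makes the semantics total and structurally recursive; with the known bound on the
  running time as fuel, a program with jumps can be unrolled into loop-free code.\<close>

fun frun :: "program \<Rightarrow> nat \<Rightarrow> nat \<Rightarrow> mem \<Rightarrow> mem" where
  "frun P 0 pc M = M"
| "frun P (Suc f) pc M = (if length P \<le> pc then M
     else frun P f (fst (instr_step (P ! pc) (pc, M))) (snd (instr_step (P ! pc) (pc, M))))"

lemma frun_runs: "runs P pc M n M' \<Longrightarrow> n \<le> f \<Longrightarrow> frun P f pc M = M'"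
proof (induction arbitrary: f rule: runs.induct)
  case (halt pc M)
  then show ?case by (cases f) auto
next
  case (step pc M pc' M' n M'')
  then show ?case by (cases f) auto
qed

definition scratch :: nm where "scratch = Q 13"

text \<open>The simulated program counter is known at translation time, so no decoding happens at
  run time. A conditional jump duplicates the remaining code; the size may grow exponentially in the
  fuel, but only time is counted. The remaining fuel passed to \<open>wt\<close> numbers the writes
  on every path differently.\<close>

fun sim :: "(ex \<Rightarrow> ex) \<Rightarrow> (nat \<Rightarrow> com) \<Rightarrow> program \<Rightarrow> nat \<Rightarrow> nat \<Rightarrow> com" where
  "sim rd wt P 0 pc = Skip"
| "sim rd wt P (Suc f) pc = (if length P \<le> pc then Skip else case P ! pc of
     Const a n \<Rightarrow> Seq (SetV scratch 0 (K a)) (Seq (SetV scratch 1 (K n)) (Seq (wt f) (sim rd wt P f (Suc pc))))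
   | Arith g a b c \<Rightarrow> Seq (SetV scratch 0 (K a)) (Seq (SetV scratch 1 (Op g (rd (K b)) (rd (K c))))
       (Seq (wt f) (sim rd wt P f (Suc pc))))
   | Load a b \<Rightarrow> Seq (SetV scratch 0 (K a)) (Seq (SetV scratch 1 (rd (rd (K b))))
       (Seq (wt f) (sim rd wt P f (Suc pc))))
   | Store a b \<Rightarrow> Seq (SetV scratch 0 (rd (K a))) (Seq (SetV scratch 1 (rd (K b)))
       (Seq (wt f) (sim rd wt P f (Suc pc))))
   | Jump l \<Rightarrow> sim rd wt P f l
   | JumpZero a l \<Rightarrow> If (rd (K a)) (sim rd wt P f (Suc pc)) (sim rd wt P f l))"

text \<open>Placing the argument in cell 0 is itself a write, with index \<open>f\<close>; the
  simulated steps use the indices below. Hence a call makes at most \<open>f + 1\<close>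
  writes.\<close>

definition call :: "(ex \<Rightarrow> ex) \<Rightarrow> (nat \<Rightarrow> com) \<Rightarrow> program \<Rightarrow> nat \<Rightarrow> ex \<Rightarrow> com" where
  "call rd wt P f e = Seq (SetV scratch 1 e) (Seq (SetV scratch 0 (K 0)) (Seq (wt f) (sim rd wt P f 0)))"

text \<open>\<open>I f\<close> may only mention the part of the state that is not touched by the writes with index
  below \<open>f\<close>; each index is used at most once, in decreasing order.\<close>

locale memory_view =
  fixes rd :: "ex \<Rightarrow> ex" and wt :: "nat \<Rightarrow> com" and view :: "st \<Rightarrow> nat \<Rightarrow> nat"
    and I :: "nat \<Rightarrow> st \<Rightarrow> bool" and N :: nat
  assumes rd: "I f s \<Longrightarrow> eval (rd e) s = view s (eval e s)"
    and scratch_I: "I f s \<Longrightarrow> j < 2 \<Longrightarrow> I f (put s scratch j v)"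
    and scratch_view: "I f s \<Longrightarrow> j < 2 \<Longrightarrow> view (put s scratch j v) = view s"
    and decr_I: "I (Suc f) s \<Longrightarrow> I f s"
    and wt_I: "I (Suc f) s \<Longrightarrow> f \<le> N \<Longrightarrow> I f (exec (wt f) s)"
    and wt_view: "I (Suc f) s \<Longrightarrow> f \<le> N \<Longrightarrow> view (exec (wt f) s) = (view s)(s scratch 0 := s scratch 1)"
begin

text \<open>The value is evaluated after \<open>scratch\<close> cell 0 has been overwritten by the
  address; the third assumption makes this harmless.\<close>

lemma write_view:
  assumes "I (Suc f) s" "f \<le> N" "\<And>s'. I (Suc f) s' \<Longrightarrow> view s' = view s \<Longrightarrow> eval b s' = eval b s"
  shows "I f (exec (wt f) (exec (SetV scratch 1 b) (exec (SetV scratch 0 a) s)))"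
    "view (exec (wt f) (exec (SetV scratch 1 b) (exec (SetV scratch 0 a) s))) = (view s)(eval a s := eval b s)"
proof -
  define s1 where "s1 = put s scratch 0 (eval a s)"
  define s2 where "s2 = put s1 scratch 1 (eval b s1)"
  have 1: "I (Suc f) s1" "view s1 = view s" using assms scratch_I scratch_view by (auto simp: s1_def)
  then have 2: "I (Suc f) s2" "view s2 = view s" "s2 scratch 0 = eval a s" "s2 scratch 1 = eval b s"
    using assms(3)[of s1] scratch_I scratch_view by (auto simp: s2_def s1_def)
  show "I f (exec (wt f) (exec (SetV scratch 1 b) (exec (SetV scratch 0 a) s)))"
    "view (exec (wt f) (exec (SetV scratch 1 b) (exec (SetV scratch 0 a) s))) = (view s)(eval a s := eval b s)"
    using wt_I[OF 2(1) assms(2)] wt_view[OF 2(1) assms(2)] 2(2-) by (simp_all add: s1_def s2_def)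
qed

lemma sim:
  assumes "I f s" "f \<le> Suc N"
  shows "I 0 (exec (sim rd wt P f pc) s) \<and> view (exec (sim rd wt P f pc) s) = frun P f pc (view s)"
  using assms
proof (induction f arbitrary: pc s)
  case 0
  then show ?case by simp
next
  case (Suc f)
  have If: "I f s" using decr_I Suc.prems(1) .
  have I0: "I m s \<Longrightarrow> I 0 s" for m by (induction m) (auto intro: decr_I)
  show ?case
  proof (cases "length P \<le> pc")
    case False
    have *: "I 0 (exec (sim rd wt P f pc') s') \<and> view (exec (sim rd wt P f pc') s') = frun P f pc' (view s')"
      if "I f s'" for s' pc'
      using Suc that by simp
    have w: "I 0 (exec (Seq (SetV scratch 0 a) (Seq (SetV scratch 1 b) (Seq (wt f) (sim rd wt P f pc')))) s) \<and>
      view (exec (Seq (SetV scratch 0 a) (Seq (SetV scratch 1 b) (Seq (wt f) (sim rd wt P f pc')))) s)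
        = frun P f pc' ((view s)(eval a s := eval b s))"
      if "\<And>s'. I (Suc f) s' \<Longrightarrow> view s' = view s \<Longrightarrow> eval b s' = eval b s" for a b pc'
    proof -
      have f: "f \<le> N" using Suc.prems(2) by simp
      show ?thesis
        using *[OF write_view(1)[OF Suc.prems(1) f that], of pc' a] write_view(2)[OF Suc.prems(1) f that, of a]
        by (simp only: exec.simps)
    qed
    note [simp del] = exec.simps
    have rd': "eval (rd e) s = view s (eval e s)" for e using rd If by blast
    show ?thesis
    proof (cases "P ! pc")
      case (Const a b)
      then show ?thesis using w[of "K b" "K a" "Suc pc"] False by simp
    next
      case (Arith g a b c)
      then show ?thesis using w[of "Op g (rd (K b)) (rd (K c))" "K a" "Suc pc"] False rd rd' by simp
    next
      case (Load a b)
      then show ?thesis using w[of "rd (rd (K b))" "K a" "Suc pc"] False rd rd' by simp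
    next
      case (Store a b)
      then show ?thesis using w[of "rd (K b)" "rd (K a)" "Suc pc"] False rd rd' by simp
    next
      case (Jump l)
      then show ?thesis using *[OF If] False by simp
    next
      case (JumpZero a l)
      then show ?thesis using *[OF If] False rd' by (simp add: exec.simps)
    qed
  qed (use Suc I0 in auto)
qed

lemma call:
  assumes "I (Suc N) s"
  shows "I 0 (exec (call rd wt P N e) s)"
    "view (exec (call rd wt P N e) s) = frun P N 0 ((view s)(0 := eval e s))"
proof -
  let ?s = "put (put s scratch 1 (eval e s)) scratch 0 0"
  have "I (Suc N) (put s scratch 1 (eval e s))" "view (put s scratch 1 (eval e s)) = view s"
    using scratch_I[OF assms, of 1] scratch_view[OF assms, of 1] by auto
  then have 1: "I (Suc N) ?s" "view ?s = view s"
    using scratch_I[of "Suc N" _ 0] scratch_view[of "Suc N" _ 0] by auto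
  then have 2: "I N (exec (wt N) ?s)" "view (exec (wt N) ?s) = (view s)(0 := eval e s)"
    using wt_I[of N ?s] wt_view[of N ?s] by auto
  show "I 0 (exec (call rd wt P N e) s)"
    "view (exec (call rd wt P N e) s) = frun P N 0 ((view s)(0 := eval e s))"
    using sim[OF 2(1), of P 0] 2(2) by (simp_all add: call_def)
qed

end

lemma wr_sim: "wr (sim rd wt P f pc) \<subseteq> insert scratch (\<Union>f. wr (wt f))"
proof (induction f arbitrary: pc)
  case (Suc f)
  have "wr (wt f) \<subseteq> insert scratch (\<Union>f. wr (wt f))" by blast
  then show ?case using Suc by (simp split: instr.split)
qed simp

lemma wr_call: "wr (call rd wt P f e) \<subseteq> insert scratch (\<Union>f. wr (wt f))"
  using wr_sim[of rd wt P f 0] by (auto simp: call_def)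

lemma okc_sim:
  assumes "uses_arith F P" "\<And>e. oke L F e \<Longrightarrow> oke L F (rd e)" "\<And>f. okc L F (wt f)"
  shows "okc L F (sim rd wt P f pc)"
proof (induction f arbitrary: pc)
  case (Suc f)
  have "g \<in> F" if "P ! pc = Arith g a b c" "pc < length P" for g a b c
    using assms(1) that unfolding uses_arith_def by (metis nth_mem)
  then show ?case using assms(2,3) Suc by (auto simp: scratch_def split: instr.split)
qed simp

lemma okc_call:
  assumes "uses_arith F P" "\<And>e. oke L F e \<Longrightarrow> oke L F (rd e)" "\<And>f. okc L F (wt f)" "oke L F e"
  shows "okc L F (call rd wt P f e)"
  using assms okc_sim[OF assms(1-3)] by (auto simp: call_def scratch_def)

lemma wc_sim:
  assumes "\<And>n. cost L (rd (K n)) \<le> r" "\<And>n. cost L (rd (rd (K n))) \<le> r" "\<And>f. wc L (wt f) \<le> w"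
  shows "wc L (sim rd wt P f pc) \<le> f * (2 * r + w + 10) + 1"
proof (induction f arbitrary: pc)
  case (Suc f)
  show ?case
  proof (cases "length P \<le> pc")
    case False
    show ?thesis
    proof (cases "P ! pc")
      case (Arith g a b c)
      then show ?thesis using False assms(1)[of b] assms(1)[of c] assms(3)[of f] Suc[of "Suc pc"] by simp
    next
      case (Load a b)
      then show ?thesis using False assms(2)[of b] assms(3)[of f] Suc[of "Suc pc"] by simp
    next
      case (Store a b)
      then show ?thesis using False assms(1)[of a] assms(1)[of b] assms(3)[of f] Suc[of "Suc pc"] by simp
    next
      case (Const a b)
      then show ?thesis using False assms(3)[of f] Suc[of "Suc pc"] by simp
    next
      case (Jump l)
      then show ?thesis using False Suc[of l] by simp
    next
      case (JumpZero a l)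
      then show ?thesis using False assms(1)[of a] Suc[of l] Suc[of "Suc pc"] by simp
    qed
  qed simp
qed simp

lemma wc_call:
  assumes "\<And>n. cost L (rd (K n)) \<le> r" "\<And>n. cost L (rd (rd (K n))) \<le> r" "\<And>f. wc L (wt f) \<le> w"
  shows "wc L (call rd wt P f e) \<le> (f + 1) * (2 * r + w + 10) + cost L e"
  using wc_sim[where rd = rd and wt = wt and P = P and f = f and pc = 0, OF assms] assms(3)[of f] by (simp add: call_def)

section \<open>Tournament trees\<close>

definition sorted_by :: "(nat \<Rightarrow> nat) \<Rightarrow> nat set \<Rightarrow> nat list" where
  "sorted_by f A = sort_key f (sorted_list_of_set A)"

lemma sorted_by [simp]:
  "finite A \<Longrightarrow> set (sorted_by f A) = A" "distinct (sorted_by f A)" "sorted (map f (sorted_by f A))"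
  "length (sorted_by f A) = card A"
  by (simp_all add: sorted_by_def)

lemma sorted_by_empty [simp]: "sorted_by f {} = []"
  by (simp add: sorted_by_def)

lemma sorted_by_eqI:
  assumes "inj_on f A" "set xs = A" "distinct xs" "sorted (map f xs)"
  shows "sorted_by f A = xs"
proof -
  have "finite A" using assms(2) by auto
  then show ?thesis
    using assms by (intro map_sorted_distinct_set_unique[of f])
      (auto simp: distinct_map)
qed

lemma insort_key_cong:
  "(\<And>y. y \<in> insert x (set xs) \<Longrightarrow> f y = g y) \<Longrightarrow> insort_key f x xs = insort_key g x xs"
  by (induction xs) auto

lemma sort_key_cong: "(\<And>y. y \<in> set xs \<Longrightarrow> f y = g y) \<Longrightarrow> sort_key f xs = sort_key g xs"
  by (induction xs) (auto intro: insort_key_cong)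

lemma sorted_by_cong:
  assumes "\<And>y. y \<in> A \<Longrightarrow> f y = g y"
  shows "sorted_by f A = sorted_by g A"
  unfolding sorted_by_def using assms by (cases "finite A") (auto intro!: sort_key_cong)

definition argmin :: "(nat \<Rightarrow> nat) \<Rightarrow> nat set \<Rightarrow> nat" where
  "argmin f A = hd (sorted_by f A)"

lemma argmin_in: "finite A \<Longrightarrow> A \<noteq> {} \<Longrightarrow> argmin f A \<in> A"
  unfolding argmin_def by (metis hd_in_set sorted_by(1) list.set(1))

lemma argmin_le: "finite A \<Longrightarrow> y \<in> A \<Longrightarrow> f (argmin f A) \<le> f y"
proof -
  assume *: "finite A" "y \<in> A"
  then have "y \<in> set (sorted_by f A)" by simp
  then show ?thesis using sorted_by(3)[of f A] unfolding argmin_def by (cases "sorted_by f A") auto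
qed

lemma argmin_eqI:
  assumes "finite A" "inj_on f A" "y \<in> A" "\<And>z. z \<in> A \<Longrightarrow> f y \<le> f z"
  shows "argmin f A = y"
proof -
  have "argmin f A \<in> A" using assms argmin_in by blast
  then have "f (argmin f A) = f y" using assms argmin_le[of A y f] by (simp add: antisym)
  then show ?thesis using assms argmin_in[of A f] by (auto dest: inj_onD)
qed

definition winner :: "(nat \<Rightarrow> nat) \<Rightarrow> nat set \<Rightarrow> nat" where
  "winner f A = (if A = {} then 0 else Suc (argmin f A))"

lemma winner_cong: "(\<And>y. y \<in> A \<Longrightarrow> f y = g y) \<Longrightarrow> winner f A = winner g A"
  using sorted_by_cong[of A f g] by (simp add: winner_def argmin_def)

lemma winner_Un:
  assumes "finite A" "finite A'" "inj_on f (A \<union> A')"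
  shows "winner f (A \<union> A') = (if winner f A = 0 then winner f A' else if winner f A' = 0 then winner f A
    else if f (winner f A - 1) \<le> f (winner f A' - 1) then winner f A else winner f A')"
proof -
  have "argmin f (A \<union> A') = (if f (argmin f A) \<le> f (argmin f A') then argmin f A else argmin f A')"
    if "A \<noteq> {}" "A' \<noteq> {}"
    using assms that argmin_in[of A f] argmin_in[of A' f] argmin_le[of A _ f] argmin_le[of A' _ f]
    by (intro argmin_eqI) (auto, (meson le_trans le_cases)+)
  then show ?thesis by (auto simp: winner_def)
qed

text \<open>A tree of height \<open>h\<close> is stored in the \<open>2 ^ (h + 1) - 1\<close> cells from \<open>p\<close> on, the root first,
  then the left and the right subtree. Only the first \<open>c\<close> leaves have been in use.\<close>

fun trep :: "(nat \<Rightarrow> nat) \<Rightarrow> nat \<Rightarrow> nat \<Rightarrow> (nat \<Rightarrow> nat) \<Rightarrow> nat set \<Rightarrow> nat \<Rightarrow> bool" where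
  "trep f 0 p v A c \<longleftrightarrow> A = (if v p = 0 then {} else {v p - 1}) \<and> (c = 0 \<longrightarrow> v p = 0)"
| "trep f (Suc h) p v A c \<longleftrightarrow> (\<exists>A1 A2. A = A1 \<union> A2 \<and> A1 \<inter> A2 = {} \<and>
     trep f h (p + 1) v A1 (min c (2 ^ h)) \<and> trep f h (p + 2 ^ Suc h) v A2 (c - 2 ^ h) \<and> v p = winner f A)"

lemma trep_root:
  assumes "trep f h p v A c" shows "finite A \<and> v p = winner f A"
  using assms
proof (induction f h p v A c rule: trep.induct)
  case (1 f p v A c)
  then show ?case by (auto simp: winner_def argmin_def sorted_by_def)
next
  case (2 f h p v A c)
  then show ?case by fastforce
qed

lemma trep_cong:
  assumes "trep f h p v A c" "\<And>z. p \<le> z \<Longrightarrow> z + 1 < p + 2 ^ Suc h \<Longrightarrow> w z = v z"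
    "\<And>y. y \<in> A \<Longrightarrow> g y = f y"
  shows "trep g h p w A c"
  using assms
proof (induction f h p v A c rule: trep.induct)
  case (1 f p v A c)
  then show ?case by auto
next
  case (2 f h p v A c)
  then obtain A1 A2 where A: "A = A1 \<union> A2" "A1 \<inter> A2 = {}" "trep f h (p + 1) v A1 (min c (2 ^ h))"
    "trep f h (p + 2 ^ Suc h) v A2 (c - 2 ^ h)" "v p = winner f A"
    by auto
  have p: "(2::nat) ^ h > 0" by simp
  have "trep g h (p + 1) w A1 (min c (2 ^ h))"
  proof (rule 2(1)[OF A(3)])
    fix z assume z: "p + 1 \<le> z" "z + 1 < p + 1 + 2 ^ Suc h"
    have "z + 1 < p + 2 ^ Suc (Suc h)" using z p by simp
    then show "w z = v z" using 2(4)[of z] z by simp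
  qed (use 2(5) A in auto)
  moreover have "trep g h (p + 2 ^ Suc h) w A2 (c - 2 ^ h)"
    by (rule 2(2)[OF A(4)]) (use 2(4,5) A in auto)
  moreover have "w p = winner g A" using A(5) 2(4)[of p] p winner_cong[of A g f] 2(5) by auto
  ultimately show ?case using A by auto
qed

lemma trep_mono: "trep f h p v A c \<Longrightarrow> c \<le> c' \<Longrightarrow> trep f h p v A c'"
proof (induction f h p v A c arbitrary: c' rule: trep.induct)
  case (2 f h p v A c)
  then obtain A1 A2 where A: "A = A1 \<union> A2" "A1 \<inter> A2 = {}" "trep f h (p + 1) v A1 (min c (2 ^ h))"
    "trep f h (p + 2 ^ Suc h) v A2 (c - 2 ^ h)" "v p = winner f A"
    by auto
  have "min c (2 ^ h) \<le> min c' (2 ^ h)" "c - 2 ^ h \<le> c' - 2 ^ h" using 2(4) by auto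
  then show ?case using 2(1)[OF A(3)] 2(2)[OF A(4)] A unfolding trep.simps by blast
qed auto

lemma trep_zero: "(\<And>z. v z = 0) \<Longrightarrow> trep f h p v {} 0"
  by (induction h arbitrary: p) (auto simp: winner_def)

definition keys :: nm where "keys = Q 10"

text \<open>Truncated subtraction serves as comparison: the difference of the two keys is nonzero
  exactly if the left winner is larger.\<close>

definition recomp :: "nm \<Rightarrow> nat \<Rightarrow> nat \<Rightarrow> com" where
  "recomp n h p = SetV n p
     (IfE (Vr n (p + 1)) (IfE (Vr n (p + 2 ^ Suc h))
       (IfE (Op (-) (Rd 10 (Op (-) (Vr n (p + 1)) (K 1))) (Rd 10 (Op (-) (Vr n (p + 2 ^ Suc h)) (K 1))))
         (Vr n (p + 2 ^ Suc h)) (Vr n (p + 1)))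
       (Vr n (p + 1))) (Vr n (p + 2 ^ Suc h)))"

text \<open>The leaf \<open>j\<close> is a constant of the program: the number of the load command
  or the time of the insertion. Leaves are never reused, so no free list has to be kept.\<close>

fun ins :: "nm \<Rightarrow> nat \<Rightarrow> nat \<Rightarrow> nat \<Rightarrow> com" where
  "ins n 0 p j = SetV n p (Vr scratch 2)"
| "ins n (Suc h) p j =
     Seq (if j < 2 ^ h then ins n h (p + 1) j else ins n h (p + 2 ^ Suc h) (j - 2 ^ h)) (recomp n h p)"

text \<open>This is the absolute difference, as subtraction is truncated.\<close>

definition ne :: "ex \<Rightarrow> ex \<Rightarrow> ex" where
  "ne a b = Op (+) (Op (-) a b) (Op (-) b a)"

lemma eval_ne [simp]: "eval (ne a b) s = 0 \<longleftrightarrow> eval a s = eval b s"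
  by (auto simp: ne_def)

lemma cost_ne [simp]: "cost L (ne a b) = 2 * cost L a + 2 * cost L b + 3"
  by (simp add: ne_def)

lemma oke_ne [simp]: "(+) \<in> F \<Longrightarrow> (-) \<in> F \<Longrightarrow> oke L F (ne a b) = (oke L F a \<and> oke L F b)"
  by (auto simp: ne_def)

text \<open>The two subtrees hold disjoint sets, so the minimum lies on the left exactly if the left
  child names the same item as the root.\<close>

fun ext :: "nm \<Rightarrow> nat \<Rightarrow> nat \<Rightarrow> com" where
  "ext n 0 p = SetV n p (K 0)"
| "ext n (Suc h) p =
     Seq (If (ne (Vr n p) (Vr n (p + 1))) (ext n h (p + 2 ^ Suc h)) (ext n h (p + 1))) (recomp n h p)"

lemma wr_recomp [simp]: "wr (recomp n h p) = {n}" by (simp add: recomp_def)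

lemma wr_ins [simp]: "wr (ins n h p j) = {n}"
  by (induction h arbitrary: p j) auto

lemma wr_ext [simp]: "wr (ext n h p) = {n}"
  by (induction h arbitrary: p) auto

lemma exec_recomp:
  assumes "trep f h (p + 1) (s n) A1 c1" "trep f h (p + 2 ^ Suc h) (s n) A2 c2"
    "inj_on f (A1 \<union> A2)" "\<And>y. y \<in> A1 \<union> A2 \<Longrightarrow> s keys y = f y"
  shows "exec (recomp n h p) s = put s n p (winner f (A1 \<union> A2))"
proof -
  have r: "finite A1" "finite A2" "s n (p + 1) = winner f A1" "s n (p + 2 ^ Suc h) = winner f A2"
    using trep_root assms by blast+
  have k: "s (Q 10) (winner f A1 - Suc 0) = f (winner f A1 - Suc 0)" if "A1 \<noteq> {}"
    using that assms(4) argmin_in[of A1 f] r by (simp add: winner_def keys_def)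
  have k': "s (Q 10) (winner f A2 - Suc 0) = f (winner f A2 - Suc 0)" if "A2 \<noteq> {}"
    using that assms(4) argmin_in[of A2 f] r by (simp add: winner_def keys_def)
  have z: "winner f A = 0 \<longleftrightarrow> A = {}" for A by (simp add: winner_def)
  show ?thesis
    using r(3,4) k k' unfolding winner_Un[OF r(1,2) assms(3)]
    by (auto simp: recomp_def z simp del: put_apply power_Suc)
qed

lemma trep_join:
  assumes "trep f h (p + 1) v A1 (min c (2 ^ h))" "trep f h (p + 2 ^ Suc h) v A2 (c - 2 ^ h)"
    "A1 \<inter> A2 = {}"
  shows "trep f (Suc h) p (v(p := winner f (A1 \<union> A2))) (A1 \<union> A2) c"
proof -
  have "trep f h (p + 1) (v(p := winner f (A1 \<union> A2))) A1 (min c (2 ^ h))"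
    by (rule trep_cong[OF assms(1)]) auto
  moreover have "trep f h (p + 2 ^ Suc h) (v(p := winner f (A1 \<union> A2))) A2 (c - 2 ^ h)"
    by (rule trep_cong[OF assms(2)]) auto
  ultimately show ?thesis using assms(3) by fastforce
qed

lemma power2_pos: "\<exists>x. (2::nat) ^ h = Suc x"
  by (intro gr0_implies_Suc) simp

lemma ins_correct:
  assumes "trep f h p (s n) A j" "j < 2 ^ h" "s scratch 2 = Suc y" "y \<notin> A" "inj_on f (insert y A)"
    "\<And>y'. y' \<in> insert y A \<Longrightarrow> s keys y' = f y'" "n \<noteq> keys" "n \<noteq> scratch"
  shows "trep f h p (exec (ins n h p j) s n) (insert y A) (Suc j) \<and>
    (\<forall>z. z < p \<or> p + 2 ^ Suc h \<le> z + 1 \<longrightarrow> exec (ins n h p j) s n z = s n z)"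
  using assms
proof (induction h arbitrary: p A j)
  case 0
  then show ?case by auto
next
  case (Suc h)
  let ?l = "p + 1" and ?r = "p + 2 ^ Suc h"
  from Suc.prems(1) obtain A1 A2 where A: "A = A1 \<union> A2" "A1 \<inter> A2 = {}"
    "trep f h ?l (s n) A1 (min j (2 ^ h))" "trep f h ?r (s n) A2 (j - 2 ^ h)"
    by auto
  show ?case
  proof (cases "j < 2 ^ h")
    case True
    define s' where "s' = exec (ins n h ?l j) s"
    have IH: "trep f h ?l (s' n) (insert y A1) (Suc j)"
      "\<And>z. z < ?l \<or> ?l + 2 ^ Suc h \<le> z + 1 \<Longrightarrow> s' n z = s n z"
      using Suc.IH[of ?l A1 j] A Suc.prems True unfolding s'_def by (auto intro: inj_on_subset)
    have fr: "s' m = s m" if "m \<noteq> n" for m using exec_frame[of m "ins n h ?l j" s] that s'_def by simp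
    have r: "trep f h ?r (s' n) A2 (j - 2 ^ h)"
      by (rule trep_cong[OF A(4)]) (use IH(2) in auto)
    have U: "insert y A1 \<union> A2 = insert y A" using A by auto
    have e: "exec (ins n (Suc h) p j) s = put s' n p (winner f (insert y A))"
      
    proof -
      have "exec (ins n (Suc h) p j) s = exec (recomp n h p) s'" using True by (simp add: s'_def del: eval_ne)
      also have "\<dots> = put s' n p (winner f (insert y A))"
        using exec_recomp[of f h p s' n "insert y A1" "Suc j" A2 "j - 2 ^ h", OF IH(1) r] Suc.prems fr unfolding U by (simp add: inj_on_diff)
      finally show ?thesis .
    qed
    have "trep f (Suc h) p (exec (ins n (Suc h) p j) s n) (insert y A) (Suc j)"
      unfolding e using trep_join[of f h p "s' n" "insert y A1" "Suc j" A2] IH(1) r U True A Suc.prems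
      by (simp add: min_def del: trep.simps)
    moreover have "exec (ins n (Suc h) p j) s n z = s n z" if "z < p \<or> p + 2 ^ Suc (Suc h) \<le> z + 1" for z
      using that IH(2)[of z] power2_pos[of h] unfolding e by auto
    ultimately show ?thesis by blast
  next
    case False
    define s' where "s' = exec (ins n h ?r (j - 2 ^ h)) s"
    have IH: "trep f h ?r (s' n) (insert y A2) (Suc (j - 2 ^ h))"
      "\<And>z. z < ?r \<or> ?r + 2 ^ Suc h \<le> z + 1 \<Longrightarrow> s' n z = s n z"
    proof -
      have j: "j - 2 ^ h < 2 ^ h" using Suc.prems(2) False by simp
      have y: "y \<notin> A2" using Suc.prems(4) A by simp
      have i: "inj_on f (insert y A2)" by (rule inj_on_subset[OF Suc.prems(5)]) (use A in auto)
      show "trep f h ?r (s' n) (insert y A2) (Suc (j - 2 ^ h))"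
        "\<And>z. z < ?r \<or> ?r + 2 ^ Suc h \<le> z + 1 \<Longrightarrow> s' n z = s n z"
        using Suc.IH[OF A(4) j Suc.prems(3) y i] Suc.prems(6-) A(1) unfolding s'_def by blast+
    qed
    have fr: "s' m = s m" if "m \<noteq> n" for m
      using exec_frame[of m "ins n h ?r (j - 2 ^ h)" s] that s'_def by simp
    have l: "trep f h ?l (s' n) A1 (min j (2 ^ h))"
      by (rule trep_cong[OF A(3)]) (use IH(2) in auto)
    have U: "A1 \<union> insert y A2 = insert y A" using A by auto
    have e: "exec (ins n (Suc h) p j) s = put s' n p (winner f (insert y A))"
      
    proof -
      have "exec (ins n (Suc h) p j) s = exec (recomp n h p) s'" using False by (simp add: s'_def del: eval_ne)
      also have "\<dots> = put s' n p (winner f (insert y A))"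
        using exec_recomp[of f h p s' n A1 "min j (2 ^ h)" "insert y A2" "Suc (j - 2 ^ h)", OF l IH(1)] Suc.prems fr unfolding U by (simp add: inj_on_diff)
      finally show ?thesis .
    qed
    have m: "min (Suc j) (2 ^ h) = min j (2 ^ h)" "Suc j - 2 ^ h = Suc (j - 2 ^ h)" using False by auto
    have "trep f (Suc h) p (exec (ins n (Suc h) p j) s n) (insert y A) (Suc j)"
      unfolding e using trep_join[of f h p "s' n" A1 "Suc j" "insert y A2"] IH(1) l U A Suc.prems
      by (simp add: m del: trep.simps)
    moreover have "exec (ins n (Suc h) p j) s n z = s n z" if "z < p \<or> p + 2 ^ Suc (Suc h) \<le> z + 1" for z
      using that IH(2)[of z] power2_pos[of h] unfolding e by auto
    ultimately show ?thesis by blast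
  qed
qed

lemma ext_correct:
  assumes "trep f h p (s n) A c" "A \<noteq> {}" "inj_on f A"
    "\<And>y'. y' \<in> A \<Longrightarrow> s keys y' = f y'" "n \<noteq> keys"
  shows "trep f h p (exec (ext n h p) s n) (A - {argmin f A}) c \<and>
    (\<forall>z. z < p \<or> p + 2 ^ Suc h \<le> z + 1 \<longrightarrow> exec (ext n h p) s n z = s n z)"
  using assms
proof (induction h arbitrary: p A c)
  case 0
  then show ?case by (auto simp: argmin_def sorted_by_def split: if_splits)
next
  case (Suc h)
  let ?l = "p + 1" and ?r = "p + 2 ^ Suc h"
  from Suc.prems(1) obtain A1 A2 where A: "A = A1 \<union> A2" "A1 \<inter> A2 = {}"
    "trep f h ?l (s n) A1 (min c (2 ^ h))" "trep f h ?r (s n) A2 (c - 2 ^ h)" "s n p = winner f A"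
    by auto
  have fin: "finite A1" "finite A2" "s n ?l = winner f A1" using trep_root[OF A(3)] trep_root[OF A(4)] by auto
  have mA: "argmin f A \<in> A" using Suc.prems fin A by (intro argmin_in) auto
  show ?case
  proof (cases "argmin f A \<in> A1")
    case True
    have m: "argmin f A1 = argmin f A"
      using True Suc.prems fin A argmin_le[of A _ f] by (intro argmin_eqI) (auto intro: inj_on_subset)
    have g: "eval (ne (Vr n p) (Vr n ?l)) s = 0"
      using True A fin m Suc.prems by (auto simp: winner_def)
    define s' where "s' = exec (ext n h ?l) s"
    have IH: "trep f h ?l (s' n) (A1 - {argmin f A}) (min c (2 ^ h))"
      "\<And>z. z < ?l \<or> ?l + 2 ^ Suc h \<le> z + 1 \<Longrightarrow> s' n z = s n z"
      using Suc.IH[of ?l A1 "min c (2 ^ h)"] A Suc.prems True m unfolding s'_def by (auto intro: inj_on_subset)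
    have fr: "s' q = s q" if "q \<noteq> n" for q using exec_frame[of q "ext n h ?l" s] that s'_def by simp
    have r: "trep f h ?r (s' n) A2 (c - 2 ^ h)"
      by (rule trep_cong[OF A(4)]) (use IH(2) in auto)
    have U: "(A1 - {argmin f A}) \<union> A2 = A - {argmin f A}" using A True by auto
    have e: "exec (ext n (Suc h) p) s = put s' n p (winner f (A - {argmin f A}))"
      
    proof -
      have "exec (ext n (Suc h) p) s = exec (recomp n h p) s'" using g by (simp add: s'_def del: eval_ne)
      also have "\<dots> = put s' n p (winner f (A - {argmin f A}))"
        using exec_recomp[of f h p s' n "A1 - {argmin f A}" "min c (2 ^ h)" A2 "c - 2 ^ h", OF IH(1) r] Suc.prems fr unfolding U by (simp add: inj_on_diff)
      finally show ?thesis .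
    qed
    have "trep f (Suc h) p (exec (ext n (Suc h) p) s n) (A - {argmin f A}) c"
    proof -
      have "(A1 - {argmin f A}) \<inter> A2 = {}" using A by auto
      from trep_join[OF IH(1) r this] show ?thesis unfolding e U by (simp del: trep.simps)
    qed
    moreover have "exec (ext n (Suc h) p) s n z = s n z" if "z < p \<or> p + 2 ^ Suc (Suc h) \<le> z + 1" for z
      using that IH(2)[of z] power2_pos[of h] unfolding e by auto
    ultimately show ?thesis by blast
  next
    case False
    then have T: "argmin f A \<in> A2" using mA A by auto
    have m: "argmin f A2 = argmin f A"
      using T Suc.prems fin A argmin_le[of A _ f] by (intro argmin_eqI) (auto intro: inj_on_subset)
    have g: "eval (ne (Vr n p) (Vr n ?l)) s \<noteq> 0"
    proof -
      have "winner f A \<noteq> winner f A1"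
        using False Suc.prems(2) argmin_in[OF fin(1), of f] by (cases "A1 = {}") (auto simp: winner_def)
      then show ?thesis unfolding eval_ne using A(5) fin(3) by simp
    qed
    define s' where "s' = exec (ext n h ?r) s"
    have IH: "trep f h ?r (s' n) (A2 - {argmin f A}) (c - 2 ^ h)"
      "\<And>z. z < ?r \<or> ?r + 2 ^ Suc h \<le> z + 1 \<Longrightarrow> s' n z = s n z"
      using Suc.IH[of ?r A2 "c - 2 ^ h"] A Suc.prems T m unfolding s'_def by (auto intro: inj_on_subset)
    have fr: "s' q = s q" if "q \<noteq> n" for q using exec_frame[of q "ext n h ?r" s] that s'_def by simp
    have l: "trep f h ?l (s' n) A1 (min c (2 ^ h))"
      by (rule trep_cong[OF A(3)]) (use IH(2) in auto)
    have U: "A1 \<union> (A2 - {argmin f A}) = A - {argmin f A}" using A T False by auto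
    have e: "exec (ext n (Suc h) p) s = put s' n p (winner f (A - {argmin f A}))"
      
    proof -
      have "exec (ext n (Suc h) p) s = exec (recomp n h p) s'" using g by (simp add: s'_def del: eval_ne)
      also have "\<dots> = put s' n p (winner f (A - {argmin f A}))"
        using exec_recomp[of f h p s' n A1 "min c (2 ^ h)" "A2 - {argmin f A}" "c - 2 ^ h", OF l IH(1)] Suc.prems fr unfolding U by (simp add: inj_on_diff)
      finally show ?thesis .
    qed
    have "trep f (Suc h) p (exec (ext n (Suc h) p) s n) (A - {argmin f A}) c"
    proof -
      have "A1 \<inter> (A2 - {argmin f A}) = {}" using A by auto
      from trep_join[OF l IH(1) this] show ?thesis unfolding e U by (simp del: trep.simps)
    qed
    moreover have "exec (ext n (Suc h) p) s n z = s n z" if "z < p \<or> p + 2 ^ Suc (Suc h) \<le> z + 1" for z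
      using that IH(2)[of z] power2_pos[of h] unfolding e by auto
    ultimately show ?thesis by blast
  qed
qed

lemma wc_ins: "wc L (ins n h p j) \<le> 40 * Suc h"
proof (induction h arbitrary: p j)
  case (Suc h)
  show ?case using Suc[of "Suc p" j] Suc[of "p + 2 * 2 ^ h" "j - 2 ^ h"] by (simp add: recomp_def)
qed simp

lemma wc_ext: "wc L (ext n h p) \<le> 60 * Suc h"
proof (induction h arbitrary: p)
  case (Suc h)
  show ?case using Suc[of "Suc p"] Suc[of "p + 2 * 2 ^ h"] by (simp add: recomp_def)
qed simp

lemma okc_ins: "okn L n \<Longrightarrow> (-) \<in> F \<Longrightarrow> okc L F (ins n h p j)"
  by (induction h arbitrary: p j) (auto simp: recomp_def scratch_def)

lemma okc_ext: "okn L n \<Longrightarrow> (+) \<in> F \<Longrightarrow> (-) \<in> F \<Longrightarrow> okc L F (ext n h p)"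
  by (induction h arbitrary: p) (auto simp: recomp_def)

section \<open>Insertions and deletions of the minimum\<close>

text \<open>The item inserted by the operation at time \<open>y\<close> is called \<open>y\<close>; \<open>VD\<close> deletes the item that is
  predicted to be deleted first.\<close>

datatype vop = VI nat nat | VD

definition key :: "(nat \<Rightarrow> vop) \<Rightarrow> nat \<Rightarrow> nat" where
  "key g y = (case g y of VI e p \<Rightarrow> p | VD \<Rightarrow> 0)"

definition elem :: "(nat \<Rightarrow> vop) \<Rightarrow> nat \<Rightarrow> nat" where
  "elem g y = (case g y of VI e p \<Rightarrow> e | VD \<Rightarrow> 0)"

fun alive :: "(nat \<Rightarrow> vop) \<Rightarrow> nat \<Rightarrow> nat set" where
  "alive g 0 = {}"
| "alive g (Suc t) = (case g t of VI e p \<Rightarrow> insert t (alive g t) | VD \<Rightarrow> alive g t - {argmin (key g) (alive g t)})"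

definition good :: "(nat \<Rightarrow> vop) \<Rightarrow> nat \<Rightarrow> bool" where
  "good g t \<longleftrightarrow> (\<forall>u\<le>t. inj_on (key g) (alive g u)) \<and> (\<forall>u<t. g u = VD \<longrightarrow> alive g u \<noteq> {})"

lemma alive_less: "y \<in> alive g t \<Longrightarrow> y < t"
  by (induction t) (auto split: vop.splits simp: less_Suc_eq)

lemma alive_VI: "y \<in> alive g t \<Longrightarrow> \<exists>e p. g y = VI e p"
  by (induction t) (auto split: vop.splits)

lemma finite_alive [simp]: "finite (alive g t)"
  by (rule finite_subset[of _ "{..<t}"]) (auto dest: alive_less)

lemma alive_mono: "y \<in> alive g t' \<Longrightarrow> y < t \<Longrightarrow> t \<le> t' \<Longrightarrow> y \<in> alive g t"
proof (induction t')
  case (Suc t')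
  then show ?case by (cases "t = Suc t'") (auto split: vop.splits)
qed simp

lemma inj_alive: "good g t \<Longrightarrow> u \<le> t \<Longrightarrow> inj_on (key g) (alive g u)"
  by (simp add: good_def)

lemma good_mono: "good g t \<Longrightarrow> u \<le> t \<Longrightarrow> good g u"
  by (simp add: good_def)

text \<open>Each step deletes at most one item, the minimum. While a member of \<open>Y\<close> is
  left, \<open>x\<close> is not the minimum; and \<open>Y\<close> loses at most one member per step,
  hence outlasts the \<open>t - B\<close> steps.\<close>

lemma survives:
  assumes "good g t" "B \<le> t" "x \<in> alive g B" "Y \<subseteq> alive g B" "\<And>y. y \<in> Y \<Longrightarrow> key g y < key g x" "t - B < card Y"
  shows "x \<in> alive g t"
proof -
  have "x \<in> alive g u \<and> card Y \<le> card (Y \<inter> alive g u) + (u - B)" if "B \<le> u" "u \<le> t" for u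
    using that
  proof (induction u rule: dec_induct)
    case base
    then show ?case using assms(3,4) by (simp add: Int_absorb2)
  next
    case (step u)
    have IH: "x \<in> alive g u" "card Y \<le> card (Y \<inter> alive g u) + (u - B)" using step by auto
    have fY: "finite Y" by (rule finite_subset[OF assms(4)]) simp
    show ?case
    proof (cases "g u")
      case (VI e p)
      have "card (Y \<inter> alive g u) \<le> card (Y \<inter> alive g (Suc u))"
        by (rule card_mono) (use fY VI in auto)
      then show ?thesis using IH VI by auto
    next
      case VD
      let ?m = "argmin (key g) (alive g u)"
      have "card (Y \<inter> alive g u) > 0" using IH(2) assms(6) step by auto
      then obtain y where y: "y \<in> Y" "y \<in> alive g u" by (metis card_gt_0_iff ex_in_conv IntE)
      have "key g ?m \<le> key g y" using argmin_le y by auto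
      then have "?m \<noteq> x" using assms(5)[OF y(1)] by auto
      moreover have "card (Y \<inter> alive g u) \<le> Suc (card (Y \<inter> alive g u - {?m}))"
        using fY by (simp add: card_Diff_singleton_if) arith
      moreover have "Y \<inter> alive g (Suc u) = Y \<inter> alive g u - {?m}" using VD by auto
      ultimately show ?thesis using IH VD step by auto
    qed
  qed
  then show ?thesis using assms by blast
qed

section \<open>The hierarchy of nodes\<close>

text \<open>Node \<open>(i, k)\<close> serves the times from \<open>k 2\<^sup>i\<close> to \<open>(k + 1) 2\<^sup>i\<close>. It is determined by the items present
  at time \<open>(k - 2) 2\<^sup>i\<close> and extends its parent \<open>(i + 1, k div 2)\<close> by all but the \<open>4 2\<^sup>i\<close> smallest of the
  remaining items, so that its items are not deleted while it is in use.\<close>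

definition start :: "nat \<Rightarrow> nat \<Rightarrow> nat" where
  "start i k = (k - 2) * 2 ^ i"

function items :: "(nat \<Rightarrow> vop) \<Rightarrow> nat \<Rightarrow> nat \<Rightarrow> nat list" where
  "items g i k = (if k < 2 then [] else items g (Suc i) (k div 2) @
     drop (4 * 2 ^ i) (sorted_by (key g) (alive g (start i k) - set (items g (Suc i) (k div 2)))))"
  by auto
termination by (relation "measure (\<lambda>(g, i, k). k)") auto

declare items.simps [simp del]

definition pool :: "(nat \<Rightarrow> vop) \<Rightarrow> nat \<Rightarrow> nat \<Rightarrow> nat list" where
  "pool g i k = (if k < 2 then [] else sorted_by (key g) (alive g (start i k) - set (items g (Suc i) (k div 2))))"

lemma items_null [simp]: "k < 2 \<Longrightarrow> items g i k = []"
  by (simp add: items.simps)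

lemma pool_null [simp]: "k < 2 \<Longrightarrow> pool g i k = []"
  by (simp add: pool_def)

lemma items_eq: "2 \<le> k \<Longrightarrow> items g i k = items g (Suc i) (k div 2) @ drop (4 * 2 ^ i) (pool g i k)"
  by (subst items.simps) (simp add: pool_def)

lemma set_pool: "2 \<le> k \<Longrightarrow> set (pool g i k) = alive g (start i k) - set (items g (Suc i) (k div 2))"
  by (simp add: pool_def)

lemma distinct_pool [simp]: "distinct (pool g i k)"
  by (simp add: pool_def)

lemma inj_pool: "good g (start i k) \<Longrightarrow> inj_on (key g) (set (pool g i k))"
  by (cases "k < 2") (auto simp: set_pool intro: inj_on_subset[OF inj_alive])

lemma sorted_pool: "sorted (map (key g) (pool g i k))"
  by (simp add: pool_def)

text \<open>For \<open>4 <= k\<close> the numbers \<open>k - 2\<close> and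
  \<open>2 * (k div 2 - 2)\<close> differ by 2 or 3. This is the origin of the
  \<open>3 * 2^i\<close> newer candidates.\<close>

lemma start_parent: "start (Suc i) (k div 2) \<le> start i k" "start i k \<le> start (Suc i) (k div 2) + 3 * 2 ^ i"
proof -
  have "(k div 2 - 2) * 2 \<le> k - 2" "k - 2 \<le> (k div 2 - 2) * 2 + 3" by linarith+
  then have "(k div 2 - 2) * 2 * 2 ^ i \<le> (k - 2) * 2 ^ i" "(k - 2) * 2 ^ i \<le> ((k div 2 - 2) * 2 + 3) * 2 ^ i"
    by (intro mult_right_mono; simp)+
  then show "start (Suc i) (k div 2) \<le> start i k" "start i k \<le> start (Suc i) (k div 2) + 3 * 2 ^ i"
    by (auto simp: start_def algebra_simps)
qed

lemma end_parent: "((k::nat) + 1) * 2 ^ i \<le> (k div 2 + 1) * 2 ^ Suc i"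
proof -
  have "k + 1 \<le> (k div 2 + 1) * 2" by presburger
  then have "(k + 1) * 2 ^ i \<le> (k div 2 + 1) * 2 * 2 ^ i" by (intro mult_right_mono; simp)
  then show ?thesis by (simp add: algebra_simps)
qed

lemma start_le_end: "start i k \<le> (k + 1) * 2 ^ i"
  unfolding start_def by (intro mult_right_mono) auto

text \<open>Inherited items are safe by induction, since the life of the parent contains that of the
  node. The node's own items are shielded by the first part of its pool, which is smaller in the
  order of keys and too large to be exhausted in time.\<close>

lemma items_safe:
  assumes "good g t" "start i k \<le> t" "t \<le> (k + 1) * 2 ^ i"
  shows "set (items g i k) \<subseteq> alive g t"
  using assms
proof (induction k arbitrary: i rule: less_induct)
  case (less k)
  show ?case
  proof (cases "k < 2")
    case False
    have "set (items g (Suc i) (k div 2)) \<subseteq> alive g t"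
      using False less.prems start_parent(1)[of i k] end_parent[of k i] by (intro less.IH) auto
    moreover have "set (drop (4 * 2 ^ i) (pool g i k)) \<subseteq> alive g t"
    proof
      fix x assume x: "x \<in> set (drop (4 * 2 ^ i) (pool g i k))"
      let ?Y = "take (4 * 2 ^ i) (pool g i k)"
      have "length ?Y = 4 * 2 ^ i" using x by (cases "4 * 2 ^ i \<le> length (pool g i k)") auto
      then have cY: "card (set ?Y) = 4 * 2 ^ i" using distinct_card[of ?Y] by simp
      have xs: "x \<in> set (pool g i k)" using x in_set_dropD by fastforce
      have Ys: "set ?Y \<subseteq> set (pool g i k)" by (rule set_take_subset)
      have "key g y < key g x" if y: "y \<in> set ?Y" for y
      proof -
        have "sorted (map (key g) (?Y @ drop (4 * 2 ^ i) (pool g i k)))" using sorted_pool by simp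
        then have "key g y \<le> key g x" using y x by (auto simp: sorted_append simp del: append_take_drop_id)
        moreover have "x \<noteq> y"
          using distinct_pool[of g i k] x y by (metis append_take_drop_id disjoint_iff distinct_append)
        then have "key g x \<noteq> key g y"
          using inj_pool[of g i k] good_mono[OF less.prems(1,2)] xs y Ys by (auto dest: inj_onD)
        ultimately show ?thesis by simp
      qed
      \<comment> \<open>From the snapshot to the end of service there are \<open>3 * 2^i\<close>
        steps; the shield has \<open>4 * 2^i\<close> items. The slack is what makes the inequality
        strict.\<close>
      moreover have "t - start i k < card (set ?Y)"
      proof -
        have "t \<le> start i k + 3 * 2 ^ i" using less.prems(3) False
          by (simp add: start_def add_mult_distrib[symmetric] )
        then show ?thesis unfolding cY using power2_pos[of i] by auto
      qed
      ultimately show "x \<in> alive g t"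
        using less.prems xs Ys set_pool[of k g i] False
        by (intro survives[of g t "start i k" x "set ?Y"]) auto
    qed
    ultimately show ?thesis using False by (simp add: items_eq)
  qed simp
qed

lemma items_start: "good g (start i k) \<Longrightarrow> set (items g i k) \<subseteq> alive g (start i k)"
  using start_le_end[of i k] by (intro items_safe) auto

lemma items_parent_start: "good g (start i k) \<Longrightarrow> set (items g (Suc i) (k div 2)) \<subseteq> alive g (start i k)"
  using start_parent(1)[of i k] end_parent[of k i] start_le_end[of i k]
  by (intro items_safe) auto

lemma distinct_items: "good g (start i k) \<Longrightarrow> distinct (items g i k)"
proof (induction k arbitrary: i rule: less_induct)
  case (less k)
  show ?case
  proof (cases "k < 2")
    case False
    have "distinct (items g (Suc i) (k div 2))"
      using less.IH[of "k div 2" "Suc i"] good_mono[OF less.prems start_parent(1)] False by auto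
    then show ?thesis using False set_pool[of k g i] by (auto simp: items_eq dest: in_set_dropD)
  qed simp
qed

text \<open>An item outside the parent that was present at the parent's snapshot was in the parent's
  pool but not among those taken, so it is one of the first \<open>4 * 2^(i+1) = 8 * 2^i\<close>;
  any other is newer than that snapshot. So a node is built from \<open>O(2^i)\<close> candidates
  without looking at all present items.\<close>

lemma set_pool_sources:
  assumes "2 \<le> k" "good g (start i k)"
  shows "set (pool g i k) = alive g (start i k) \<inter>
    (set (take (8 * 2 ^ i) (pool g (Suc i) (k div 2))) \<union> {start (Suc i) (k div 2)..<start i k})"
proof -
  let ?B = "start i k" and ?B' = "start (Suc i) (k div 2)" and ?k = "k div 2"
  have g: "good g ?B'" using good_mono assms(2) start_parent(1) by blast
  have m: "x \<in> alive g ?B'" if "x \<in> alive g ?B" "x < ?B'" for x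
    using alive_mono[OF that] start_parent(1) by blast
  show ?thesis
  proof (cases "?k < 2")
    case True
    then show ?thesis using set_pool[OF assms(1)] alive_less[of _ g ?B] by (auto simp: start_def)
  next
    case False
    have d: "set (take (8 * 2 ^ i) (pool g (Suc i) ?k)) \<inter> set (drop (8 * 2 ^ i) (pool g (Suc i) ?k)) = {}"
      using distinct_pool[of g "Suc i" ?k] by (metis append_take_drop_id distinct_append)
    have l: "set (items g (Suc i) ?k) = set (items g (Suc (Suc i)) (?k div 2)) \<union> set (drop (8 * 2 ^ i) (pool g (Suc i) ?k))"
      using False by (simp add: items_eq[of ?k])
    have t: "set (pool g (Suc i) ?k) = set (take (8 * 2 ^ i) (pool g (Suc i) ?k)) \<union> set (drop (8 * 2 ^ i) (pool g (Suc i) ?k))"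
      by (metis append_take_drop_id set_append)
    have c: "set (pool g (Suc i) ?k) = alive g ?B' - set (items g (Suc (Suc i)) (?k div 2))"
      using False set_pool by simp
    have lb: "set (items g (Suc i) ?k) \<subseteq> alive g ?B'" using items_start[OF g] .
    have "x \<in> set (take (8 * 2 ^ i) (pool g (Suc i) ?k))" if "x \<in> alive g ?B" "x \<notin> set (items g (Suc i) ?k)" "x < ?B'" for x
      using that m[of x] l t c by auto
    moreover have "x \<notin> set (items g (Suc i) ?k)" if "x \<in> set (take (8 * 2 ^ i) (pool g (Suc i) ?k))" for x
      using that d l t c by auto
    moreover have "x \<notin> set (items g (Suc i) ?k)" if "?B' \<le> x" for x
      using that lb alive_less by fastforce
    ultimately have "x \<notin> set (items g (Suc i) ?k) \<longleftrightarrow>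
        x \<in> set (take (8 * 2 ^ i) (pool g (Suc i) ?k)) \<union> {?B'..<?B}" if "x \<in> alive g ?B" for x
      using alive_less[OF that] that by (cases "x < ?B'") auto
    then show ?thesis unfolding set_pool[OF assms(1)] by blast
  qed
qed

text \<open>\<open>8 * 2^i\<close> left by the parent plus \<open>3 * 2^i\<close> newer ones. Hence
  \<open>11 * 2^i\<close> extractions empty the tree, and \<open>2^(i+4)\<close> leaves are
  enough.\<close>

lemma length_pool:
  assumes "good g (start i k)"
  shows "length (pool g i k) \<le> 11 * 2 ^ i"
proof (cases "k < 2")
  case False
  let ?B' = "start (Suc i) (k div 2)"
  have "length (pool g i k) = card (set (pool g i k))" by (simp add: distinct_card)
  also have "\<dots> \<le> card (set (take (8 * 2 ^ i) (pool g (Suc i) (k div 2))) \<union> {?B'..<start i k})"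
    using set_pool_sources[of k g i] False assms by (intro card_mono) auto
  also have "\<dots> \<le> 8 * 2 ^ i + 3 * 2 ^ i"
    using start_parent(2)[of i k] card_length[of "take (8 * 2 ^ i) (pool g (Suc i) (k div 2))"]
    by (intro le_trans[OF card_Un_le] add_mono) auto
  finally show ?thesis by simp
qed simp

lemma alive_cong: "(\<And>u. u < t \<Longrightarrow> g u = g' u) \<Longrightarrow> alive g t = alive g' t"
proof (induction t)
  case (Suc t)
  have "key g y = key g' y" if "y \<in> alive g' t" for y
    using Suc.prems alive_less[OF that] by (simp add: key_def)
  then have "argmin (key g) (alive g' t) = argmin (key g') (alive g' t)"
    unfolding argmin_def by (intro arg_cong[of _ _ hd] sorted_by_cong) auto
  then show ?case using Suc by (auto split: vop.split)
qed simp

text \<open>Operations arrive online, and a sequence \<open>g\<close> is prolonged as they come;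
  nodes whose snapshot lies in the past must not depend on how it goes on.\<close>

lemma items_cong:
  assumes "\<And>u. u < t \<Longrightarrow> g u = g' u" "start i k \<le> t"
  shows "items g i k = items g' i k \<and> pool g i k = pool g' i k"
  using assms(2)
proof (induction k arbitrary: i rule: less_induct)
  case (less k)
  show ?case
  proof (cases "k < 2")
    case False
    have 1: "items g (Suc i) (k div 2) = items g' (Suc i) (k div 2)"
      using less.IH[of "k div 2" "Suc i"] False less.prems start_parent(1)[of i k] by auto
    have 2: "alive g (start i k) = alive g' (start i k)" using assms(1) less.prems by (intro alive_cong) auto
    have "pool g i k = pool g' i k"
    proof -
      have "key g y = key g' y" if "y \<in> alive g' (start i k)" for y
        using assms(1) less.prems alive_less[OF that] by (simp add: key_def)
      then show ?thesis using False 1 2 by (auto simp: pool_def intro!: sorted_by_cong)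
    qed
    then show ?thesis using False 1 by (simp add: items_eq)
  qed simp
qed

definition amem :: "program \<Rightarrow> nat \<Rightarrow> (nat \<Rightarrow> vop) \<Rightarrow> nat list \<Rightarrow> mem" where
  "amem P f g ys = foldl (\<lambda>m y. frun P f 0 (m(0 := elem g y))) (\<lambda>_. 0) ys"

lemma amem_Nil [simp]: "amem P f g [] = (\<lambda>_. 0)"
  by (simp add: amem_def)

lemma amem_snoc: "amem P f g (ys @ [y]) = frun P f 0 ((amem P f g ys)(0 := elem g y))"
  by (simp add: amem_def)

lemma amem_cong: "(\<And>y. y \<in> set ys \<Longrightarrow> g y = g' y) \<Longrightarrow> amem P f g ys = amem P f g' ys"
  by (induction ys rule: rev_induct) (auto simp: amem_snoc elem_def)

section \<open>Construction of a node\<close>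

text \<open>The path towards the root. Intervals with index below 2 have no node, as their snapshot
  would lie before time 0.\<close>

function chain :: "nat \<Rightarrow> nat \<Rightarrow> nm list" where
  "chain i k = (if k < 2 then [] else W 0 i k # chain (Suc i) (k div 2))"
  by auto
termination by (relation "measure (\<lambda>(i, k). k)") auto

declare chain.simps [simp del]

lemma chain_null [simp]: "k < 2 \<Longrightarrow> chain i k = []"
  by (simp add: chain.simps)

lemma chain_eq: "2 \<le> k \<Longrightarrow> chain i k = W 0 i k # chain (Suc i) (k div 2)"
  by (simp add: chain.simps[of i k])

lemma chain_mem: "n \<in> set (chain i k) \<Longrightarrow> \<exists>d. n = W 0 (i + d) (k div 2 ^ d) \<and> 2 \<le> k div 2 ^ d"
proof (induction k arbitrary: i rule: less_induct)
  case (less k)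
  show ?case
  proof (cases "k < 2")
    case False
    consider "n = W 0 i k" | "n \<in> set (chain (Suc i) (k div 2))"
      using less.prems False by (auto simp: chain_eq)
    then show ?thesis
    proof cases
      case 1
      then show ?thesis using False by (intro exI[of _ 0]) auto
    next
      case 2
      then obtain d where "n = W 0 (Suc i + d) (k div 2 div 2 ^ d)" "2 \<le> k div 2 div 2 ^ d"
        using less.IH[of "k div 2" "Suc i"] False by auto
      then show ?thesis by (intro exI[of _ "Suc d"]) (auto simp: div_mult2_eq)
    qed
  qed (use less.prems in simp)
qed

lemma chain_level: "n \<in> set (chain i k) \<Longrightarrow> \<exists>i' k'. n = W 0 i' k' \<and> i \<le> i' \<and> 2 \<le> k'"
  using chain_mem by (metis le_add1)

lemma first_cong: "(\<And>n. n \<in> set ns \<Longrightarrow> s n = s' n) \<Longrightarrow> first s ns a = first s' ns a"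
  by (induction ns) auto

text \<open>Node \<open>(i, k)\<close> uses the arrays \<open>W 0 i k\<close> (memory of the simulated algorithm; \<open>v + 1\<close> stands for \<open>v\<close>, and
  \<open>0\<close> for a cell inherited from the parent), \<open>W 1 i k\<close> (\<open>i + 1\<close> at the written cells), \<open>W 2 i k\<close> (the items left
  to the children), \<open>W 3 i k\<close> (a tournament tree) and \<open>W 4 i k\<close> (a log of the written addresses).
  \<open>W 5 0 0\<close> is a tournament tree of all items present. \<open>Q 2\<close>, \<open>Q 3\<close>, \<open>Q 4\<close> form the cache,
  \<open>Q 5\<close>, \<open>Q 6\<close> and \<open>Q 7\<close>, \<open>Q 8\<close> are overlays (stamp and value) for the items outside the nodes and for the
  current query. \<open>Q 14\<close> holds the time, the number of queries, and arguments.\<close>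

locale params =
  fixes L G Gq :: nat and A :: inc_alg
begin

abbreviation AM :: "(nat \<Rightarrow> vop) \<Rightarrow> nat list \<Rightarrow> mem" where
  "AM \<equiv> amem (inc_insert A) G"

text \<open>If no node on the path wrote the cell, \<open>Find\<close> gives 0 and the truncated
  subtraction leaves 0, the initial content of the memory.\<close>

definition rdj :: "nat \<Rightarrow> nat \<Rightarrow> ex \<Rightarrow> ex" where
  "rdj i k e = Op (-) (Find (chain i k) e) (K 1)"

text \<open>Command \<open>c\<close> owns the \<open>G + 1\<close> log slots from
  \<open>c * (G + 1)\<close> on, one per write of a call. The tag \<open>i + 1\<close> in
  \<open>W 1 i k\<close> lets a later search over several levels return the level of a hit.\<close>

definition wtj :: "nat \<Rightarrow> nat \<Rightarrow> nat \<Rightarrow> nat \<Rightarrow> com" where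
  "wtj i k c f = Seq (Set (W 0 i k) (Vr scratch 0) (Op (+) (Vr scratch 1) (K 1)))
    (Seq (Set (W 1 i k) (Vr scratch 0) (K (Suc i)))
         (SetV (W 4 i k) (c * (G + 1) + f) (Op (+) (Vr scratch 0) (K 1))))"

text \<open>The command may run long after the snapshot it works for. So it does not ask whether the
  candidate is present now, but whether its recorded deletion time lies after the snapshot.\<close>

definition loadc :: "nat \<Rightarrow> nat \<Rightarrow> nat \<Rightarrow> com" where
  "loadc i k c = Seq (SetV scratch 2 (if c < 8 * 2 ^ i then Vr (W 2 (Suc i) (k div 2)) c
      else if start (Suc i) (k div 2) + (c - 8 * 2 ^ i) < start i k
      then K (Suc (start (Suc i) (k div 2) + (c - 8 * 2 ^ i))) else K 0))
    (If (IfE (Vr scratch 2) (Op (-) (Rd 12 (Op (-) (Vr scratch 2) (K 1))) (K (start i k))) (K 0))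
      (ins (W 3 i k) (i + 4) 0 c) Skip)"

definition extrc :: "nat \<Rightarrow> nat \<Rightarrow> nat \<Rightarrow> com" where
  "extrc i k c = Seq (SetV scratch 2 (Vr (W 3 i k) 0))
    (If (Vr scratch 2)
      (Seq (ext (W 3 i k) (i + 4) 0)
        (if c < 4 * 2 ^ i then SetV (W 2 i k) c (Vr scratch 2)
         else call (rdj i k) (wtj i k c) (inc_insert A) G (Rd 9 (Op (-) (Vr scratch 2) (K 1)))))
      Skip)"

text \<open>There are \<open>8 2\<^sup>i\<close> candidate items left by the parent and at most \<open>3 2\<^sup>i\<close> newer ones; they are
  inserted into the tournament tree and then extracted, the \<open>4 2\<^sup>i\<close> smallest for the children.\<close>

definition job :: "nat \<Rightarrow> nat \<Rightarrow> nat \<Rightarrow> com" where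
  "job i k c = (if c < 11 * 2 ^ i then loadc i k c else extrc i k (c - 11 * 2 ^ i))"

definition cont :: "(nat \<Rightarrow> vop) \<Rightarrow> nat \<Rightarrow> nat \<Rightarrow> nat \<Rightarrow> nat set" where
  "cont g i k c = (if c \<le> 11 * 2 ^ i then alive g (start i k) \<inter>
     (set (take (min c (8 * 2 ^ i)) (pool g (Suc i) (k div 2))) \<union>
      {y. start (Suc i) (k div 2) \<le> y \<and> y - start (Suc i) (k div 2) + 8 * 2 ^ i < c})
     else set (drop (c - 11 * 2 ^ i) (pool g i k)))"

text \<open>Each cell in which the node differs from its parent must be found by reading the slots
  \<open>R\<close>, which are known in advance; this is what the refreshing of the cache relies
  on.\<close>

definition logged :: "nat \<Rightarrow> nat \<Rightarrow> nat set \<Rightarrow> st \<Rightarrow> bool" where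
  "logged i k R s \<longleftrightarrow> (\<forall>a. (s (W 0 i k) a = 0 \<longrightarrow> s (W 1 i k) a = 0) \<and>
     (s (W 0 i k) a \<noteq> 0 \<longrightarrow> s (W 1 i k) a = Suc i \<and> (\<exists>q\<in>R. s (W 4 i k) q = Suc a)))"

text \<open>The state of node \<open>(i, k)\<close> after the first \<open>c\<close> of the \<open>22 2\<^sup>i\<close> commands of its construction.\<close>

definition node_inv :: "(nat \<Rightarrow> vop) \<Rightarrow> nat \<Rightarrow> nat \<Rightarrow> nat \<Rightarrow> st \<Rightarrow> bool" where
  "node_inv g i k c s \<longleftrightarrow>
     trep (key g) (i + 4) 0 (s (W 3 i k)) (cont g i k c) (min c (11 * 2 ^ i)) \<and>
     (\<forall>j. s (W 2 i k) j = (if j < min (c - 11 * 2 ^ i) (4 * 2 ^ i) \<and> j < length (pool g i k)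
        then Suc (pool g i k ! j) else 0)) \<and>
     (if c \<le> 11 * 2 ^ i then (\<forall>a. s (W 0 i k) a = 0)
      else (\<forall>a. first s (chain i k) a - 1 =
        AM g (items g (Suc i) (k div 2) @ drop (4 * 2 ^ i) (take (c - 11 * 2 ^ i) (pool g i k))) a)) \<and>
     logged i k {..<(c - 11 * 2 ^ i) * (G + 1)} s"

text \<open>\<open>Q 9\<close>, \<open>keys\<close> and \<open>Q 12\<close> hold element, predicted and actual deletion time of each item; the latter is
  \<open>2\<^sup>L + 1\<close> as long as the item is present.\<close>

definition item_inv :: "(nat \<Rightarrow> vop) \<Rightarrow> nat \<Rightarrow> st \<Rightarrow> bool" where
  "item_inv g t s \<longleftrightarrow> (\<forall>y<t. \<forall>e p. g y = VI e p \<longrightarrow> s (Q 9) y = e \<and> s keys y = p) \<and>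
     (\<forall>y b. b \<le> t \<longrightarrow> y < b \<longrightarrow> (b < s (Q 12) y \<longleftrightarrow> y \<in> alive g b)) \<and>
     (\<forall>y. s (Q 12) y \<le> t \<or> s (Q 12) y = 2 ^ L + 1) \<and> (\<forall>y\<ge>t. s (Q 12) y = 0)"

lemma item_inv_keys: "item_inv g t s \<Longrightarrow> b \<le> t \<Longrightarrow> y \<in> alive g b \<Longrightarrow> s keys y = key g y \<and> s (Q 9) y = elem g y"
  using alive_VI[of y g b] alive_less[of y g b] by (fastforce simp: item_inv_def key_def elem_def)

lemma cont_full:
  assumes "2 \<le> k" "good g (start i k)"
  shows "cont g i k (11 * 2 ^ i) = set (pool g i k)"
proof -
  have "{y. start (Suc i) (k div 2) \<le> y \<and> y - start (Suc i) (k div 2) + 8 * 2 ^ i < 11 * 2 ^ i} \<inter> alive g (start i k)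
    = {start (Suc i) (k div 2)..<start i k} \<inter> alive g (start i k)"
    using start_parent(2)[of i k] alive_less[of _ g "start i k"] by fastforce
  then show ?thesis
    unfolding set_pool_sources[OF assms] cont_def by (auto simp: min_def)
qed

lemma cont_subset:
  assumes "2 \<le> k"
  shows "cont g i k c \<subseteq> alive g (start i k)"
  using set_pool[OF assms] set_drop_subset[of "c - 11 * 2 ^ i" "pool g i k"] by (auto simp: cont_def)

lemma logged_mono: "logged i k R s \<Longrightarrow> R \<subseteq> R' \<Longrightarrow> logged i k R' s"
  unfolding logged_def by (meson subsetD)

lemma node_inv_load:
  assumes g: "good g t" "start i k \<le> t" "2 \<le> k" and item_inv: "item_inv g t s" and node_inv: "node_inv g i k c s" and c: "c < 11 * 2 ^ i"
    and X: "\<And>j. s (W 2 (Suc i) (k div 2)) j = (if j < 8 * 2 ^ i \<and> j < length (pool g (Suc i) (k div 2))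
      then Suc (pool g (Suc i) (k div 2) ! j) else 0)"
  shows "node_inv g i k (Suc c) (exec (loadc i k c) s)"
proof -
  let ?b = "start i k" and ?b' = "start (Suc i) (k div 2)" and ?csp = "pool g (Suc i) (k div 2)"
  define v where "v = (if c < 8 * 2 ^ i then s (W 2 (Suc i) (k div 2)) c
    else if ?b' + (c - 8 * 2 ^ i) < ?b then Suc (?b' + (c - 8 * 2 ^ i)) else 0)"
  define s1 where "s1 = put s scratch 2 v"
  have gb: "good g ?b" "good g ?b'" using good_mono g start_parent(1)[of i k] le_trans by blast+
  have csp: "x < ?b'" if "x \<in> set ?csp" for x
    using that set_pool[of "k div 2" g "Suc i"] alive_less[of x g ?b'] by (cases "k div 2 < 2") auto
  have v_less: "v - 1 < ?b" if "v \<noteq> 0"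
    using that X[of c] csp[of "?csp ! c"] start_parent(1)[of i k] by (auto simp: v_def split: if_splits)
  have cond: "v \<noteq> 0 \<and> ?b < s (Q 12) (v - 1) \<longleftrightarrow> v \<noteq> 0 \<and> v - 1 \<in> alive g ?b"
    using item_inv v_less g(2) by (auto simp: item_inv_def)
  have ex: "exec (loadc i k c) s = (if v \<noteq> 0 \<and> v - 1 \<in> alive g ?b then exec (ins (W 3 i k) (i + 4) 0 c) s1 else s1)"
  proof -
    have "eval (if c < 8 * 2 ^ i then Vr (W 2 (Suc i) (k div 2)) c
      else if ?b' + (c - 8 * 2 ^ i) < ?b then K (Suc (?b' + (c - 8 * 2 ^ i))) else K 0) s = v"
      by (simp add: v_def)
    note e = this
    have gd: "eval (IfE (Vr scratch 2) (Op (-) (Rd 12 (Op (-) (Vr scratch 2) (K 1))) (K ?b)) (K 0)) s1 = 0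
      \<longleftrightarrow> \<not> (v \<noteq> 0 \<and> ?b < s (Q 12) (v - 1))"
      by (auto simp: s1_def scratch_def)
    show ?thesis
      unfolding loadc_def exec.simps e s1_def[symmetric] gd cond by simp
  qed
  have cont: "cont g i k (Suc c) = (if v \<noteq> 0 \<and> v - 1 \<in> alive g ?b then insert (v - 1) (cont g i k c) else cont g i k c)
    \<and> (v \<noteq> 0 \<longrightarrow> v - 1 \<notin> cont g i k c)"
  proof (cases "c < 8 * 2 ^ i")
    case True
    have e: "{y. ?b' \<le> y \<and> y - ?b' + 8 * 2 ^ i < Suc c} = {}" "{y. ?b' \<le> y \<and> y - ?b' + 8 * 2 ^ i < c} = {}"
      using True by auto
    have m: "min (Suc c) (8 * 2 ^ i) = Suc c" "min c (8 * 2 ^ i) = c" using True by auto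
    have "?csp ! c \<notin> set (take c ?csp)" if "c < length ?csp"
      using distinct_pool[of g "Suc i" "k div 2"] id_take_nth_drop[OF that] by (metis distinct_append IntI disjoint_insert(1) not_distinct_conv_prefix distinct_take take_Suc_conv_app_nth that)
    then show ?thesis
      using c True X[of c] unfolding cont_def e m
      by (cases "c < length ?csp") (auto simp: v_def take_Suc_conv_app_nth)
  next
    case False
    have e: "{y. ?b' \<le> y \<and> y - ?b' + 8 * 2 ^ i < Suc c} = insert (?b' + (c - 8 * 2 ^ i)) {y. ?b' \<le> y \<and> y - ?b' + 8 * 2 ^ i < c}"
      using False by auto
    have m: "min (Suc c) (8 * 2 ^ i) = 8 * 2 ^ i" "min c (8 * 2 ^ i) = 8 * 2 ^ i" using False by auto
    have n: "?b' + (c - 8 * 2 ^ i) \<notin> set (take (8 * 2 ^ i) ?csp)"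
      using csp[of "?b' + (c - 8 * 2 ^ i)"] by (auto dest: in_set_takeD)
    show ?thesis
      using c False n alive_less[of "?b' + (c - 8 * 2 ^ i)" g ?b] unfolding cont_def e m
      by (auto simp: v_def)
  qed
  have tr: "trep (key g) (i + 4) 0 (s (W 3 i k)) (cont g i k c) c"
    using node_inv c by (simp add: node_inv_def)
  \<comment> \<open>A tree of height \<open>i + 4\<close> has \<open>16 * 2^i\<close> leaves, the
    least power of two above the \<open>11 * 2^i\<close> candidates.\<close>
  have h: "c < 2 ^ (i + 4)" using c by (simp add: power_add)
  have sub: "cont g i k (Suc c) \<subseteq> alive g ?b" by (rule cont_subset[OF g(3)])
  have T: "trep (key g) (i + 4) 0 (exec (loadc i k c) s (W 3 i k)) (cont g i k (Suc c)) (Suc c)"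
  proof (cases "v \<noteq> 0 \<and> v - 1 \<in> alive g ?b")
    case True
    have ce: "cont g i k (Suc c) = insert (v - 1) (cont g i k c)" using cont True by simp
    have "trep (key g) (i + 4) 0 (exec (ins (W 3 i k) (i + 4) 0 c) s1 (W 3 i k)) (insert (v - 1) (cont g i k c)) (Suc c) \<and>
      (\<forall>z. z < 0 \<or> 0 + 2 ^ Suc (i + 4) \<le> z + 1 \<longrightarrow> exec (ins (W 3 i k) (i + 4) 0 c) s1 (W 3 i k) z = s1 (W 3 i k) z)"
    proof (rule ins_correct)
      show "trep (key g) (i + 4) 0 (s1 (W 3 i k)) (cont g i k c) c" using tr by (simp add: s1_def scratch_def)
      show "s1 scratch 2 = Suc (v - 1)" using True by (simp add: s1_def)
      show "inj_on (key g) (insert (v - 1) (cont g i k c))"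
        using inj_on_subset[OF inj_alive[OF gb(1) order.refl] sub] ce by simp
      show "\<And>y'. y' \<in> insert (v - 1) (cont g i k c) \<Longrightarrow> s1 keys y' = key g y'"
        using item_inv_keys[OF item_inv g(2)] sub ce by (auto simp: s1_def scratch_def keys_def)
    qed (use cont True h in \<open>auto simp: keys_def scratch_def\<close>)
    then show ?thesis using True ex ce by simp
  next
    case False
    then show ?thesis using ex cont trep_mono[OF tr, of "Suc c"] by (auto simp: s1_def scratch_def)
  qed
  have fr: "exec (loadc i k c) s n = s n" if "n \<noteq> W 3 i k" "n \<noteq> scratch" for n
    using that by (intro exec_frame) (auto simp: loadc_def)
  show ?thesis
    using node_inv c T fr by (auto simp: node_inv_def logged_def scratch_def)
qed

lemma first_put: "n \<notin> set ns \<Longrightarrow> first (put s n x v) ns a = first s ns a"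
  by (intro first_cong) auto

text \<open>The invariant at index \<open>f\<close> relies on no slot from
  \<open>c * (G + 1)\<close> to \<open>c * (G + 1) + f - 1\<close>; these are still free. The write
  with index \<open>f\<close> fills slot \<open>c * (G + 1) + f\<close>, on which nothing depended
  before, so no earlier record is lost.\<close>

lemma memory_view_job:
  assumes "2 \<le> k"
  shows "memory_view (rdj i k) (wtj i k c) (\<lambda>s a. first s (chain i k) a - 1)
    (\<lambda>f. logged i k ({..<(c + 1) * (G + 1)} - {c * (G + 1)..<c * (G + 1) + f})) G"
proof
  have ch: "chain i k = W 0 i k # chain (Suc i) (k div 2)" using assms by (rule chain_eq)
  have nin: "W 0 i k \<notin> set (chain (Suc i) (k div 2))" using chain_level by fastforce
  have nW: "W c' i' k' \<notin> set (chain i k)" if "c' \<noteq> 0" for c' i' k'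
    using that chain_level by fastforce
  have nS: "scratch \<notin> set (chain i k)" using chain_level by (fastforce simp: scratch_def)
  fix f s e j v
  show "eval (rdj i k e) s = first s (chain i k) (eval e s) - 1" by (simp add: rdj_def)
  show "logged i k R (put s scratch j v)" if "logged i k R s" for R
    using that by (simp add: logged_def scratch_def)
  show "(\<lambda>a. first (put s scratch j v) (chain i k) a - 1) = (\<lambda>a. first s (chain i k) a - 1)"
    using nS by (simp add: first_put)
  assume I: "logged i k ({..<(c + 1) * (G + 1)} - {c * (G + 1)..<c * (G + 1) + Suc f}) s"
  show "logged i k ({..<(c + 1) * (G + 1)} - {c * (G + 1)..<c * (G + 1) + f}) s"
    using I unfolding logged_def by fastforce
  assume f: "f \<le> G"
  let ?s = "exec (wtj i k c f) s" and ?a = "s scratch 0"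
  have V: "?s (W 0 i k) = (s (W 0 i k))(?a := Suc (s scratch 1))" "?s (W 1 i k) = (s (W 1 i k))(?a := Suc i)"
    "?s (W 4 i k) = (s (W 4 i k))(c * (G + 1) + f := Suc ?a)"
    by (auto simp: wtj_def scratch_def)
  have new: "c * (G + 1) + f \<in> {..<(c + 1) * (G + 1)} - {c * (G + 1)..<c * (G + 1) + f}"
    using f by auto
  have old: "\<exists>q\<in>{..<(c + 1) * (G + 1)} - {c * (G + 1)..<c * (G + 1) + f}. ?s (W 4 i k) q = Suc a"
    if "s (W 0 i k) a \<noteq> 0" for a
  proof -
    obtain q where "q \<in> {..<(c + 1) * (G + 1)} - {c * (G + 1)..<c * (G + 1) + Suc f}" "s (W 4 i k) q = Suc a"
      using I \<open>s (W 0 i k) a \<noteq> 0\<close> unfolding logged_def by blast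
    then show ?thesis unfolding V by (intro bexI[of _ q]) auto
  qed
  show "logged i k ({..<(c + 1) * (G + 1)} - {c * (G + 1)..<c * (G + 1) + f}) ?s"
    unfolding logged_def
  proof (intro allI conjI impI)
    fix a
    show "?s (W 1 i k) a = 0" if "?s (W 0 i k) a = 0"
      using that I unfolding V logged_def by (auto split: if_splits)
    assume a: "?s (W 0 i k) a \<noteq> 0"
    show "?s (W 1 i k) a = Suc i"
      using a I unfolding V logged_def by (auto split: if_splits)
    show "\<exists>q\<in>{..<(c + 1) * (G + 1)} - {c * (G + 1)..<c * (G + 1) + f}. ?s (W 4 i k) q = Suc a"
    proof (cases "a = ?a")
      case True
      then show ?thesis using new unfolding V by (intro bexI[OF _ new]) simp
    next
      case False
      then show ?thesis using old a unfolding V(1) by simp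
    qed
  qed
  have "first ?s (chain (Suc i) (k div 2)) a = first s (chain (Suc i) (k div 2)) a" for a
    using nin nW nS ch by (intro first_cong exec_frame) (auto simp: wtj_def)
  then show "(\<lambda>a. first ?s (chain i k) a - 1) = (\<lambda>a. first s (chain i k) a - 1)(?a := s scratch 1)"
    unfolding ch by (auto simp: V fun_eq_iff)
qed

lemma wr_call_job: "wr (call (rdj i k) (wtj i k c) P f e) \<subseteq> {scratch, W 0 i k, W 1 i k, W 4 i k}"
  using wr_call[of "rdj i k" "wtj i k c" P f e] by (auto simp: wtj_def)

lemma node_inv_extract:
  assumes g: "good g t" "start i k \<le> t" "2 \<le> k" and item_inv: "item_inv g t s" and node_inv: "node_inv g i k c s" and c: "11 * 2 ^ i \<le> c"
    and P: "\<And>a. first s (chain (Suc i) (k div 2)) a - 1 = AM g (items g (Suc i) (k div 2)) a"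
  shows "node_inv g i k (Suc c) (exec (extrc i k (c - 11 * 2 ^ i)) s)"
proof -
  define c' where "c' = c - 11 * 2 ^ i"
  let ?b = "start i k" and ?pool = "pool g i k" and ?lp = "items g (Suc i) (k div 2)"
  let ?T = "W 3 i k" and ?s' = "exec (extrc i k c') s"
  have gb: "good g ?b" using good_mono g by blast
  have Sc: "Suc c - 11 * 2 ^ i = Suc c'" using c by (auto simp: c'_def)
  have cont: "cont g i k c = set (drop c' ?pool)" "cont g i k (Suc c) = set (drop (Suc c') ?pool)"
    using cont_full[OF g(3) gb] c Sc by (auto simp: cont_def c'_def)
  have m: "min c (11 * 2 ^ i) = 11 * 2 ^ i" "min (Suc c) (11 * 2 ^ i) = 11 * 2 ^ i" using c by auto
  have tr: "trep (key g) (i + 4) 0 (s ?T) (set (drop c' ?pool)) (11 * 2 ^ i)"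
    using node_inv unfolding node_inv_def cont m by blast
  have root: "s ?T 0 = winner (key g) (set (drop c' ?pool))" using trep_root[OF tr] by simp
  have X: "s (W 2 i k) j = (if j < min c' (4 * 2 ^ i) \<and> j < length ?pool then Suc (?pool ! j) else 0)" for j
    using node_inv by (simp add: node_inv_def c'_def)
  \<comment> \<open>At the boundary between loading and extracting, the invariant says only that the
    node's own array is empty; the memory is then the parent's.\<close>
  have V: "first s (chain i k) a - 1 = AM g (?lp @ drop (4 * 2 ^ i) (take c' ?pool)) a" for a
  proof (cases "c' = 0")
    case True
    then have "c = 11 * 2 ^ i" using c by (simp add: c'_def)
    then show ?thesis using node_inv True P by (simp add: node_inv_def chain_eq[OF g(3)])
  next
    case False
    then show ?thesis using node_inv by (simp add: node_inv_def c'_def)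
  qed
  have lg: "logged i k {..<c' * (G + 1)} s" using node_inv by (simp add: node_inv_def c'_def)
  then have lg': "logged i k {..<Suc c' * (G + 1)} s" by (rule logged_mono) auto
  have goal: "node_inv g i k (Suc c) ?s'"
    if "trep (key g) (i + 4) 0 (?s' ?T) (set (drop (Suc c') ?pool)) (11 * 2 ^ i)"
      "\<And>j. ?s' (W 2 i k) j = (if j < min (Suc c') (4 * 2 ^ i) \<and> j < length ?pool then Suc (?pool ! j) else 0)"
      "\<And>a. first ?s' (chain i k) a - 1 = AM g (?lp @ drop (4 * 2 ^ i) (take (Suc c') ?pool)) a"
      "logged i k {..<Suc c' * (G + 1)} ?s'"
    using that c unfolding node_inv_def cont m Sc by simp
  show ?thesis
    unfolding c'_def[symmetric]
  proof (cases "c' < length ?pool")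
    \<comment> \<open>The pool may be shorter than \<open>11 * 2^i\<close>. The remaining commands
      find an empty tree and change nothing but \<open>scratch\<close>.\<close>
    case False
    have "?s' = put s scratch 2 0" using root False by (simp add: extrc_def winner_def)
    moreover have "first (put s scratch 2 0) (chain i k) a = first s (chain i k) a" for a
      using chain_level by (intro first_put) (fastforce simp: scratch_def)
    ultimately show "node_inv g i k (Suc c) ?s'"
      using False tr X V lg' by (intro goal) (auto simp: scratch_def logged_def)
  next
    case True
    let ?y = "?pool ! c'" and ?D = "set (drop c' ?pool)"
    define s1 where "s1 = exec (ext ?T (i + 4) 0) (put s scratch 2 (Suc ?y))"
    have dr: "drop c' ?pool = ?y # drop (Suc c') ?pool" using True by (simp add: Cons_nth_drop_Suc)
    have Dsub: "?D \<subseteq> alive g ?b" using set_pool[OF g(3)] set_drop_subset[of c' ?pool] by fastforce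
    have yal: "?y \<in> alive g ?b" using Dsub dr by simp
    have inj: "inj_on (key g) ?D" using inj_on_subset[OF inj_alive[OF gb order.refl] Dsub] .
    have y: "argmin (key g) ?D = ?y"
    proof (rule argmin_eqI[OF _ inj])
      have "sorted (map (key g) (drop c' ?pool))"
        using sorted_pool[of g i k] by (simp add: drop_map[symmetric] sorted_wrt_drop)
      then show "key g ?y \<le> key g z" if "z \<in> ?D" for z using that unfolding dr by auto
    qed (use dr in auto)
    have D': "?D - {?y} = set (drop (Suc c') ?pool)"
      using dr distinct_drop[OF distinct_pool, of c' g i k] by simp
    have rt: "s ?T 0 = Suc ?y" using root y dr by (simp add: winner_def)
    have t1: "trep (key g) (i + 4) 0 (s1 ?T) (set (drop (Suc c') ?pool)) (11 * 2 ^ i)"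
    proof -
      have "trep (key g) (i + 4) 0 (exec (ext ?T (i + 4) 0) (put s scratch 2 (Suc ?y)) ?T) (?D - {argmin (key g) ?D}) (11 * 2 ^ i) \<and>
        (\<forall>z. z < 0 \<or> 0 + 2 ^ Suc (i + 4) \<le> z + 1 \<longrightarrow> exec (ext ?T (i + 4) 0) (put s scratch 2 (Suc ?y)) ?T z
          = put s scratch 2 (Suc ?y) ?T z)"
        by (rule ext_correct)
          (use tr inj dr item_inv_keys[OF item_inv g(2)] Dsub in \<open>auto simp: scratch_def keys_def\<close>)
      then show ?thesis unfolding s1_def y D' by blast
    qed
    have f1: "s1 n = s n" if "n \<noteq> ?T" "n \<noteq> scratch" for n
      using that exec_frame[of n "ext ?T (i + 4) 0" "put s scratch 2 (Suc ?y)"] by (simp add: s1_def)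
    have sc: "s1 scratch 2 = Suc ?y"
      using exec_frame[of scratch "ext ?T (i + 4) 0" "put s scratch 2 (Suc ?y)"] by (simp add: s1_def scratch_def)
    have V1: "first s1 (chain i k) a = first s (chain i k) a" for a
      using chain_level by (intro first_cong f1) (fastforce simp: scratch_def)+
    have tk: "take (Suc c') ?pool = take c' ?pool @ [?y]" using True by (rule take_Suc_conv_app_nth)
    show "node_inv g i k (Suc c) ?s'"
    proof (cases "c' < 4 * 2 ^ i")
      case c4: True
      have "?s' = put s1 (W 2 i k) c' (Suc ?y)"
        using rt c4 sc by (simp add: extrc_def s1_def scratch_def)
      moreover have "first (put s1 (W 2 i k) c' (Suc ?y)) (chain i k) a = first s (chain i k) a" for a
        using chain_level V1 by (subst first_put) fastforce+
      ultimately show ?thesis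
        using t1 X V f1 c4 True lg'
        by (intro goal) (auto simp: scratch_def logged_def less_Suc_eq)
    next
      case c4: False
      interpret memory_view "rdj i k" "wtj i k c'" "\<lambda>s a. first s (chain i k) a - 1"
        "\<lambda>f. logged i k ({..<(c' + 1) * (G + 1)} - {c' * (G + 1)..<c' * (G + 1) + f})" G
        by (rule memory_view_job[OF g(3)])
      let ?e = "Rd 9 (Op (-) (Vr scratch 2) (K 1))"
      let ?call = "call (rdj i k) (wtj i k c') (inc_insert A) G ?e"
      have s': "?s' = exec ?call s1"
        using rt c4 by (simp add: extrc_def s1_def scratch_def)
      have fr: "?s' n = s1 n" if "n \<notin> {scratch, W 0 i k, W 1 i k, W 4 i k}" for n
        unfolding s' using that wr_call_job by (intro exec_frame) blast
      have "logged i k ({..<(c' + 1) * (G + 1)} - {c' * (G + 1)..<c' * (G + 1) + Suc G}) s1"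
      proof -
        have "{..<(c' + 1) * (G + 1)} - {c' * (G + 1)..<c' * (G + 1) + Suc G} = {..<c' * (G + 1)}" by auto
        then show ?thesis using lg f1 by (simp add: logged_def scratch_def)
      qed
      from call[OF this, of "inc_insert A" ?e] have
        "logged i k {..<Suc c' * (G + 1)} ?s'"
        "(\<lambda>a. first ?s' (chain i k) a - 1) = frun (inc_insert A) G 0
          ((\<lambda>a. first s1 (chain i k) a - 1)(0 := eval ?e s1))"
        unfolding s' by simp_all
      moreover have "eval ?e s1 = elem g ?y"
        using sc f1[of "Q 9"] item_inv_keys[OF item_inv g(2) yal] by (simp add: scratch_def)
      moreover have "(\<lambda>a. first s1 (chain i k) a - 1) = AM g (?lp @ drop (4 * 2 ^ i) (take c' ?pool))"
        using V V1 by auto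
      moreover have "?lp @ drop (4 * 2 ^ i) (take (Suc c') ?pool) = (?lp @ drop (4 * 2 ^ i) (take c' ?pool)) @ [?y]"
        unfolding tk using c4 True by simp
      ultimately have "first ?s' (chain i k) a - 1 = AM g (?lp @ drop (4 * 2 ^ i) (take (Suc c') ?pool)) a"
        "logged i k {..<Suc c' * (G + 1)} ?s'" for a
        by (metis amem_snoc)+
      moreover have "?s' (W 2 i k) = s (W 2 i k)" "?s' ?T = s1 ?T"
        using fr f1 by (auto simp: scratch_def)
      ultimately show ?thesis
        using t1 X c4 by (intro goal) auto
    qed
  qed
qed

section \<open>The cache\<close>

text \<open>The cache entry of address \<open>a\<close> made at time \<open>u\<close>: the value to be read before and from time
  \<open>s (Q 3) a\<close> on, the first time after \<open>u\<close> at which it can change according to the nodes known at \<open>u\<close>.\<close>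

definition hit :: "st \<Rightarrow> nat \<Rightarrow> nat \<Rightarrow> nat \<Rightarrow> bool" where
  "hit s u j a \<longleftrightarrow> s (W 0 j (u div 2 ^ j)) a \<noteq> 0 \<or> s (W 0 j (u div 2 ^ j + 1)) a \<noteq> 0"

text \<open>\<open>j\<close> is the lowest level at which the current or the next node writes
  \<open>a\<close>. Lower levels can be skipped, so the two cached values are those seen from these
  two nodes, and the switch is at the common end of their intervals.\<close>

definition cspec :: "st \<Rightarrow> nat \<Rightarrow> nat \<Rightarrow> bool" where
  "cspec s u a \<longleftrightarrow>
     (\<exists>j<L. hit s u j a \<and> (\<forall>m<j. \<not> hit s u m a) \<and> s (Q 2) a = first s (chain j (u div 2 ^ j)) a \<and>
        s (Q 3) a = (u div 2 ^ j + 1) * 2 ^ j \<and> s (Q 4) a = first s (chain j (u div 2 ^ j + 1)) a) \<or>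
     (\<forall>m<L. \<not> hit s u m a) \<and> s (Q 2) a = 0 \<and> s (Q 3) a = 0 \<and> s (Q 4) a = 0"

text \<open>\<open>lt a\<close> is the time of the last refresh of \<open>a\<close>. During each
  interval \<open>e\<close> adjacent or equal to \<open>k\<close> the log of node
  \<open>(i, k)\<close> is read at \<open>11 * (G + 1)\<close> slots per step, so that
  \<open>min (2 ^ i) (t - e * 2 ^ i)\<close> portions are done; truncated subtraction covers
  intervals not yet begun.\<close>

definition swept :: "nat \<Rightarrow> st \<Rightarrow> (nat \<Rightarrow> nat) \<Rightarrow> bool" where
  "swept t s lt \<longleftrightarrow> (\<forall>i<L. \<forall>k e q a. 2 \<le> k \<and> k \<le> e + 1 \<and> e \<le> k + 1 \<and> q < 11 * (G + 1) * min (2 ^ i) (t - e * 2 ^ i) \<and>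
     s (W 4 i k) q = Suc a \<longrightarrow> e * 2 ^ i \<le> lt a)"

definition cache_inv :: "nat \<Rightarrow> st \<Rightarrow> bool" where
  "cache_inv t s \<longleftrightarrow> (\<exists>lt. (\<forall>a. lt a \<le> t - 1 \<and> cspec s (lt a) a) \<and> swept t s lt)"

definition null_ok :: "st \<Rightarrow> bool" where
  "null_ok s \<longleftrightarrow> (\<forall>c i k x. c < 5 \<and> k < 2 \<longrightarrow> s (W c i k) x = 0)"

lemma chain_skip:
  assumes "\<And>m. m < j \<Longrightarrow> s (W 0 m (t div 2 ^ m)) a = 0"
  shows "first s (chain 0 t) a = first s (chain j (t div 2 ^ j)) a"
  using assms
proof (induction j)
  case (Suc j)
  have "first s (chain j (t div 2 ^ j)) a = first s (chain (Suc j) (t div 2 ^ j div 2)) a"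
    using Suc.prems[of j] by (cases "t div 2 ^ j < 2") (simp_all add: chain_eq)
  then show ?case using Suc by (simp add: div_mult2_eq[symmetric] mult.commute)
qed simp

lemma div_eqI: "(k::nat) * 2 ^ m \<le> u \<Longrightarrow> u < (k + 1) * 2 ^ m \<Longrightarrow> u div 2 ^ m = k"
  by (simp add: div_nat_eqI mult.commute)

text \<open>The entry may be old and was made without knowledge of later nodes. But any node that
  could make it wrong has had its log swept since it became complete, and this would have refreshed
  the entry.\<close>

lemma cache_read:
  assumes C: "cache_inv t s" and Z: "null_ok s" and t: "t < 2 ^ L"
    and Lg: "\<And>i k. i < L \<Longrightarrow> 2 \<le> k \<Longrightarrow> k * 2 ^ i \<le> t \<Longrightarrow> logged i k {..<11 * 2 ^ i * (G + 1)} s"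
  shows "(if t < s (Q 3) a then s (Q 2) a else s (Q 4) a) = first s (chain 0 t) a"
proof -
  obtain lt where "lt a \<le> t - 1" and pool: "cspec s (lt a) a" and sw: "swept t s lt" using C unfolding cache_inv_def by blast
  then have lt: "lt a \<le> t" "cspec s (lt a) a" by auto
  define u where "u = lt a"
  have swept: "e * 2 ^ i \<le> u"
    if h: "i < L" "2 \<le> k" "k * 2 ^ i \<le> t" "k \<le> e + 1" "e \<le> k + 1" "(e + 1) * 2 ^ i \<le> t" "s (W 0 i k) a \<noteq> 0" for i k e
  proof -
    obtain q where q: "q < 11 * 2 ^ i * (G + 1)" "s (W 4 i k) q = Suc a"
      using Lg[OF h(1-3)] h(7) unfolding logged_def by blast
    have "2 ^ i \<le> t - e * 2 ^ i" using h(6) by simp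
    then have "q < 11 * (G + 1) * min (2 ^ i) (t - e * 2 ^ i)" using q(1) by (simp add: min_def algebra_simps)
    then show ?thesis using sw q h unfolding swept_def u_def by blast
  qed
  have two: "2 \<le> k" if "s (W 0 i k) a \<noteq> 0" for i k
    using Z that unfolding null_ok_def by (metis not_le zero_less_numeral)
  \<comment> \<open>If the node serving at \<open>t\<close> writes \<open>a\<close>, the sweep
    during the preceding interval \<open>k - 1\<close> is over, so the entry is not older than that
    interval and has seen the node as its current or next one. Hence no level below the entry's
    \<open>j\<close> contributes at time \<open>t\<close>.\<close>
  have hit: "hit s u m a" if m: "m < L" and V: "s (W 0 m (t div 2 ^ m)) a \<noteq> 0" for m
  proof -
    define k where "k = t div 2 ^ m"
    have k: "2 \<le> k" using two V k_def by blast
    have kt: "k * 2 ^ m \<le> t" "t < (k + 1) * 2 ^ m"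
      unfolding k_def by (simp_all add: dividend_less_div_times add.commute)
    have "(k - 1) * 2 ^ m \<le> u"
      by (rule swept[OF m k kt(1)]) (use k kt V k_def in auto)
    moreover have "u \<le> t" using lt u_def by simp
    ultimately have "u div 2 ^ m = k - 1 \<or> u div 2 ^ m = k"
      using kt k div_eqI[of "k - 1" m u] div_eqI[of k m u] by (cases "u < k * 2 ^ m") auto
    then show ?thesis using V k unfolding hit_def k_def[symmetric] by auto
  qed
  consider j where "j < L" "hit s u j a" "\<forall>m<j. \<not> hit s u m a" "s (Q 2) a = first s (chain j (u div 2 ^ j)) a"
        "s (Q 3) a = (u div 2 ^ j + 1) * 2 ^ j" "s (Q 4) a = first s (chain j (u div 2 ^ j + 1)) a"
    | "\<forall>m<L. \<not> hit s u m a" "s (Q 2) a = 0" "s (Q 3) a = 0" "s (Q 4) a = 0"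
    using lt(2)[unfolded cspec_def, folded u_def] by (elim disjE exE conjE) assumption+
  then show ?thesis
  proof cases
    case 1
    define k where "k = u div 2 ^ j"
    have ku: "k * 2 ^ j \<le> u" "u < (k + 1) * 2 ^ j"
      unfolding k_def by (simp_all add: dividend_less_div_times add.commute)
    have sk: "first s (chain 0 t) a = first s (chain j (t div 2 ^ j)) a"
      using hit 1(1,3) by (intro chain_skip) (metis less_trans)
    have ut: "u \<le> t" using lt u_def by simp
    show ?thesis
    proof (cases "t < (k + 1) * 2 ^ j")
      case True
      then have "t div 2 ^ j = k" using ku ut by (intro div_eqI) auto
      then show ?thesis using 1 True sk by (simp add: k_def)
    next
      case False
      \<comment> \<open>The entry knows only two intervals. Interval \<open>k + 1\<close> is next to
        or equal to that of the node which was hit, so once it is over the entry would have been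
        renewed at or after its beginning.\<close>
      have "t < (k + 2) * 2 ^ j"
      proof (rule ccontr)
        assume "\<not> t < (k + 2) * 2 ^ j"
        then have *: "(k + 1 + 1) * 2 ^ j \<le> t" by simp
        obtain k' where k': "k' = k \<or> k' = k + 1" "s (W 0 j k') a \<noteq> 0"
          using 1(2) unfolding hit_def k_def by blast
        have "k' * 2 ^ j \<le> (k + 1 + 1) * 2 ^ j" using k' by (intro mult_right_mono) auto
        then have "(k + 1) * 2 ^ j \<le> u"
          by (intro swept[OF 1(1) two[OF k'(2)] _ _ _ * k'(2)]) (use k' * in auto)
        then show False using ku by simp
      qed
      then have "t div 2 ^ j = k + 1" using False by (intro div_eqI) auto
      then show ?thesis using 1 False sk by (simp add: k_def)
    qed
  next
    case 2
    have "first s (chain 0 t) a = first s (chain L (t div 2 ^ L)) a"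
      using hit 2(1) by (intro chain_skip) blast
    then show ?thesis using 2 t by simp
  qed
qed

section \<open>Refreshing cache entries and sweeping the logs\<close>

definition tleaf :: "nat \<Rightarrow> nat \<Rightarrow> com" where
  "tleaf u j = Seq (Set (Q 2) (Vr scratch 3) (Find (chain j (u div 2 ^ j)) (Vr scratch 3)))
    (Seq (Set (Q 3) (Vr scratch 3) (K ((u div 2 ^ j + 1) * 2 ^ j)))
         (Set (Q 4) (Vr scratch 3) (Find (chain j (u div 2 ^ j + 1)) (Vr scratch 3))))"

fun tsel :: "nat \<Rightarrow> nat list \<Rightarrow> com" where
  "tsel u [] = Seq (Set (Q 2) (Vr scratch 3) (K 0))
    (Seq (Set (Q 3) (Vr scratch 3) (K 0)) (Set (Q 4) (Vr scratch 3) (K 0)))"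
| "tsel u (j # js) = If (ne (Vr scratch 4) (K (Suc j))) (tsel u js) (tleaf u j)"

definition unames :: "nat \<Rightarrow> nat list \<Rightarrow> nm list" where
  "unames u js = concat (map (\<lambda>j. [W 1 j (u div 2 ^ j), W 1 j (u div 2 ^ j + 1)]) js)"

text \<open>A single search through the tags of all levels yields the level in question. Then only
  the two chains of that level are walked, which keeps the cost at \<open>O(L)\<close> instead of
  one walk per level.\<close>

definition touch :: "nat \<Rightarrow> com" where
  "touch u = Seq (SetV scratch 4 (Find (unames u [0..<L]) (Vr scratch 3))) (tsel u [0..<L])"

definition tagged :: "st \<Rightarrow> nat \<Rightarrow> bool" where
  "tagged s u \<longleftrightarrow> (\<forall>j<L. \<forall>k\<in>{u div 2 ^ j, u div 2 ^ j + 1}. \<forall>a.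
     s (W 1 j k) a = (if s (W 0 j k) a = 0 then 0 else Suc j))"

lemma wr_tsel: "wr (tsel u js) \<subseteq> {Q 2, Q 3, Q 4}"
  by (induction js) (auto simp: tleaf_def)

lemma wr_touch: "wr (touch u) \<subseteq> {scratch, Q 2, Q 3, Q 4}"
  using wr_tsel by (auto simp: touch_def)

lemma first_unames:
  assumes "tagged s u" "\<And>j. j \<in> set js \<Longrightarrow> j < L"
  shows "first s (unames u js) a = (case find (\<lambda>j. hit s u j a) js of None \<Rightarrow> 0 | Some j \<Rightarrow> Suc j)"
  using assms(2)
proof (induction js)
  case (Cons j js)
  have t: "s (W 1 j k) a = (if s (W 0 j k) a = 0 then 0 else Suc j)" if "k \<in> {u div 2 ^ j, u div 2 ^ j + 1}" for k
    using assms(1) Cons.prems[of j] that unfolding tagged_def by (meson list.set_intros(1))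
  have "unames u (j # js) = W 1 j (u div 2 ^ j) # W 1 j (u div 2 ^ j + 1) # unames u js"
    by (simp add: unames_def)
  moreover have "s (W 1 j (u div 2 ^ j)) a = (if s (W 0 j (u div 2 ^ j)) a = 0 then 0 else Suc j)"
    "s (W 1 j (u div 2 ^ j + 1)) a = (if s (W 0 j (u div 2 ^ j + 1)) a = 0 then 0 else Suc j)"
    using t by simp_all
  ultimately show ?case using Cons by (simp add: hit_def)
qed (simp add: unames_def)

lemma exec_tsel:
  assumes "case find (\<lambda>j. hit s u j a) js of None \<Rightarrow> s scratch 4 = 0 | Some j \<Rightarrow> s scratch 4 = Suc j"
  shows "exec (tsel u js) s = exec (case find (\<lambda>j. hit s u j a) js of None \<Rightarrow> tsel u [] | Some j \<Rightarrow> tleaf u j) s"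
  using assms
proof (induction js)
  case (Cons j js)
  show ?case
  proof (cases "hit s u j a")
    case True
    then show ?thesis using Cons.prems by simp
  next
    case False
    have "s scratch 4 \<noteq> Suc j"
    proof (cases "find (\<lambda>j. hit s u j a) js")
      case None
      then show ?thesis using Cons.prems False by simp
    next
      case (Some j')
      then have "hit s u j' a" by (metis find_Some_iff)
      then show ?thesis using Cons.prems False Some by auto
    qed
    then show ?thesis using Cons False by simp
  qed
qed simp

text \<open>An entry made at \<open>u\<close> mentions only nodes of index at most
  \<open>u div 2^i + 1\<close>, and passing to ancestors preserves this bound. Nodes under
  construction at \<open>u\<close> have index \<open>u div 2^i + 2\<close>.\<close>

lemma cspec_cong:
  assumes "cspec s u a" "\<And>r. r \<in> {2, 3, 4} \<Longrightarrow> s' (Q r) a = s (Q r) a"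
    "\<And>i k. k \<le> u div 2 ^ i + 1 \<Longrightarrow> s' (W 0 i k) = s (W 0 i k)"
  shows "cspec s' u a"
proof -
  have h: "hit s' u j b = hit s u j b" for j b using assms(3) by (simp add: hit_def)
  have "first s' (chain j k) b = first s (chain j k) b" if k: "k \<le> u div 2 ^ j + 1" for j k b
  proof (rule first_cong)
    fix n assume "n \<in> set (chain j k)"
    then obtain d where n: "n = W 0 (j + d) (k div 2 ^ d)" using chain_mem by blast
    have "k div 2 ^ d \<le> (u div 2 ^ j + 1) div 2 ^ d" using k by (rule div_le_mono)
    also have "\<dots> \<le> (u div 2 ^ j) div 2 ^ d + 1"
      by (metis div_add_self2 div_le_mono add_le_mono le_refl one_le_numeral one_le_power power_not_zero zero_neq_numeral)
    also have "\<dots> = u div 2 ^ (j + d) + 1" by (simp add: power_add div_mult2_eq)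
    finally show "s' n = s n" using n assms(3) by simp
  qed
  then show ?thesis using assms(1,2) unfolding cspec_def h by simp
qed

lemma touch_correct:
  assumes "tagged s u" "s scratch 3 = a"
  shows "cspec (exec (touch u) s) u a"
    "n \<notin> {scratch, Q 2, Q 3, Q 4} \<Longrightarrow> exec (touch u) s n = s n"
    "b \<noteq> a \<Longrightarrow> r \<in> {2, 3, 4} \<Longrightarrow> exec (touch u) s (Q r) b = s (Q r) b"
proof -
  define F where "F = find (\<lambda>j. hit s u j a) [0..<L]"
  define s1 where "s1 = put s scratch 4 (case F of None \<Rightarrow> 0 | Some j \<Rightarrow> Suc j)"
  have h: "hit s1 u j b = hit s u j b" for j b by (simp add: hit_def s1_def scratch_def)
  have f: "first s1 (chain j k) b = first s (chain j k) b" for j k b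
    unfolding s1_def using chain_level by (intro first_put) (fastforce simp: scratch_def)
  have sc: "s1 scratch 3 = a" "scratch \<noteq> Q 2" "scratch \<noteq> Q 3" "scratch \<noteq> Q 4" using assms(2)
    by (auto simp: s1_def scratch_def)
  have "exec (touch u) s = exec (tsel u [0..<L]) s1"
    using first_unames[OF assms(1), of "[0..<L]" a] assms(2) by (simp add: touch_def s1_def F_def)
  also have "\<dots> = exec (case F of None \<Rightarrow> tsel u [] | Some j \<Rightarrow> tleaf u j) s1"
    using exec_tsel[of s1 u a "[0..<L]"] unfolding h F_def[symmetric] by (auto simp: s1_def split: option.splits)
  finally have e: "exec (touch u) s = exec (case F of None \<Rightarrow> tsel u [] | Some j \<Rightarrow> tleaf u j) s1" .
  show fr: "exec (touch u) s n = s n" if "n \<notin> {scratch, Q 2, Q 3, Q 4}" for n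
    using exec_frame[of n "touch u" s] wr_touch[of u] that by blast
  have hh: "hit (exec (touch u) s) u j b = hit s u j b" for j b
    using fr by (simp add: hit_def scratch_def)
  have ff: "first (exec (touch u) s) (chain j k) b = first s (chain j k) b" for j k b
    using chain_level by (intro first_cong fr) (fastforce simp: scratch_def)
  have fW: "first (put s' (Q r) x v) (chain j k) b = first s' (chain j k) b" for s' r x v j k b
    using chain_level by (intro first_put) fastforce
  show "cspec (exec (touch u) s) u a"
  proof (cases F)
    case None
    then have "\<not> hit s u j a" if "j < L" for j using that unfolding F_def find_None_iff by auto
    moreover have "exec (touch u) s (Q 2) a = 0" "exec (touch u) s (Q 3) a = 0" "exec (touch u) s (Q 4) a = 0"
      using sc unfolding e None by simp_all
    ultimately show ?thesis unfolding cspec_def hh by blast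
  next
    case (Some j)
    then have j: "j < L" "hit s u j a" "\<forall>m<j. \<not> hit s u m a"
      unfolding F_def find_Some_iff by auto
    have "exec (touch u) s (Q 2) a = first s (chain j (u div 2 ^ j)) a"
      "exec (touch u) s (Q 3) a = (u div 2 ^ j + 1) * 2 ^ j"
      "exec (touch u) s (Q 4) a = first s (chain j (u div 2 ^ j + 1)) a"
      using sc unfolding e Some by (simp_all add: tleaf_def fW f)
    then show ?thesis using j unfolding cspec_def hh ff by blast
  qed
  show "exec (touch u) s (Q r) b = s (Q r) b" if "b \<noteq> a" "r \<in> {2, 3, 4}"
    using that sc unfolding e by (cases F) (auto simp: tleaf_def s1_def)
qed

definition refresh :: "nat \<Rightarrow> nat \<times> nat \<times> nat \<Rightarrow> com" where
  "refresh u = (\<lambda>(i, k, q). If (Vr (W 4 i k) q)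
     (Seq (SetV scratch 3 (Op (-) (Vr (W 4 i k) q) (K 1))) (touch u)) Skip)"

lemma wr_refresh: "wr (refresh u x) \<subseteq> {scratch, Q 2, Q 3, Q 4}"
  using wr_touch by (auto simp: refresh_def split: prod.splits)

lemma sweeps:
  assumes "tagged s u" "\<And>a. lt a \<le> u \<and> cspec s (lt a) a"
  shows "\<exists>lt'. (\<forall>a. lt a \<le> lt' a \<and> lt' a \<le> u \<and> cspec (exec (seqs (map (refresh u) es)) s) (lt' a) a) \<and>
    (\<forall>i k q a. (i, k, q) \<in> set es \<longrightarrow> s (W 4 i k) q = Suc a \<longrightarrow> lt' a = u)"
  using assms
proof (induction es arbitrary: s lt)
  case Nil
  then show ?case by auto
next
  case (Cons x es)
  obtain i k q where x: "x = (i, k, q)" by (cases x)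
  let ?s = "exec (refresh u x) s"
  have fr: "?s n = s n" if "n \<notin> {scratch, Q 2, Q 3, Q 4}" for n
    using exec_frame[of n "refresh u x" s] wr_refresh[of u x] that by blast
  have W: "?s (W c' i' k') = s (W c' i' k')" for c' i' k' using fr by (simp add: scratch_def)
  define lt1 where "lt1 = (if s (W 4 i k) q = 0 then lt else lt(s (W 4 i k) q - 1 := u))"
  have 1: "tagged ?s u" using Cons.prems(1) by (simp add: tagged_def W)
  have 2: "lt1 a \<le> u \<and> cspec ?s (lt1 a) a" for a
  proof (cases "s (W 4 i k) q = 0")
    case True
    then show ?thesis using Cons.prems(2) by (simp add: lt1_def refresh_def x)
  next
    case False
    let ?s1 = "put s scratch 3 (s (W 4 i k) q - 1)"
    have e: "?s = exec (touch u) ?s1" using False by (simp add: refresh_def x)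
    have tg: "tagged ?s1 u" using Cons.prems(1) by (simp add: tagged_def scratch_def)
    note tc = touch_correct[OF tg, of "s (W 4 i k) q - 1"]
    show ?thesis
    proof (cases "a = s (W 4 i k) q - 1")
      case True
      then show ?thesis using False tc(1) unfolding e lt1_def by (simp add: scratch_def)
    next
      case a: False
      have "cspec ?s (lt a) a"
      proof (rule cspec_cong)
        show "cspec s (lt a) a" using Cons.prems(2) by blast
        show "?s (Q r) a = s (Q r) a" if r: "r \<in> {2, 3, 4}" for r
        proof -
          have "?s1 scratch 3 = s (W 4 i k) q - 1" by simp
          from tc(3)[OF this a r] show ?thesis unfolding e using r by (auto simp: scratch_def)
        qed
      qed (use W in simp)
      then show ?thesis using a Cons.prems(2) by (simp add: lt1_def)
    qed
  qed
  from Cons.IH[OF 1 2] obtain lt' where lt': "\<And>a. lt1 a \<le> lt' a \<and> lt' a \<le> u \<and>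
      cspec (exec (seqs (map (refresh u) es)) ?s) (lt' a) a"
    "\<And>i k q a. (i, k, q) \<in> set es \<Longrightarrow> ?s (W 4 i k) q = Suc a \<Longrightarrow> lt' a = u"
    by blast
  have "lt a \<le> lt1 a" for a using Cons.prems(2) by (simp add: lt1_def)
  moreover have "lt' a = u" if "s (W 4 i k) q = Suc a" for a
    using lt'(1)[of a] that by (auto simp: lt1_def intro: antisym)
  ultimately show ?case
    using lt' x unfolding W by (intro exI[of _ lt']) (auto intro: le_trans)
qed

text \<open>On each level the portion \<open>u mod 2^i\<close> of the logs of the preceding, current
  and next node. Over a whole interval the portions add up to the full log of
  \<open>11 * 2^i * (G + 1)\<close> slots.\<close>

definition entries :: "nat \<Rightarrow> (nat \<times> nat \<times> nat) list" where
  "entries u = concat (map (\<lambda>i. concat (map (\<lambda>k. map (\<lambda>q. (i, k, q))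
     [11 * (G + 1) * (u mod 2 ^ i)..<11 * (G + 1) * (u mod 2 ^ i + 1)])
     [u div 2 ^ i - 1, u div 2 ^ i, u div 2 ^ i + 1])) [0..<L])"

definition sweep :: "nat \<Rightarrow> com" where
  "sweep u = seqs (map (refresh u) (entries u))"

lemma wr_sweep: "wr (sweep u) \<subseteq> {scratch, Q 2, Q 3, Q 4}"
  unfolding sweep_def wr_seqs by (auto dest!: subsetD[OF wr_refresh])

text \<open>Refreshes only increase the time of the last refresh, so older obligations persist; the
  step has to settle just the slots by which the bounds in \<open>swept\<close> grow from
  \<open>u\<close> to \<open>Suc u\<close>.\<close>

lemma sweep_correct:
  assumes "tagged s u" "cache_inv u s"
  shows "cache_inv (Suc u) (exec (sweep u) s)"
proof -
  obtain lt where lt: "\<And>a. lt a \<le> u \<and> cspec s (lt a) a" and sw: "swept u s lt"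
    using assms(2) unfolding cache_inv_def by (meson diff_le_self le_trans)
  obtain lt' where lt': "\<And>a. lt a \<le> lt' a \<and> lt' a \<le> u \<and> cspec (exec (sweep u) s) (lt' a) a"
    "\<And>i k q a. (i, k, q) \<in> set (entries u) \<Longrightarrow> s (W 4 i k) q = Suc a \<Longrightarrow> lt' a = u"
    using sweeps[OF assms(1) lt, of "entries u"] unfolding sweep_def by blast
  have W: "exec (sweep u) s (W c i k) = s (W c i k)" for c i k
    using wr_sweep[of u] by (intro exec_frame) (auto simp: scratch_def)
  have "swept (Suc u) (exec (sweep u) s) lt'"
    unfolding swept_def W
  proof (intro allI impI, elim conjE)
    fix i k e q a
    assume i: "i < L" and k: "2 \<le> k" "k \<le> e + 1" "e \<le> k + 1"
      and q: "q < 11 * (G + 1) * min (2 ^ i) (Suc u - e * 2 ^ i)" and a: "s (W 4 i k) q = Suc a"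
    show "e * 2 ^ i \<le> lt' a"
    proof (cases "q < 11 * (G + 1) * min (2 ^ i) (u - e * 2 ^ i)")
      case True
      then have "e * 2 ^ i \<le> lt a" using sw i k a unfolding swept_def by blast
      then show ?thesis using lt' le_trans by blast
    next
      case False
      \<comment> \<open>The bound grows only for the interval \<open>e\<close> that contains
        \<open>u\<close>; the additional slots are then the portion
        \<open>u mod 2^i\<close>.\<close>
      have ne: "min (2 ^ i) (Suc u - e * 2 ^ i) \<noteq> min (2 ^ i) (u - e * 2 ^ i)" using q False by metis
      then have eu: "e * 2 ^ i \<le> u" "u < (e + 1) * 2 ^ i" by (auto simp: min_def split: if_splits)
      have d: "u div 2 ^ i = e" using eu by (rule div_eqI)
      have m: "u mod 2 ^ i = u - e * 2 ^ i" using d by (metis minus_div_mult_eq_mod)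
      have 1: "min (2 ^ i) (u - e * 2 ^ i) = u mod 2 ^ i" "min (2 ^ i) (Suc u - e * 2 ^ i) = u mod 2 ^ i + 1"
        unfolding m using eu by (auto simp: min_def)
      have "(i, k, q) \<in> set (entries u)"
      proof -
        have "k = e - 1 \<or> k = e \<or> k = e + 1" using k by linarith
        moreover have "11 * (G + 1) * (u mod 2 ^ i) \<le> q" "q < 11 * (G + 1) * (u mod 2 ^ i + 1)"
          using q False unfolding 1 by auto
        ultimately show ?thesis using i d unfolding entries_def set_concat set_map
          by (auto simp: image_iff simp del: upt_Suc mult_Suc_right mult_Suc intro!: bexI[of _ i])
      qed
      then show ?thesis using lt'(2) a eu by simp
    qed
  qed
  then show ?thesis using lt' unfolding cache_inv_def by auto
qed

text \<open>Neither the entries made up to \<open>u\<close> nor the slots swept so far concern the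
  nodes of index \<open>u div 2^i + 2\<close>, so the construction commands of step \<open>u\<close>
  leave the cache valid.\<close>

lemma cache_inv_cong:
  assumes "cache_inv (Suc u) s" "\<And>r. r \<in> {2, 3, 4} \<Longrightarrow> s' (Q r) = s (Q r)"
    "\<And>c i k. c < 5 \<Longrightarrow> k \<le> u div 2 ^ i + 1 \<Longrightarrow> s' (W c i k) = s (W c i k)"
  shows "cache_inv (Suc u) s'"
proof -
  obtain lt where lt: "\<And>a. lt a \<le> u \<and> cspec s (lt a) a" and sw: "swept (Suc u) s lt"
    using assms(1) unfolding cache_inv_def by auto
  have "cspec s' (lt a) a" for a
  proof (rule cspec_cong)
    show "cspec s (lt a) a" using lt by blast
    fix i k assume "k \<le> lt a div 2 ^ i + 1"
    moreover have "lt a div 2 ^ i \<le> u div 2 ^ i" using lt div_le_mono by blast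
    ultimately show "s' (W 0 i k) = s (W 0 i k)" using assms(3) by auto
  qed (use assms(2) in auto)
  moreover have "swept (Suc u) s' lt"
    unfolding swept_def
  proof (intro allI impI, elim conjE)
    fix i k e q a
    assume i: "i < L" and k: "2 \<le> k" "k \<le> e + 1" "e \<le> k + 1"
      and q: "q < 11 * (G + 1) * min (2 ^ i) (Suc u - e * 2 ^ i)" and a: "s' (W 4 i k) q = Suc a"
    have "e * 2 ^ i \<le> u" using q by (cases "e * 2 ^ i \<le> u") auto
    then have "e \<le> u div 2 ^ i" by (simp add: less_eq_div_iff_mult_less_eq)
    then have "s (W 4 i k) q = Suc a" using a assms(3)[of 4 k i] k by simp
    then show "e * 2 ^ i \<le> lt a" using sw i k q unfolding swept_def by blast
  qed
  ultimately show ?thesis using lt unfolding cache_inv_def by auto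
qed

section \<open>One operation\<close>

lemma node_inv_complete:
  assumes "2 \<le> k" "good g (start i k)" "node_inv g i k (22 * 2 ^ i) s"
  shows "s (W 2 i k) j = (if j < 4 * 2 ^ i \<and> j < length (pool g i k) then Suc (pool g i k ! j) else 0)"
    "first s (chain i k) a - 1 = AM g (items g i k) a"
    "logged i k {..<11 * 2 ^ i * (G + 1)} s"
proof -
  have 1: "22 * 2 ^ i - 11 * 2 ^ i = 11 * (2::nat) ^ i" "\<not> 22 * 2 ^ i \<le> 11 * (2::nat) ^ i"
    "min (11 * 2 ^ i) (4 * 2 ^ i) = 4 * (2::nat) ^ i" by auto
  show "s (W 2 i k) j = (if j < 4 * 2 ^ i \<and> j < length (pool g i k) then Suc (pool g i k ! j) else 0)"
    using assms(3) unfolding node_inv_def 1 by blast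
  show "first s (chain i k) a - 1 = AM g (items g i k) a"
    using assms(3) length_pool[OF assms(2)] unfolding node_inv_def 1 items_eq[OF assms(1)] by simp
  show "logged i k {..<11 * 2 ^ i * (G + 1)} s"
    using assms(3) unfolding node_inv_def 1 by blast
qed

lemma node_inv_frame:
  assumes "node_inv g i k c s" "\<And>c'. c' < 5 \<Longrightarrow> s' (W c' i k) = s (W c' i k)"
    "11 * 2 ^ i < c \<Longrightarrow> 2 \<le> k \<and> (\<forall>n\<in>set (chain (Suc i) (k div 2)). s' n = s n)"
  shows "node_inv g i k c s'"
proof -
  have W: "s' (W 0 i k) = s (W 0 i k)" "s' (W 1 i k) = s (W 1 i k)" "s' (W 2 i k) = s (W 2 i k)"
    "s' (W 3 i k) = s (W 3 i k)" "s' (W 4 i k) = s (W 4 i k)" using assms(2) by auto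
  have "first s' (chain i k) a = first s (chain i k) a" if "11 * 2 ^ i < c" for a
    using assms(3)[OF that] W by (intro first_cong) (auto simp: chain_eq)
  then show ?thesis using assms(1) unfolding node_inv_def logged_def W by (cases "c \<le> 11 * 2 ^ i") auto
qed

text \<open>A node not yet begun is empty; this covers the nodes whose snapshot lies in the unknown
  future.\<close>

lemma node_inv_zero: "node_inv g i k 0 s \<longleftrightarrow> node_inv g' i k 0 s"
proof -
  have "cont g i k 0 = {}" for g by (simp add: cont_def)
  moreover have "trep (key g) (i + 4) 0 v {} 0 \<Longrightarrow> trep (key g') (i + 4) 0 v {} 0" for g g' v
    by (erule trep_cong) auto
  ultimately show ?thesis unfolding node_inv_def by auto
qed

lemma node_inv_cong:
  assumes "node_inv g i k c s" "start i k \<le> t" "2 \<le> k" "\<And>u. u < t \<Longrightarrow> g' u = g u" "good g t"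
  shows "node_inv g' i k c s"
proof -
  have b: "start (Suc i) (k div 2) \<le> t" using assms(2) start_parent(1)[of i k] by simp
  have e: "items g' (Suc i) (k div 2) = items g (Suc i) (k div 2)" "pool g' i k = pool g i k"
    "pool g' (Suc i) (k div 2) = pool g (Suc i) (k div 2)" "alive g' (start i k) = alive g (start i k)"
    using items_cong[of t g' g i k] items_cong[of t g' g "Suc i" "k div 2"] assms b
      alive_cong[of "start i k" g' g] by auto
  have c: "cont g' i k c = cont g i k c" unfolding cont_def e ..
  have k: "key g' y = key g y" if "y \<in> alive g (start i k)" for y
    using alive_less[OF that] assms(2,4) by (simp add: key_def)
  have "trep (key g') (i + 4) 0 (s (W 3 i k)) (cont g i k c) (min c (11 * 2 ^ i))"
  proof (rule trep_cong)
    show "trep (key g) (i + 4) 0 (s (W 3 i k)) (cont g i k c) (min c (11 * 2 ^ i))"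
      using assms(1) unfolding node_inv_def by blast
  qed (use k cont_subset[OF assms(3), of g i c] in auto)
  moreover have "AM g' (items g (Suc i) (k div 2) @ drop (4 * 2 ^ i) (take c' (pool g i k))) =
      AM g (items g (Suc i) (k div 2) @ drop (4 * 2 ^ i) (take c' (pool g i k)))" for c'
  proof (rule amem_cong)
    fix y assume "y \<in> set (items g (Suc i) (k div 2) @ drop (4 * 2 ^ i) (take c' (pool g i k)))"
    then have "y \<in> alive g (start i k)"
      using items_parent_start[OF good_mono[OF assms(5,2)]] set_pool[OF assms(3), of g i]
      by (auto dest!: in_set_dropD in_set_takeD)
    then have "y < t" using alive_less assms(2) less_le_trans by blast
    then show "g' y = g y" by (rule assms(4))
  qed
  ultimately show ?thesis using assms(1) unfolding node_inv_def e c by metis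
qed

section \<open>The schedule of the construction commands\<close>

definition progress :: "nat \<Rightarrow> nat \<Rightarrow> nat \<Rightarrow> nat" where
  "progress t i k = 22 * min (2 ^ i) (t - start i k)"

text \<open>Twenty-two commands per step finish the node after \<open>2^i\<close> steps, at time
  \<open>(k - 1) 2^i\<close>. Being ready one interval before its service leaves interval
  \<open>k - 1\<close> for the sweep.\<close>

lemma progress_done: "2 \<le> k \<Longrightarrow> k \<le> t div 2 ^ i + 1 \<Longrightarrow> progress t i k = 22 * 2 ^ i"
proof -
  assume k: "2 \<le> k" "k \<le> t div 2 ^ i + 1"
  have "start i k + 2 ^ i = (k - 1) * 2 ^ i" using k by (simp add: start_def add_mult_distrib2 algebra_simps diff_mult_distrib)
  also have "\<dots> \<le> (t div 2 ^ i) * 2 ^ i" using k by (intro mult_right_mono) auto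
  also have "\<dots> \<le> t" by simp
  finally show ?thesis by (simp add: progress_def min_def)
qed

lemma progress_job: "progress t i (t div 2 ^ i + 2) = 22 * (t mod 2 ^ i)" "progress (Suc t) i (t div 2 ^ i + 2) = 22 * (t mod 2 ^ i + 1)"
proof -
  have e: "t - t div 2 ^ i * 2 ^ i = t mod 2 ^ i" "Suc t - t div 2 ^ i * 2 ^ i = t mod 2 ^ i + 1"
    by (simp_all add: minus_div_mult_eq_mod Suc_diff_le)
  have "t mod 2 ^ i < 2 ^ i" by simp
  then have l: "min (2 ^ i) (t mod 2 ^ i) = t mod 2 ^ i" "min (2 ^ i) (t mod 2 ^ i + 1) = t mod 2 ^ i + 1"
    by linarith+
  show "progress t i (t div 2 ^ i + 2) = 22 * (t mod 2 ^ i)" "progress (Suc t) i (t div 2 ^ i + 2) = 22 * (t mod 2 ^ i + 1)"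
    unfolding progress_def start_def using e l by simp_all
qed

lemma progress_future: "t div 2 ^ i + 2 < k \<Longrightarrow> progress t i k = 0 \<and> progress (Suc t) i k = 0"
proof -
  assume k: "t div 2 ^ i + 2 < k"
  have "Suc t \<le> (t div 2 ^ i + 1) * 2 ^ i" by (simp add: dividend_less_div_times add.commute Suc_le_eq)
  also have "\<dots> \<le> start i k" unfolding start_def using k by (intro mult_right_mono) auto
  finally show ?thesis by (simp add: progress_def)
qed

lemma progress_zero: "t \<le> start i k \<Longrightarrow> progress t i k = 0" by (simp add: progress_def)

definition nodes_ok :: "(nat \<Rightarrow> vop) \<Rightarrow> nat \<Rightarrow> st \<Rightarrow> bool" where
  "nodes_ok g t s \<longleftrightarrow> (\<forall>i<L. \<forall>k\<ge>2. node_inv g i k (progress t i k) s)"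

lemma nodes_complete:
  assumes "nodes_ok g t s" "good g t" "i < L" "2 \<le> k" "k \<le> t div 2 ^ i + 1"
  shows "node_inv g i k (22 * 2 ^ i) s" "good g (start i k)"
proof -
  show "node_inv g i k (22 * 2 ^ i) s" using assms progress_done[OF assms(4,5)] unfolding nodes_ok_def by metis
  have "start i k \<le> (t div 2 ^ i) * 2 ^ i" using assms unfolding start_def by (intro mult_right_mono) auto
  also have "\<dots> \<le> t" by simp
  finally show "good g (start i k)" using assms good_mono by blast
qed

definition jobs :: "nat \<Rightarrow> com" where
  "jobs u = seqs (map (\<lambda>i. seqs (map (job i (u div 2 ^ i + 2)) [22 * (u mod 2 ^ i)..<22 * (u mod 2 ^ i + 1)])) [0..<L])"

definition jnames :: "nat \<Rightarrow> nm set" where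
  "jnames u = insert scratch {W c i (u div 2 ^ i + 2) |c i. c < 5}"

lemma wr_job: "wr (job i k c) \<subseteq> insert scratch {W c' i k |c'. c' < 5}"
proof -
  have "wr (call (rdj i k) (wtj i k c) P f e) \<subseteq> insert scratch {W c' i k |c'. c' < 5}" for c P f e
    by (rule order_trans[OF wr_call_job]) auto
  then show ?thesis by (simp add: job_def loadc_def extrc_def)
qed

lemma wr_jobs: "wr (jobs u) \<subseteq> jnames u"
  using wr_job by (fastforce simp: jobs_def jnames_def)

lemma half_plus: "1 \<le> d \<Longrightarrow> (m + 2) div 2 ^ d \<le> m div 2 ^ d + (1::nat)"
proof -
  assume "1 \<le> d"
  then have "(2::nat) \<le> 2 ^ d" using power_increasing[of 1 d "2::nat"] by simp
  then have "(m + 2) div 2 ^ d \<le> (m + 2 ^ d) div 2 ^ d" by (intro div_le_mono) simp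
  also have "\<dots> = m div 2 ^ d + 1" by simp
  finally show ?thesis .
qed

text \<open>A node under construction is two intervals ahead, but halving brings each proper
  ancestor to at most one interval ahead on its own level. So all ancestors are complete and nothing
  they contain changes meanwhile.\<close>

lemma chain_jnames:
  assumes "n \<in> set (chain (Suc i) (k div 2))" "k \<le> u div 2 ^ i + 2"
  shows "n \<notin> jnames u"
proof -
  obtain d where n: "n = W 0 (Suc i + d) (k div 2 div 2 ^ d)" using chain_mem[OF assms(1)] by blast
  have "k div 2 div 2 ^ d = k div 2 ^ Suc d" by (simp add: div_mult2_eq)
  also have "\<dots> \<le> (u div 2 ^ i + 2) div 2 ^ Suc d" using assms(2) by (rule div_le_mono)
  also have "\<dots> \<le> u div 2 ^ i div 2 ^ Suc d + 1" by (rule half_plus) simp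
  also have "\<dots> = u div 2 ^ (Suc i + d) + 1" by (simp add: power_add div_mult2_eq[symmetric] mult.commute mult.left_commute)
  finally show ?thesis using n by (auto simp: jnames_def scratch_def)
qed

lemma jobs_correct:
  assumes g: "good g (Suc u)" and item_inv: "item_inv g (Suc u) s" and null: "null_ok s" and nodes: "nodes_ok g u s" and uL: "u < 2 ^ L"
  shows "nodes_ok g (Suc u) (exec (jobs u) s)"
proof -
  define kk where "kk i = u div 2 ^ i + 2" for i
  \<comment> \<open>All commands of this step write only to nodes under construction, and read other
    nodes only if they are complete. Hence the levels do not interfere and may be treated in any
    order.\<close>
  define agree where "agree s' \<longleftrightarrow> (\<forall>n. n \<notin> jnames u \<longrightarrow> s' n = s n)" for s' :: st
  have gu: "good g u" using g good_mono by auto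
  have half: "kk i div 2 = u div 2 ^ Suc i + 1" for i
    by (simp add: kk_def div_mult2_eq[symmetric] mult.commute)
  \<comment> \<open>The parent of the node under construction is either complete or, for an index
    below 2, the empty root state.\<close>
  have par: "(\<forall>j. s (W 2 (Suc i) (kk i div 2)) j = (if j < 8 * 2 ^ i \<and> j < length (pool g (Suc i) (kk i div 2))
        then Suc (pool g (Suc i) (kk i div 2) ! j) else 0)) \<and>
      (\<forall>a. first s (chain (Suc i) (kk i div 2)) a - 1 = AM g (items g (Suc i) (kk i div 2)) a)" if i: "i < L" for i
  proof (cases "kk i div 2 < 2")
    case True
    then show ?thesis using null by (simp add: null_ok_def)
  next
    case False
    \<comment> \<open>On level \<open>L\<close> the time \<open>u < 2^L\<close> lies in interval 0,
      so a parent there would have index 1 and be empty.\<close>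
    have "Suc i < L"
    proof (rule ccontr)
      assume "\<not> Suc i < L"
      then have "L = Suc i" using i by simp
      then have "u div 2 ^ Suc i = 0" using uL by (simp only: div_less)
      then show False using False half[of i] by simp
    qed
    note nc = nodes_complete[OF nodes gu this, of "kk i div 2"]
    have n: "node_inv g (Suc i) (kk i div 2) (22 * 2 ^ Suc i) s" "good g (start (Suc i) (kk i div 2))"
      using nc False half[of i] by auto
    have 8: "4 * 2 ^ Suc i = 8 * (2::nat) ^ i" by simp
    have two: "2 \<le> kk i div 2" using False by simp
    show ?thesis using node_inv_complete(1,2)[OF two n(2,1)] unfolding 8 by blast
  qed
  have bask: "start i (kk i) \<le> Suc u" for i
  proof -
    have "u div 2 ^ i * 2 ^ i \<le> u" by simp
    then have "u div 2 ^ i * 2 ^ i \<le> Suc u" by (rule le_SucI)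
    then show ?thesis unfolding start_def kk_def by simp
  qed
  have step: "node_inv g i (kk i) (Suc c) (exec (job i (kk i) c) s') \<and> agree (exec (job i (kk i) c) s')"
    if i: "i < L" and ag: "agree s'" and node_inv: "node_inv g i (kk i) c s'" for i c s'
  proof
    have BI': "item_inv g (Suc u) s'"
      using item_inv ag by (simp add: item_inv_def agree_def jnames_def scratch_def keys_def)
    have p: "s' (W 2 (Suc i) (kk i div 2)) = s (W 2 (Suc i) (kk i div 2))"
      using ag half[of i] by (simp add: agree_def jnames_def scratch_def)
    have c: "first s' (chain (Suc i) (kk i div 2)) a = first s (chain (Suc i) (kk i div 2)) a" for a
      using ag chain_jnames[of _ i "kk i" u] by (intro first_cong) (simp add: agree_def kk_def)
    show "node_inv g i (kk i) (Suc c) (exec (job i (kk i) c) s')"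
    proof (cases "c < 11 * 2 ^ i")
      case True
      then show ?thesis
        using node_inv_load[OF g bask _ BI' node_inv True] par[OF i] p by (simp add: job_def kk_def)
    next
      case False
      then show ?thesis
        using node_inv_extract[OF g bask _ BI' node_inv] par[OF i] c by (simp add: job_def kk_def)
    qed
    have "exec (job i (kk i) c) s' n = s n" if "n \<notin> jnames u" for n
    proof -
      have "n \<notin> wr (job i (kk i) c)" using wr_job[of i "kk i" c] that by (auto simp: jnames_def kk_def)
      then show ?thesis using ag that by (simp add: agree_def exec_frame)
    qed
    then show "agree (exec (job i (kk i) c) s')" by (simp add: agree_def)
  qed
  have chunk: "node_inv g i (kk i) (c + m) (exec (seqs (map (job i (kk i)) [c..<c + m])) s') \<and>
      agree (exec (seqs (map (job i (kk i)) [c..<c + m])) s')"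
    if i: "i < L" and ag: "agree s'" and node_inv: "node_inv g i (kk i) c s'" for i c m s'
  proof (induction m)
    case 0
    then show ?case using ag node_inv by simp
  next
    case (Suc m)
    then show ?case using step[OF i, of _ "c + m"] by simp
  qed
  define ch where "ch i = seqs (map (job i (kk i)) [22 * (u mod 2 ^ i)..<22 * (u mod 2 ^ i + 1)])" for i
  have lev: "agree (exec (seqs (map ch [0..<n])) s) \<and>
      (\<forall>i<L. node_inv g i (kk i) (if i < n then 22 * (u mod 2 ^ i + 1) else 22 * (u mod 2 ^ i)) (exec (seqs (map ch [0..<n])) s))"
    if "n \<le> L" for n
    using that
  proof (induction n)
    case 0
    have "node_inv g i (kk i) (22 * (u mod 2 ^ i)) s" if "i < L" for i
      using nodes that progress_job(1)[of u i] unfolding nodes_ok_def kk_def by (metis le_add2)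
    then show ?case by (simp add: agree_def)
  next
    case (Suc n)
    let ?s = "exec (seqs (map ch [0..<n])) s"
    have IH: "agree ?s" "\<And>i. i < L \<Longrightarrow> node_inv g i (kk i) (if i < n then 22 * (u mod 2 ^ i + 1) else 22 * (u mod 2 ^ i)) ?s"
      using Suc by auto
    have e: "exec (seqs (map ch [0..<Suc n])) s = exec (ch n) ?s" by simp
    have 1: "node_inv g n (kk n) (22 * (u mod 2 ^ n + 1)) (exec (ch n) ?s)" "agree (exec (ch n) ?s)"
    proof -
      have eq: "22 * (u mod 2 ^ n + 1) = 22 * (u mod 2 ^ n) + 22" by simp
      have n: "n < L" using Suc.prems by simp
      have IHn: "node_inv g n (kk n) (22 * (u mod 2 ^ n)) ?s" using IH(2)[OF n] by simp
      have chn: "ch n = seqs (map (job n (kk n)) [22 * (u mod 2 ^ n)..<22 * (u mod 2 ^ n) + 22])"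
        unfolding ch_def eq ..
      show "node_inv g n (kk n) (22 * (u mod 2 ^ n + 1)) (exec (ch n) ?s)" "agree (exec (ch n) ?s)"
        using chunk[OF n IH(1) IHn, of 22] unfolding chn[symmetric] eq by blast+
    qed
    have 2: "node_inv g i (kk i) c (exec (ch n) ?s)" if "i \<noteq> n" "node_inv g i (kk i) c ?s" for i c
    proof (rule node_inv_frame[OF that(2)])
      have w: "wr (ch n) \<subseteq> insert scratch {W c' n (kk n) |c'. c' < 5}"
        unfolding ch_def using wr_job[of n "kk n"] by auto
      show "exec (ch n) ?s (W c' i (kk i)) = ?s (W c' i (kk i))" for c'
        using w that(1) by (intro exec_frame) (auto simp: scratch_def)
      show "2 \<le> kk i \<and> (\<forall>n'\<in>set (chain (Suc i) (kk i div 2)). exec (ch n) ?s n' = ?s n')"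
        using chain_jnames[of _ i "kk i" u] 1(2) IH(1) by (auto simp: kk_def agree_def)
    qed
    have "node_inv g i (kk i) (if i < Suc n then 22 * (u mod 2 ^ i + 1) else 22 * (u mod 2 ^ i)) (exec (ch n) ?s)"
      if i: "i < L" for i
    proof (cases "i = n")
      case True
      then show ?thesis using 1(1) by simp
    next
      case False
      then have "i < Suc n \<longleftrightarrow> i < n" by auto
      then show ?thesis using 2[OF False IH(2)[OF i]] by presburger
    qed
    then show ?case unfolding e using 1(2) by blast
  qed
  have js: "jobs u = seqs (map ch [0..<L])" unfolding jobs_def ch_def kk_def ..
  show ?thesis
    unfolding nodes_ok_def
  proof (intro allI impI)
    fix i k :: nat assume i: "i < L" and k: "2 \<le> k"
    consider "k = kk i" | "k \<noteq> kk i" by blast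
    then show "node_inv g i k (progress (Suc u) i k) (exec (jobs u) s)"
    proof cases
      case 1
      then show ?thesis using lev[of L] i progress_job(2)[of u i] unfolding js kk_def by auto
    next
      case 2
      have pe: "progress (Suc u) i k = progress u i k"
      proof (cases "k < kk i")
        case True
        then have "k \<le> u div 2 ^ i + 1" by (simp add: kk_def)
        moreover have "u div 2 ^ i \<le> Suc u div 2 ^ i" by (rule div_le_mono) simp
        ultimately have "k \<le> u div 2 ^ i + 1" "k \<le> Suc u div 2 ^ i + 1" by linarith+
        then show ?thesis using progress_done k by metis
      next
        case False
        then show ?thesis using 2 progress_future[of u i k] by (simp add: kk_def)
      qed
      show ?thesis unfolding pe
      proof (rule node_inv_frame)
        show "node_inv g i k (progress u i k) s" using nodes i k unfolding nodes_ok_def by blast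
        show "exec (jobs u) s (W c' i k) = s (W c' i k)" if "c' < 5" for c'
          using lev[of L] 2 unfolding js agree_def by (simp add: jnames_def scratch_def kk_def)
        assume "11 * 2 ^ i < progress u i k"
        then have "k \<le> kk i" using progress_future[of u i k] by (cases "k \<le> kk i") (auto simp: kk_def)
        then show "2 \<le> k \<and> (\<forall>n\<in>set (chain (Suc i) (k div 2)). exec (jobs u) s n = s n)"
          using k chain_jnames[of _ i k u] lev[of L] unfolding js agree_def by (simp add: kk_def)
      qed
    qed
  qed
qed

section \<open>The items outside the nodes\<close>

definition tview :: "st \<Rightarrow> nat \<Rightarrow> nat" where
  "tview s a = (if s (Q 5) a = s (Q 14) 0 then s (Q 6) a
     else (if s (Q 14) 0 < s (Q 3) a then s (Q 2) a else s (Q 4) a) - 1)"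

definition rdt :: "ex \<Rightarrow> ex" where
  "rdt e = IfE (ne (Rd 5 e) (Vr (Q 14) 0))
     (Op (-) (IfE (Op (-) (Rd 3 e) (Vr (Q 14) 0)) (Rd 2 e) (Rd 4 e)) (K 1)) (Rd 6 e)"

definition wtt :: "nat \<Rightarrow> com" where
  "wtt f = Seq (Set (Q 6) (Vr scratch 0) (Vr scratch 1)) (Set (Q 5) (Vr scratch 0) (Vr (Q 14) 0))"

lemma eval_rdt: "eval (rdt e) s = tview s (eval e s)"
  by (auto simp: rdt_def tview_def)

text \<open>An overlay cell counts only if its stamp equals the current time. Advancing the time
  thus discards the previous overlay at no cost.\<close>

lemma memory_view_top: "memory_view rdt wtt tview (\<lambda>_ s. \<forall>a. s (Q 5) a \<le> s (Q 14) 0) N"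
proof
  fix f e s j v
  show "eval (rdt e) s = tview s (eval e s)" by (rule eval_rdt)
  show "tview (put s scratch j v) = tview s" by (simp add: tview_def fun_eq_iff scratch_def)
  show "tview (exec (wtt f) s) = (tview s)(s scratch 0 := s scratch 1)"
    by (auto simp: tview_def fun_eq_iff scratch_def wtt_def)
qed (auto simp: scratch_def wtt_def)

text \<open>The snapshot of node \<open>(0, t)\<close> is at time \<open>t - 2\<close>, so it misses
  only the first four items of its pool and the items inserted at \<open>t - 2\<close> and
  \<open>t - 1\<close>. The constants are these names plus one, and 0 means that there is no
  item.\<close>

definition titem :: "nat \<Rightarrow> nat \<Rightarrow> com" where
  "titem t j = Seq (SetV scratch 2 (if j < 4 then Vr (W 2 0 t) j else if j = 4 then K (t - 1) else K t))
    (If (IfE (Vr scratch 2) (Op (-) (Rd 12 (Op (-) (Vr scratch 2) (K 1))) (K t)) (K 0))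
      (call rdt wtt (inc_insert A) G (Rd 9 (Op (-) (Vr scratch 2) (K 1)))) Skip)"

definition topc :: "nat \<Rightarrow> com" where
  "topc t = seqs (map (titem t) [0..<6])"

lemma wr_call_top: "wr (call rdt wtt P f e) \<subseteq> {scratch, Q 5, Q 6}"
  using wr_call[of rdt wtt P f e] by (auto simp: wtt_def)

lemma wr_top: "wr (topc t) \<subseteq> {scratch, Q 5, Q 6}"
  using wr_call_top by (fastforce simp: topc_def titem_def)

text \<open>The order \<open>ys\<close> in which the items were fed is left open, since the
  admissible answers depend on the set only.\<close>

definition top_inv :: "(nat \<Rightarrow> vop) \<Rightarrow> nat \<Rightarrow> st \<Rightarrow> bool" where
  "top_inv g t s \<longleftrightarrow> (\<forall>a. s (Q 5) a \<le> s (Q 14) 0) \<and>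
     (\<exists>ys. set ys = alive g t \<and> distinct ys \<and> tview s = AM g ys)"

lemma top_items:
  assumes g: "good g t" and v0: "\<And>j. v j = (if j < 4 then (if j < length (pool g 0 t) then Suc (pool g 0 t ! j) else 0)
      else if j = 4 then t - 1 else t)"
    and zs: "zs = concat (map (\<lambda>j. if v j \<noteq> 0 \<and> v j - 1 \<in> alive g t then [v j - 1] else []) [0..<6])"
  shows "set (items g 0 t @ zs) = alive g t" "distinct (items g 0 t @ zs)"
proof -
  have gb: "good g (start 0 t)" using good_mono[OF g] by (simp add: start_def)
  have szs: "y \<in> set zs \<longleftrightarrow> y \<in> alive g t \<and> (\<exists>j<6. v j = Suc y)" for y
    unfolding zs by (force split: if_splits)
  have csl: "y < t - 2" if "y \<in> set (pool g 0 t)" for y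
    using that set_pool[of t g 0] alive_less[of y g "t - 2"] by (cases "t < 2") (auto simp: start_def)
  have tk: "(\<exists>j<4. v j = Suc y) \<longleftrightarrow> y \<in> set (take 4 (pool g 0 t))" for y
  proof
    assume "\<exists>j<4. v j = Suc y"
    then obtain j where j: "j < 4" "v j = Suc y" by blast
    then have "j < length (pool g 0 t)" "pool g 0 t ! j = y" using v0[of j] by (auto split: if_splits)
    then show "y \<in> set (take 4 (pool g 0 t))" using j by (auto simp: in_set_conv_nth intro!: exI[of _ j])
  next
    assume "y \<in> set (take 4 (pool g 0 t))"
    then obtain j where "j < length (take 4 (pool g 0 t))" "take 4 (pool g 0 t) ! j = y" by (auto simp: in_set_conv_nth)
    then show "\<exists>j<4. v j = Suc y" using v0[of j] by (intro exI[of _ j]) auto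
  qed
  have six: "(\<exists>j<6. v j = Suc y) \<longleftrightarrow> (\<exists>j<4. v j = Suc y) \<or> t - 1 = Suc y \<or> t = Suc y" for y
  proof -
    have 6: "j < 6 \<longleftrightarrow> j < 4 \<or> j = 4 \<or> j = 5" for j :: nat by auto
    have "v 4 = t - 1" "v 5 = t" using v0[of 4] v0[of 5] by simp_all
    then show ?thesis unfolding 6 by metis
  qed
  have lsub: "set (items g 0 t) \<subseteq> alive g t" by (rule items_safe[OF g]) (auto simp: start_def)
  have lb: "set (items g 0 t) \<subseteq> alive g (t - 2)" using items_start[OF gb] by (simp add: start_def)
  have split: "set (pool g 0 t) = set (take 4 (pool g 0 t)) \<union> set (drop 4 (pool g 0 t))"
    "set (take 4 (pool g 0 t)) \<inter> set (drop 4 (pool g 0 t)) = {}"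
    using distinct_pool[of g 0 t] by (metis append_take_drop_id set_append, metis append_take_drop_id distinct_append)
  have "y \<in> set (items g 0 t) \<or> y \<in> set zs" if y: "y \<in> alive g t" for y
  proof (cases "y < t - 2")
    case True
    then have "y \<in> alive g (start 0 t)" "2 \<le> t" using alive_mono[OF y True] by (auto simp: start_def)
    then have "y \<in> set (items g (Suc 0) (t div 2)) \<or> y \<in> set (pool g 0 t)" using set_pool[of t g 0] by auto
    then show ?thesis using \<open>2 \<le> t\<close> split szs y six tk by (auto simp: items_eq)
  next
    case False
    then have "t - 1 = Suc y \<or> t = Suc y" using alive_less[OF y] by auto
    then show ?thesis using szs six y by blast
  qed
  then show "set (items g 0 t @ zs) = alive g t" using lsub szs by auto
  have "y \<notin> set (items g 0 t)" if y: "y \<in> set zs" for y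
  proof
    assume l: "y \<in> set (items g 0 t)"
    have t2: "2 \<le> t" using l by (cases "t < 2") auto
    have "y < t - 2" using l lb alive_less by blast
    then have "y \<in> set (take 4 (pool g 0 t))" using y szs six tk by auto
    then show False using l t2 split set_pool[of t g 0] by (auto simp: items_eq)
  qed
  moreover have "distinct zs"
  proof -
    have inj: "j = j'" if "j < 6" "j' < 6" "v j = v j'" "v j \<noteq> 0" for j j'
    proof -
      have a: "v j - 1 < t - 2" if "j < 4" "v j \<noteq> 0" for j
        using that csl v0[of j] by (auto split: if_splits)
      consider "j < 4" "j' < 4" | "j < 4" "j' \<ge> 4" | "j \<ge> 4" "j' < 4" | "j \<ge> 4" "j' \<ge> 4" by linarith
      then show ?thesis
      proof cases
        case 1
        then show ?thesis using that v0[of j] v0[of j'] distinct_pool[of g 0 t]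
          by (auto split: if_splits simp: nth_eq_iff_index_eq)
      next
        case 2
        then show ?thesis using that a[of j] v0[of j'] by (auto split: if_splits)
      next
        case 3
        then show ?thesis using that a[of j'] v0[of j] by (auto split: if_splits)
      next
        case 4
        then show ?thesis using that v0[of j] v0[of j'] by (auto split: if_splits)
      qed
    qed
    define zz where "zz n = concat (map (\<lambda>j. if v j \<noteq> 0 \<and> v j - 1 \<in> alive g t then [v j - 1] else []) [0..<n])" for n
    have "n \<le> 6 \<Longrightarrow> distinct (zz n) \<and> (\<forall>y\<in>set (zz n). \<exists>j<n. v j = Suc y)" for n
    proof (induction n)
      case (Suc n)
      have e: "zz (Suc n) = zz n @ (if v n \<noteq> 0 \<and> v n - 1 \<in> alive g t then [v n - 1] else [])"
        by (simp add: zz_def)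
      have IH: "distinct (zz n)" "\<And>y. y \<in> set (zz n) \<Longrightarrow> \<exists>j<n. v j = Suc y" using Suc by auto
      have "v n - 1 \<notin> set (zz n)" if "v n \<noteq> 0"
      proof
        assume "v n - 1 \<in> set (zz n)"
        from IH(2)[OF this] obtain j where "j < n" "v j = v n" using \<open>v n \<noteq> 0\<close> by auto
        then show False using inj[of j n] Suc.prems \<open>v n \<noteq> 0\<close> by auto
      qed
      moreover have "\<exists>j<Suc n. v j = Suc y" if "y \<in> set (zz (Suc n))" for y
        using that IH(2)[of y] unfolding e by (auto split: if_splits intro: less_SucI)
      ultimately show ?case using IH(1) unfolding e by auto
    qed (simp add: zz_def)
    then show ?thesis unfolding zs zz_def by blast
  qed
  ultimately show "distinct (items g 0 t @ zs)" using distinct_items[OF gb] by auto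
qed

lemma top_correct:
  assumes g: "good g t" and item_inv: "item_inv g t s" and t: "s (Q 14) 0 = t" and st: "\<And>a. s (Q 5) a < t"
    and cache: "\<And>a. (if t < s (Q 3) a then s (Q 2) a else s (Q 4) a) - 1 = AM g (items g 0 t) a"
    and X: "\<And>j. j < 4 \<Longrightarrow> s (W 2 0 t) j = (if j < length (pool g 0 t) then Suc (pool g 0 t ! j) else 0)"
  shows "top_inv g t (exec (topc t) s)"
proof -
  interpret memory_view rdt wtt tview "\<lambda>_ s. \<forall>a. s (Q 5) a \<le> s (Q 14) 0" G by (rule memory_view_top)
  define v where "v j = (if j < 4 then (if j < length (pool g 0 t) then Suc (pool g 0 t ! j) else 0)
      else if j = 4 then t - 1 else t)" for j
  let ?z = "\<lambda>j. if v j \<noteq> 0 \<and> v j - 1 \<in> alive g t then [v j - 1] else []"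
  have vt: "v j - 1 < t" if "v j \<noteq> 0" for j
  proof (cases "j < 4 \<and> j < length (pool g 0 t)")
    case True
    then have "pool g 0 t ! j \<in> set (pool g 0 t)" by simp
    then have "pool g 0 t ! j < t"
      using set_pool[of t g 0] alive_less[of "pool g 0 t ! j" g "t - 2"] by (cases "t < 2") (auto simp: start_def)
    then show ?thesis using True by (simp add: v_def)
  next
    case False
    then show ?thesis using that by (auto simp: v_def)
  qed
  have 0: "tview s = AM g (items g 0 t)" using cache st t by (auto simp: tview_def fun_eq_iff less_le)
  have "tview (exec (seqs (map (titem t) [0..<n])) s) = AM g (items g 0 t @ concat (map ?z [0..<n])) \<and>
    (\<forall>a. exec (seqs (map (titem t) [0..<n])) s (Q 5) a \<le> t) \<and>
    (\<forall>m. m \<notin> {scratch, Q 5, Q 6} \<longrightarrow> exec (seqs (map (titem t) [0..<n])) s m = s m)" if "n \<le> 6" for n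
    using that
  proof (induction n)
    case 0
    show ?case using 0 st by (simp add: less_imp_le \<open>tview s = _\<close>)
  next
    case (Suc n)
    define s1 where "s1 = exec (seqs (map (titem t) [0..<n])) s"
    have IH: "tview s1 = AM g (items g 0 t @ concat (map ?z [0..<n]))" "\<And>a. s1 (Q 5) a \<le> t"
      "\<And>m. m \<notin> {scratch, Q 5, Q 6} \<Longrightarrow> s1 m = s m"
      using Suc unfolding s1_def by auto
    define s2 where "s2 = put s1 scratch 2 (v n)"
    have e2: "eval (if n < 4 then Vr (W 2 0 t) n else if n = 4 then K (t - 1) else K t) s1 = v n"
      using X[of n] IH(3)[of "W 2 0 t"] by (auto simp: v_def scratch_def)
    have tv2: "tview s2 = tview s1" by (simp add: s2_def tview_def fun_eq_iff scratch_def)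
    have dt: "s2 (Q 12) = s (Q 12)" "s2 (Q 9) = s (Q 9)" "s2 (Q 14) 0 = t" "s2 (Q 5) = s1 (Q 5)" "s2 scratch 2 = v n"
      using IH(3) t by (auto simp: s2_def scratch_def)
    have gd: "eval (IfE (Vr scratch 2) (Op (-) (Rd 12 (Op (-) (Vr scratch 2) (K 1))) (K t)) (K 0)) s2 = 0
      \<longleftrightarrow> \<not> (v n \<noteq> 0 \<and> v n - 1 \<in> alive g t)"
    proof -
      have "t < s (Q 12) (v n - 1) \<longleftrightarrow> v n - 1 \<in> alive g t" if "v n \<noteq> 0"
        using item_inv vt[OF that] unfolding item_inv_def by blast
      then show ?thesis by (auto simp: dt)
    qed
    let ?e = "Rd 9 (Op (-) (Vr scratch 2) (K 1))"
    let ?s = "exec (seqs (map (titem t) [0..<Suc n])) s"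
    have ex: "?s = (if v n \<noteq> 0 \<and> v n - 1 \<in> alive g t then exec (call rdt wtt (inc_insert A) G ?e) s2 else s2)"
    proof -
      have "?s = exec (titem t n) s1" by (simp add: s1_def)
      then show ?thesis unfolding titem_def exec.simps e2 s2_def[symmetric] gd by simp
    qed
    have fr: "?s m = s m" if "m \<notin> {scratch, Q 5, Q 6}" for m
    proof -
      have "exec (call rdt wtt (inc_insert A) G ?e) s2 m = s2 m"
        using that wr_call_top by (intro exec_frame) blast
      moreover have "s2 m = s m" using that IH(3) by (simp add: s2_def)
      ultimately show ?thesis using ex by presburger
    qed
    show ?case
    proof (cases "v n \<noteq> 0 \<and> v n - 1 \<in> alive g t")
      case True
      have I: "\<forall>a. s2 (Q 5) a \<le> s2 (Q 14) 0" using IH(2) dt by simp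
      have ee: "eval ?e s2 = elem g (v n - 1)" using item_inv_keys[OF item_inv order.refl, of "v n - 1"] True dt by simp
      have s: "?s = exec (call rdt wtt (inc_insert A) G ?e) s2" using ex True by presburger
      have "tview ?s = AM g ((items g 0 t @ concat (map ?z [0..<n])) @ [v n - 1])"
        unfolding s call(2)[OF I] ee tv2 IH(1) amem_snoc ..
      moreover have "\<forall>a. ?s (Q 5) a \<le> ?s (Q 14) 0" unfolding s using call(1)[OF I] by blast
      moreover have "?s (Q 14) 0 = t" using fr[of "Q 14"] t by (simp add: scratch_def)
      ultimately show ?thesis using True fr by simp
    next
      case False
      then have s: "?s = s2" using ex by presburger
      have "tview ?s = AM g (items g 0 t @ concat (map ?z [0..<n]))" unfolding s tv2 IH(1) ..
      moreover have "\<forall>a. ?s (Q 5) a \<le> t" unfolding s using IH(2) dt by simp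
      moreover have "?z n = []" using False by auto
      ultimately show ?thesis using fr by simp
    qed
  qed
  from this[of 6] have "tview (exec (topc t) s) = AM g (items g 0 t @ concat (map ?z [0..<6]))"
    "\<forall>a. exec (topc t) s (Q 5) a \<le> t" "exec (topc t) s (Q 14) = s (Q 14)"
    unfolding topc_def by (auto simp: scratch_def)
  note tv = this
  have "\<forall>a. exec (topc t) s (Q 5) a \<le> exec (topc t) s (Q 14) 0" using tv(2,3) t by simp
  moreover have "set (items g 0 t @ concat (map ?z [0..<6])) = alive g t"
    "distinct (items g 0 t @ concat (map ?z [0..<6]))"
    by (rule top_items[OF g v_def refl])+
  ultimately show ?thesis using tv(1) unfolding top_inv_def by blast
qed

section \<open>The invariant of the whole state and a single operation\<close>

definition state_inv :: "(nat \<Rightarrow> vop) \<Rightarrow> nat \<Rightarrow> st \<Rightarrow> bool" where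
  "state_inv g t s \<longleftrightarrow> good g t \<and> t < 2 ^ L \<and> s (Q 14) 0 = t \<and> item_inv g t s \<and>
     trep (key g) L 0 (s (W 5 0 0)) (alive g t) t \<and> null_ok s \<and> nodes_ok g t s \<and> cache_inv t s \<and> top_inv g t s"

text \<open>The invariant looks only at the past of \<open>g\<close>, so the value at
  \<open>t\<close> can be chosen when the next operation becomes known.\<close>

lemma state_inv_cong:
  assumes "state_inv g t s" "\<And>u. u < t \<Longrightarrow> g' u = g u"
  shows "state_inv g' t s"
proof -
  have alive: "alive g' u = alive g u" if "u \<le> t" for u using assms(2) that by (intro alive_cong) auto
  have key: "key g' y = key g y" if "y < t" for y using assms(2)[OF that] by (simp add: key_def)
  have g: "good g t" using assms(1) by (simp add: state_inv_def)
  have "good g' t"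
    unfolding good_def
  proof (intro conjI allI impI)
    fix u assume u: "u \<le> t"
    have "inj_on (key g) (alive g u)" using g u by (simp add: good_def)
    moreover have "key g' y = key g y" if "y \<in> alive g u" for y using alive_less[OF that] u key by simp
    ultimately show "inj_on (key g') (alive g' u)" unfolding alive[OF u] by (simp cong: inj_on_cong)
  next
    fix u assume u: "u < t" "g' u = VD"
    then have "g u = VD" using assms(2) by metis
    then show "alive g' u \<noteq> {}" using g u alive[of u] by (simp add: good_def)
  qed
  moreover have "item_inv g' t s"
    using assms alive unfolding state_inv_def item_inv_def by auto
  moreover have "trep (key g') L 0 (s (W 5 0 0)) (alive g' t) t"
  proof -
    have "trep (key g) L 0 (s (W 5 0 0)) (alive g t) t" using assms(1) by (simp add: state_inv_def)
    then have "trep (key g') L 0 (s (W 5 0 0)) (alive g t) t"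
      by (rule trep_cong) (auto dest: alive_less simp: key)
    then show ?thesis using alive by simp
  qed
  moreover have "nodes_ok g' t s"
    unfolding nodes_ok_def
  proof (intro allI impI)
    fix i k assume ik: "i < L" "2 \<le> (k::nat)"
    have n: "node_inv g i k (progress t i k) s" using assms(1) ik unfolding state_inv_def nodes_ok_def by blast
    show "node_inv g' i k (progress t i k) s"
    proof (cases "start i k \<le> t")
      case True
      show ?thesis by (rule node_inv_cong[OF n True ik(2) assms(2) g])
    next
      case False
      then show ?thesis using n node_inv_zero[of g i k s g'] progress_zero[of t i k] by simp
    qed
  qed
  moreover have "top_inv g' t s"
  proof -
    obtain ys where ys: "set ys = alive g t" "distinct ys" "tview s = AM g ys" "\<forall>a. s (Q 5) a \<le> s (Q 14) 0"
      using assms(1) unfolding state_inv_def top_inv_def by blast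
    have "AM g' ys = AM g ys"
    proof (rule amem_cong)
      fix y assume "y \<in> set ys"
      then have "y < t" using ys(1) alive_less by blast
      then show "g' y = g y" by (rule assms(2))
    qed
    then show ?thesis using ys alive unfolding top_inv_def by auto
  qed
  ultimately show ?thesis using assms(1) unfolding state_inv_def by blast
qed

lemma state_inv_init: "0 < L \<Longrightarrow> state_inv g 0 (\<lambda>_ _. 0)"
proof -
  have "node_inv g i k 0 (\<lambda>_ _. 0)" for i k
    by (simp add: node_inv_def cont_def logged_def trep_zero)
  then have "nodes_ok g 0 (\<lambda>_ _. 0)" by (simp add: nodes_ok_def progress_def)
  moreover have "cache_inv 0 (\<lambda>_ _. 0)" unfolding cache_inv_def swept_def cspec_def hit_def
    by (intro exI[of _ "\<lambda>_. 0"]) auto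
  moreover have "top_inv g 0 (\<lambda>_ _. 0)" unfolding top_inv_def
    by (intro conjI exI[of _ "[]"]) (auto simp: tview_def)
  moreover have "item_inv g 0 (\<lambda>_ _. 0)" by (simp add: item_inv_def)
  moreover have "good g 0" by (simp add: good_def)
  ultimately show "state_inv g 0 (\<lambda>_ _. 0)"
    by (simp add: state_inv_def null_ok_def trep_zero)
qed

definition pins :: "nat \<Rightarrow> com" where
  "pins u = Seq (SetV (Q 9) u (Vr (Q 14) 2)) (Seq (SetV keys u (Vr (Q 14) 3))
    (Seq (SetV (Q 12) u (K (2 ^ L + 1))) (Seq (SetV scratch 2 (K (Suc u))) (ins (W 5 0 0) L 0 u))))"

definition pdel :: "nat \<Rightarrow> com" where
  "pdel u = Seq (SetV scratch 2 (Vr (W 5 0 0) 0))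
    (Seq (Set (Q 12) (Op (-) (Vr scratch 2) (K 1)) (K (Suc u))) (ext (W 5 0 0) L 0))"

definition rest :: "nat \<Rightarrow> com" where
  "rest u = Seq (sweep u) (Seq (jobs u) (Seq (SetV (Q 14) 0 (K (Suc u))) (topc (Suc u))))"

definition pnames :: "nm set" where
  "pnames = {scratch, Q 9, keys, Q 12, W 5 0 0}"

lemma wr_pins: "wr (pins u) \<subseteq> pnames" by (auto simp: pins_def pnames_def)

lemma wr_pdel: "wr (pdel u) \<subseteq> pnames" by (auto simp: pdel_def pnames_def)

lemma pins_correct:
  assumes I: "state_inv g u s" and g: "good g (Suc u)" "g u = VI (s (Q 14) 2) (s (Q 14) 3)"
  shows "item_inv g (Suc u) (exec (pins u) s)" "trep (key g) L 0 (exec (pins u) s (W 5 0 0)) (alive g (Suc u)) (Suc u)"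
proof -
  have B: "item_inv g u s" and uL: "u < 2 ^ L" and tr: "trep (key g) L 0 (s (W 5 0 0)) (alive g u) u"
    using I by (auto simp: state_inv_def)
  define s1 where "s1 = put (put (put (put s (Q 9) u (s (Q 14) 2)) keys u (s (Q 14) 3)) (Q 12) u (2 ^ L + 1)) scratch 2 (Suc u)"
  have e: "exec (pins u) s = exec (ins (W 5 0 0) L 0 u) s1"
    by (simp add: pins_def s1_def keys_def)
  have fr: "exec (pins u) s n = s1 n" if "n \<noteq> W 5 0 0" for n
    unfolding e using that by (intro exec_frame) simp
  have als: "alive g (Suc u) = insert u (alive g u)" using g(2) by simp
  have dt: "exec (pins u) s (Q 12) = (s (Q 12))(u := 2 ^ L + 1)" "exec (pins u) s (Q 9) = (s (Q 9))(u := s (Q 14) 2)"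
    "exec (pins u) s keys = (s keys)(u := s (Q 14) 3)"
    using fr by (auto simp: s1_def scratch_def keys_def)
  have dT: "s (Q 12) y \<le> u \<or> s (Q 12) y = 2 ^ L + 1" for y using B by (simp add: item_inv_def)
  have old: "b < s (Q 12) y \<longleftrightarrow> y \<in> alive g b" if "b \<le> u" "y < b" for y b using B that by (simp add: item_inv_def)
  show B': "item_inv g (Suc u) (exec (pins u) s)"
    unfolding item_inv_def dt
  proof (intro conjI allI impI)
    fix y e p assume "y < Suc u" "g y = VI e p"
    then show "((s (Q 9))(u := s (Q 14) 2)) y = e" "((s keys)(u := s (Q 14) 3)) y = p"
      using B g(2) by (auto simp: item_inv_def less_Suc_eq)
  next
    fix y b assume b: "b \<le> Suc u" "y < b"
    show "(b < ((s (Q 12))(u := 2 ^ L + 1)) y) = (y \<in> alive g b)"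
    proof (cases "b = Suc u")
      case True
      show ?thesis
      proof (cases "y = u")
        case True
        then show ?thesis using \<open>b = Suc u\<close> uL als by simp
      next
        case False
        then have "y < u" using b by simp
        then have "u < s (Q 12) y \<longleftrightarrow> y \<in> alive g u" using old by simp
        moreover have "Suc u < s (Q 12) y \<longleftrightarrow> u < s (Q 12) y" using dT[of y] uL by auto
        ultimately show ?thesis using \<open>b = Suc u\<close> False als by simp
      qed
    next
      case False
      then show ?thesis using old[of b y] b by simp
    qed
  next
    fix y
    show "((s (Q 12))(u := 2 ^ L + 1)) y \<le> Suc u \<or> ((s (Q 12))(u := 2 ^ L + 1)) y = 2 ^ L + 1"
      using dT[of y] by auto
    assume "Suc u \<le> y"
    then show "((s (Q 12))(u := 2 ^ L + 1)) y = 0" using B by (simp add: item_inv_def)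
  qed
  have "trep (key g) L 0 (exec (ins (W 5 0 0) L 0 u) s1 (W 5 0 0)) (insert u (alive g u)) (Suc u) \<and>
    (\<forall>z. z < 0 \<or> 0 + 2 ^ Suc L \<le> z + 1 \<longrightarrow> exec (ins (W 5 0 0) L 0 u) s1 (W 5 0 0) z = s1 (W 5 0 0) z)"
  proof (rule ins_correct)
    show "trep (key g) L 0 (s1 (W 5 0 0)) (alive g u) u" using tr by (simp add: s1_def scratch_def keys_def)
    show "inj_on (key g) (insert u (alive g u))" using inj_alive[OF g(1) order.refl] als by simp
    show "s1 keys y = key g y" if "y \<in> insert u (alive g u)" for y
      using item_inv_keys[OF B' order.refl, of y] that fr[of keys] unfolding als by (simp add: keys_def)
    show "u \<notin> alive g u" using alive_less by blast
  qed (use uL in \<open>auto simp: s1_def keys_def scratch_def\<close>)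
  then show "trep (key g) L 0 (exec (pins u) s (W 5 0 0)) (alive g (Suc u)) (Suc u)"
    unfolding e als by blast
qed

lemma pdel_correct:
  assumes I: "state_inv g u s" and g: "good g (Suc u)" "g u = VD"
  shows "item_inv g (Suc u) (exec (pdel u) s)" "trep (key g) L 0 (exec (pdel u) s (W 5 0 0)) (alive g (Suc u)) (Suc u)"
proof -
  have B: "item_inv g u s" and uL: "u < 2 ^ L" and tr: "trep (key g) L 0 (s (W 5 0 0)) (alive g u) u"
    using I by (auto simp: state_inv_def)
  let ?m = "argmin (key g) (alive g u)"
  have ne: "alive g u \<noteq> {}" using g by (simp add: good_def)
  have m: "?m \<in> alive g u" using argmin_in[OF finite_alive ne] .
  have mu: "?m < u" using alive_less[OF m] .
  define s1 where "s1 = put (put s scratch 2 (Suc ?m)) (Q 12) ?m (Suc u)"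
  have rt: "s (W 5 0 0) 0 = Suc ?m" using trep_root[OF tr] ne by (simp add: winner_def)
  have e: "exec (pdel u) s = exec (ext (W 5 0 0) L 0) s1"
    by (simp add: pdel_def s1_def rt scratch_def)
  have fr: "exec (pdel u) s n = s1 n" if "n \<noteq> W 5 0 0" for n
    unfolding e using that by (intro exec_frame) simp
  have als: "alive g (Suc u) = alive g u - {?m}" using g(2) by simp
  have dt: "exec (pdel u) s (Q 12) = (s (Q 12))(?m := Suc u)" "exec (pdel u) s (Q 9) = s (Q 9)"
    "exec (pdel u) s keys = s keys"
    using fr by (auto simp: s1_def scratch_def keys_def)
  have dT: "s (Q 12) y \<le> u \<or> s (Q 12) y = 2 ^ L + 1" for y using B by (simp add: item_inv_def)
  have dz: "s (Q 12) y = 0" if "u \<le> y" for y using B that by (simp add: item_inv_def)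
  have old: "b < s (Q 12) y \<longleftrightarrow> y \<in> alive g b" if "b \<le> u" "y < b" for y b using B that by (simp add: item_inv_def)
  show B': "item_inv g (Suc u) (exec (pdel u) s)"
    unfolding item_inv_def dt
  proof (intro conjI allI impI)
    fix y e p assume "y < Suc u" "g y = VI e p"
    then show "s (Q 9) y = e" "s keys y = p"
      using B g(2) by (auto simp: item_inv_def less_Suc_eq)
  next
    fix y b assume b: "b \<le> Suc u" "y < b"
    show "(b < ((s (Q 12))(?m := Suc u)) y) = (y \<in> alive g b)"
    proof (cases "b = Suc u")
      case True
      consider "y = u" | "y = ?m" | "y < u" "y \<noteq> ?m" using b True by linarith
      then show ?thesis
      proof cases
        case 1
        then show ?thesis using True dz[of u] als mu alive_less[of u g u] by auto
      next
        case 2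
        then show ?thesis using True als by simp
      next
        case 3
        then have "u < s (Q 12) y \<longleftrightarrow> y \<in> alive g u" using old by simp
        moreover have "Suc u < s (Q 12) y \<longleftrightarrow> u < s (Q 12) y" using dT[of y] uL by auto
        ultimately show ?thesis using True 3 als by simp
      qed
    next
      case False
      show ?thesis
      proof (cases "y = ?m")
        case True
        then have "y \<in> alive g b" using alive_mono[OF m] b False by simp
        then show ?thesis using True b False by simp
      next
        case y: False
        then show ?thesis using old[of b y] b False by simp
      qed
    qed
  next
    fix y
    show "((s (Q 12))(?m := Suc u)) y \<le> Suc u \<or> ((s (Q 12))(?m := Suc u)) y = 2 ^ L + 1"
      using dT[of y] by auto
    assume "Suc u \<le> y"
    then show "((s (Q 12))(?m := Suc u)) y = 0" using dz mu by simp
  qed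
  have "trep (key g) L 0 (exec (ext (W 5 0 0) L 0) s1 (W 5 0 0)) (alive g u - {?m}) u \<and>
    (\<forall>z. z < 0 \<or> 0 + 2 ^ Suc L \<le> z + 1 \<longrightarrow> exec (ext (W 5 0 0) L 0) s1 (W 5 0 0) z = s1 (W 5 0 0) z)"
  proof (rule ext_correct)
    show "trep (key g) L 0 (s1 (W 5 0 0)) (alive g u) u" using tr by (simp add: s1_def scratch_def)
    show "inj_on (key g) (alive g u)" using inj_alive[OF g(1), of u] by simp
    show "s1 keys y = key g y" if "y \<in> alive g u" for y
      using item_inv_keys[OF B order.refl that] by (simp add: s1_def keys_def scratch_def)
  qed (use ne in \<open>auto simp: keys_def\<close>)
  then have "trep (key g) L 0 (exec (pdel u) s (W 5 0 0)) (alive g (Suc u)) u"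
    unfolding e als by blast
  then show "trep (key g) L 0 (exec (pdel u) s (W 5 0 0)) (alive g (Suc u)) (Suc u)"
    by (rule trep_mono) simp
qed

lemma rest_correct:
  assumes I: "state_inv g u s0" and g: "good g (Suc u)" and uL: "Suc u < 2 ^ L"
    and fr: "\<And>n. n \<notin> pnames \<Longrightarrow> s n = s0 n"
    and item_inv: "item_inv g (Suc u) s" and tr: "trep (key g) L 0 (s (W 5 0 0)) (alive g (Suc u)) (Suc u)"
  shows "state_inv g (Suc u) (exec (rest u) s)"
proof -
  have fW: "s (W c i k) = s0 (W c i k)" if "c < 5" for c i k using fr that by (simp add: pnames_def scratch_def keys_def)
  have gu: "good g u" using I by (simp add: state_inv_def)
  have nd: "nodes_ok g u s"
    unfolding nodes_ok_def
  proof (intro allI impI)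
    fix i k assume ik: "i < L" "2 \<le> (k::nat)"
    show "node_inv g i k (progress u i k) s"
    proof (rule node_inv_frame)
      show "node_inv g i k (progress u i k) s0" using I ik unfolding state_inv_def nodes_ok_def by blast
      show "2 \<le> k \<and> (\<forall>n\<in>set (chain (Suc i) (k div 2)). s n = s0 n)"
        using ik chain_level fW by fastforce
    qed (use fW in auto)
  qed
  have nl: "null_ok s" using I fW unfolding state_inv_def null_ok_def by metis
  have ci: "cache_inv u s"
  proof -
    obtain lt where lt: "\<forall>a. lt a \<le> u - 1 \<and> cspec s0 (lt a) a" "swept u s0 lt"
      using I unfolding state_inv_def cache_inv_def by blast
    have "cspec s (lt a) a" for a
      by (rule cspec_cong[of s0]) (use lt fr fW in \<open>auto simp: pnames_def scratch_def keys_def\<close>)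
    moreover have "swept u s lt" using lt(2) fW unfolding swept_def by simp
    ultimately show ?thesis using lt(1) unfolding cache_inv_def by blast
  qed
  have tg: "tagged s u"
    unfolding tagged_def
  proof (intro allI impI ballI)
    fix j k a assume j: "j < L" and k: "k \<in> {u div 2 ^ j, u div 2 ^ j + 1}"
    show "s (W 1 j k) a = (if s (W 0 j k) a = 0 then 0 else Suc j)"
    proof (cases "k < 2")
      case True
      then show ?thesis using nl by (simp add: null_ok_def)
    next
      case False
      then have "logged j k {..<11 * 2 ^ j * (G + 1)} s"
        using node_inv_complete(3) nodes_complete[OF nd gu j, of k] k by auto
      then show ?thesis by (auto simp: logged_def)
    qed
  qed
  define s1 where "s1 = exec (sweep u) s"
  define s2 where "s2 = exec (jobs u) s1"
  define s3 where "s3 = put s2 (Q 14) 0 (Suc u)"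
  have f1: "s1 n = s n" if "n \<notin> {scratch, Q 2, Q 3, Q 4}" for n
    unfolding s1_def using that wr_sweep by (intro exec_frame) blast
  have f2: "s2 n = s1 n" if "n \<notin> jnames u" for n
    unfolding s2_def using that wr_jobs by (intro exec_frame) blast
  have e: "exec (rest u) s = exec (topc (Suc u)) s3" by (simp add: rest_def s1_def s2_def s3_def)
  have f3: "exec (rest u) s n = s3 n" if "n \<notin> {scratch, Q 5, Q 6}" for n
    unfolding e using that wr_top by (intro exec_frame) blast
  have W1: "s1 (W c i k) = s (W c i k)" for c i k using f1 by (simp add: scratch_def)
  have ci1: "cache_inv (Suc u) s1" unfolding s1_def by (rule sweep_correct[OF tg ci])
  have nd1: "nodes_ok g u s1"
    unfolding nodes_ok_def
  proof (intro allI impI)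
    fix i k assume ik: "i < L" "2 \<le> (k::nat)"
    show "node_inv g i k (progress u i k) s1"
    proof (rule node_inv_frame)
      show "node_inv g i k (progress u i k) s" using nd ik unfolding nodes_ok_def by blast
      show "2 \<le> k \<and> (\<forall>n\<in>set (chain (Suc i) (k div 2)). s1 n = s n)"
        using ik chain_level W1 by fastforce
    qed (use W1 in auto)
  qed
  have nl1: "null_ok s1" using nl W1 by (simp add: null_ok_def)
  have BI1: "item_inv g (Suc u) s1" using item_inv f1 by (simp add: item_inv_def scratch_def keys_def)
  have nd2: "nodes_ok g (Suc u) s2"
    unfolding s2_def using jobs_correct[OF g BI1 nl1 nd1] uL by simp
  have ci2: "cache_inv (Suc u) s2"
    by (rule cache_inv_cong[OF ci1]) (use f2 in \<open>auto simp: jnames_def scratch_def\<close>)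
  have W2: "s2 (W c i k) = s1 (W c i k)" if "k < 2" for c i k
    using f2 that by (simp add: jnames_def scratch_def)
  have nl2: "null_ok s2" using nl1 W2 by (simp add: null_ok_def)
  have W3: "s3 (W c i k) = s2 (W c i k)" for c i k by (simp add: s3_def)
  have NIeq: "node_inv g i k c s' \<longleftrightarrow> node_inv g i k c s2" if "\<And>c i k. s' (W c i k) = s2 (W c i k)" for s' i k c
  proof -
    have "first s' (chain i k) a = first s2 (chain i k) a" for a
      using chain_level that by (intro first_cong) fastforce
    then show ?thesis using that by (simp add: node_inv_def logged_def)
  qed
  have nd3: "nodes_ok g (Suc u) s3" using nd2 NIeq[OF W3] by (simp add: nodes_ok_def)
  have nl3: "null_ok s3" using nl2 W3 by (simp add: null_ok_def)
  have ci3: "cache_inv (Suc u) s3"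
    by (rule cache_inv_cong[OF ci2]) (auto simp: s3_def)
  have BI3: "item_inv g (Suc u) s3"
    using BI1 f2 by (simp add: item_inv_def s3_def jnames_def scratch_def keys_def)
  have lg: "logged i k {..<11 * 2 ^ i * (G + 1)} s3" if "i < L" "2 \<le> k" "k * 2 ^ i \<le> Suc u" for i k
  proof -
    have "k \<le> Suc u div 2 ^ i + 1" using that(3) by (simp add: less_eq_div_iff_mult_less_eq le_SucI)
    then show ?thesis using node_inv_complete(3) nodes_complete[OF nd3 g that(1,2)] that(2) by blast
  qed
  have L0: "0 < L" using uL by (cases L) auto
  have cache: "(if Suc u < s3 (Q 3) a then s3 (Q 2) a else s3 (Q 4) a) - 1 = AM g (items g 0 (Suc u)) a" for a
  proof -
    have "(if Suc u < s3 (Q 3) a then s3 (Q 2) a else s3 (Q 4) a) = first s3 (chain 0 (Suc u)) a"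
      by (rule cache_read[OF ci3 nl3 uL lg])
    moreover have "first s3 (chain 0 (Suc u)) a - 1 = AM g (items g 0 (Suc u)) a"
    proof (cases "Suc u < 2")
      case False
      then show ?thesis using node_inv_complete(2) nodes_complete[OF nd3 g L0, of "Suc u"] by simp
    qed simp
    ultimately show ?thesis by simp
  qed
  have X: "s3 (W 2 0 (Suc u)) j = (if j < length (pool g 0 (Suc u)) then Suc (pool g 0 (Suc u) ! j) else 0)" if "j < 4" for j
  proof (cases "Suc u < 2")
    case True
    then show ?thesis using nl3 by (simp add: null_ok_def)
  next
    case False
    then show ?thesis using node_inv_complete(1)[of "Suc u" g 0 s3 j] nodes_complete[OF nd3 g L0, of "Suc u"] that by simp
  qed
  \<comment> \<open>All stamps stem from earlier times, so the overlay of the new time starts out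
    empty.\<close>
  have st: "s3 (Q 5) a < Suc u" for a
  proof -
    have "s3 (Q 5) = s0 (Q 5)" using f1 f2 fr by (simp add: s3_def jnames_def scratch_def pnames_def keys_def)
    moreover have "s0 (Q 5) a \<le> u" using I unfolding state_inv_def top_inv_def by metis
    ultimately show ?thesis by simp
  qed
  have "s3 (Q 14) 0 = Suc u" by (simp add: s3_def)
  from top_correct[OF g BI3 this st cache X] have TP: "top_inv g (Suc u) (exec (rest u) s)" unfolding e .
  have W4: "exec (rest u) s (W c i k) = s2 (W c i k)" for c i k using f3 W3 by (simp add: scratch_def)
  have "nodes_ok g (Suc u) (exec (rest u) s)" using nd2 NIeq[OF W4] by (simp add: nodes_ok_def)
  moreover have "null_ok (exec (rest u) s)" using nl2 W4 by (simp add: null_ok_def)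
  moreover have "cache_inv (Suc u) (exec (rest u) s)"
    by (rule cache_inv_cong[OF ci2]) (use W4 f3 in \<open>auto simp: s3_def scratch_def\<close>)
  moreover have "item_inv g (Suc u) (exec (rest u) s)"
    using BI3 f3 by (simp add: item_inv_def scratch_def keys_def)
  moreover have "exec (rest u) s (Q 14) 0 = Suc u" using f3 by (simp add: s3_def scratch_def)
  moreover have "exec (rest u) s (W 5 0 0) = s (W 5 0 0)"
    using W4 f2[of "W 5 0 0"] f1[of "W 5 0 0"] by (simp add: jnames_def scratch_def)
  ultimately show ?thesis using g uL tr TP by (simp add: state_inv_def)
qed

lemma rest_regs: "j \<noteq> 0 \<Longrightarrow> exec (rest u) s (Q 14) j = s (Q 14) j"
proof -
  assume "j \<noteq> 0"
  have 1: "exec (topc t) s' (Q 14) = s' (Q 14)" for t s'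
    using wr_top by (intro exec_frame) (fastforce simp: scratch_def)
  have 2: "exec (jobs t) s' (Q 14) = s' (Q 14)" for t s'
    using wr_jobs by (intro exec_frame) (fastforce simp: scratch_def jnames_def)
  have 3: "exec (sweep t) s' (Q 14) = s' (Q 14)" for t s'
    using wr_sweep by (intro exec_frame) (fastforce simp: scratch_def)
  show ?thesis using \<open>j \<noteq> 0\<close> by (simp add: rest_def 1 2 3)
qed

text \<open>Binary search for the current time selects the piece of code made for it, at an
  additional cost of \<open>O(L)\<close>.\<close>

fun disp :: "(nat \<Rightarrow> com) \<Rightarrow> nat \<Rightarrow> nat \<Rightarrow> com" where
  "disp f lo 0 = f lo"
| "disp f lo (Suc h) = If (Op (-) (K (lo + 2 ^ h)) (Vr (Q 14) 0)) (disp f lo h) (disp f (lo + 2 ^ h) h)"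

lemma exec_disp: "lo \<le> s (Q 14) 0 \<Longrightarrow> s (Q 14) 0 < lo + 2 ^ h \<Longrightarrow> exec (disp f lo h) s = exec (f (s (Q 14) 0)) s"
proof (induction h arbitrary: lo)
  case 0
  then have "s (Q 14) 0 = lo" by simp
  then show ?case by simp
qed auto

definition INS :: com where "INS = disp (\<lambda>u. Seq (pins u) (rest u)) 0 L"

definition DELMIN :: com where "DELMIN = disp (\<lambda>u. Seq (pdel u) (rest u)) 0 L"

lemma INS_correct:
  assumes "state_inv g u s" "good g (Suc u)" "g u = VI (s (Q 14) 2) (s (Q 14) 3)" "Suc u < 2 ^ L"
  shows "state_inv g (Suc u) (exec INS s)" "j \<noteq> 0 \<Longrightarrow> exec INS s (Q 14) j = s (Q 14) j"
proof -
  have e: "exec INS s = exec (rest u) (exec (pins u) s)"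
    using assms exec_disp[of 0 s L] by (simp add: INS_def state_inv_def)
  have fr: "exec (pins u) s n = s n" if "n \<notin> pnames" for n using that wr_pins by (intro exec_frame) blast
  show "state_inv g (Suc u) (exec INS s)"
    unfolding e by (rule rest_correct[OF assms(1,2,4) fr pins_correct[OF assms(1-3)]])
  show "j \<noteq> 0 \<Longrightarrow> exec INS s (Q 14) j = s (Q 14) j"
    unfolding e using fr[of "Q 14"] by (simp add: rest_regs pnames_def scratch_def keys_def)
qed

lemma DELMIN_correct:
  assumes "state_inv g u s" "good g (Suc u)" "g u = VD" "Suc u < 2 ^ L"
  shows "state_inv g (Suc u) (exec DELMIN s)" "j \<noteq> 0 \<Longrightarrow> exec DELMIN s (Q 14) j = s (Q 14) j"
proof -
  have e: "exec DELMIN s = exec (rest u) (exec (pdel u) s)"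
    using assms exec_disp[of 0 s L] by (simp add: DELMIN_def state_inv_def)
  have fr: "exec (pdel u) s n = s n" if "n \<notin> pnames" for n using that wr_pdel by (intro exec_frame) blast
  show "state_inv g (Suc u) (exec DELMIN s)"
    unfolding e by (rule rest_correct[OF assms(1,2,4) fr pdel_correct[OF assms(1-3)]])
  show "j \<noteq> 0 \<Longrightarrow> exec DELMIN s (Q 14) j = s (Q 14) j"
    unfolding e using fr[of "Q 14"] by (simp add: rest_regs pnames_def scratch_def keys_def)
qed

end

section \<open>Running times\<close>

lemma wc_seqs: "(\<And>c. c \<in> set xs \<Longrightarrow> wc L c \<le> b) \<Longrightarrow> wc L (seqs xs) \<le> length xs * b + 1"
proof (induction xs)
  case (Cons a xs)
  then show ?case using add_mono[of "wc L a" b "wc L (seqs xs)" "length xs * b + 1"] by simp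
qed simp

lemma length_chain: "k < 2 ^ m \<Longrightarrow> length (chain i k) \<le> m"
proof (induction m arbitrary: i k)
  case (Suc m)
  then show ?case using Suc.IH[of "k div 2" "Suc i"] by (cases "k < 2") (auto simp: chain_eq)
qed simp

lemma chain_ok:
  assumes "j < L" "u < 2 ^ L" "k \<le> u div 2 ^ j + 2"
  shows "length (chain j k) \<le> L + 2" "n \<in> set (chain j k) \<Longrightarrow> okn L n \<and> wide n" "k < 2 ^ (L + 2)" "j < 2 ^ L"
proof -
  have "u div 2 ^ j \<le> u" by (rule div_le_dividend)
  then have "k < 2 ^ L + 2" using assms by linarith
  moreover have "(1::nat) \<le> 2 ^ L" by simp
  moreover have "(2::nat) ^ (L + 2) = 4 * 2 ^ L" by (simp add: power_add)
  ultimately show k: "k < 2 ^ (L + 2)" by linarith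
  then show "length (chain j k) \<le> L + 2" by (rule length_chain)
  have LL: "L < 2 ^ L" by simp
  then show "j < 2 ^ L" using assms by linarith
  assume "n \<in> set (chain j k)"
  then obtain d where n: "n = W 0 (j + d) (k div 2 ^ d)" "2 \<le> k div 2 ^ d" using chain_mem by blast
  have "u < 2 ^ (L - j) * 2 ^ j" using assms by (simp add: power_add[symmetric])
  then have "u div 2 ^ j < 2 ^ (L - j)" by (simp add: less_mult_imp_div_less)
  moreover have "(2::nat) \<le> 2 ^ (L - j)" using power_increasing[of 1 "L - j" "2::nat"] assms(1) by simp
  ultimately have "k < 2 ^ Suc (L - j)" using assms(3) by simp
  moreover have "2 * 2 ^ d \<le> k" using n(2) by (simp add: less_eq_div_iff_mult_less_eq)
  ultimately have "(2::nat) * 2 ^ d < 2 * 2 ^ (L - j)" unfolding power_Suc by linarith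
  then have "d < L - j" by simp
  then have "j + d < 2 ^ L" using LL by linarith
  moreover have "k div 2 ^ d < 2 ^ (L + 2)" using k div_le_dividend[of k "2 ^ d"] by linarith
  ultimately show "okn L n \<and> wide n" using n by simp
qed

context params
begin

text \<open>The unit of cost for one simulated insertion: \<open>G + 1\<close> writes or steps, each
  with a walk through \<open>O(L)\<close> ancestors.\<close>

definition H :: nat where "H = (G + 1) * (L + 1)"

lemma H_ge: "G + 1 \<le> H" "L + 1 \<le> H"
  by (simp_all add: H_def)

lemma wc_call_bound:
  assumes "\<And>n. cost L (rd (K n)) \<le> r" "\<And>n. cost L (rd (rd (K n))) \<le> r" "\<And>f. wc L (wt f) \<le> w"
    "2 * r + w + 10 \<le> c * (L + 1)"
  shows "wc L (call rd wt P G e) \<le> c * H + cost L e"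
proof -
  have "(G + 1) * (2 * r + w + 10) \<le> (G + 1) * (c * (L + 1))" using assms(4) by (rule mult_left_mono) simp
  also have "\<dots> = c * H" by (simp add: H_def algebra_simps)
  finally show ?thesis
    using wc_call[where rd = rd and wt = wt and P = P and f = G and e = e, OF assms(1-3)] by linarith
qed

lemma wc_job:
  assumes "i < L" "u < 2 ^ L"
  shows "wc L (job i (u div 2 ^ i + 2) c) \<le> 480 * H"
proof -
  let ?k = "u div 2 ^ i + 2"
  have ch: "length (chain i ?k) \<le> L + 2" using chain_ok(1)[OF assms] by simp
  have r: "cost L (rdj i ?k (K n)) \<le> 12 * L + 56" "cost L (rdj i ?k (rdj i ?k (K n))) \<le> 12 * L + 56" for n
    using ch by (simp_all add: rdj_def)
  have w: "wc L (wtj i ?k c' f) \<le> 4 * L + 39" for c' f by (simp add: wtj_def scratch_def)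
  have "wc L (call (rdj i ?k) (wtj i ?k c') (inc_insert A) G e) \<le> 161 * H + cost L e" for c' e
    by (rule wc_call_bound[OF r w]) simp
  from this[of _ "Rd 9 (Op (-) (Vr scratch 2) (K 1))"]
  have call: "wc L (call (rdj i ?k) (wtj i ?k c') (inc_insert A) G (Rd 9 (Op (-) (Vr scratch 2) (K 1)))) \<le> 161 * H + 11" for c'
    by simp
  have i5: "Suc (i + 4) \<le> 5 * H" using assms H_ge by linarith
  have "wc L (ins (W 3 i ?k) (i + 4) 0 c) \<le> 200 * H" by (rule order_trans[OF wc_ins]) (use i5 in simp)
  then have "wc L (loadc i ?k c) \<le> 480 * H" using H_ge by (auto simp: loadc_def max_def)
  moreover have "wc L (ext (W 3 i ?k) (i + 4) 0) \<le> 300 * H" by (rule order_trans[OF wc_ext]) (use i5 in simp)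
  then have "wc L (extrc i ?k c') \<le> 480 * H" for c' using H_ge call[of c'] by (auto simp: extrc_def max_def)
  ultimately show ?thesis by (simp add: job_def)
qed

text \<open>\<open>L\<close> levels with 22 commands each, of cost \<open>O(H)\<close> per command;
  with \<open>H = (G + 1) * (L + 1)\<close> this is one source of the squared logarithm.\<close>

lemma wc_jobs:
  assumes "u < 2 ^ L"
  shows "wc L (jobs u) \<le> 10562 * (H * (L + 1))"
proof -
  have "wc L (jobs u) \<le> L * (10561 * H) + 1"
    unfolding jobs_def
  proof (rule order_trans[OF wc_seqs[of _ L "10561 * H"]])
    fix c assume "c \<in> set (map (\<lambda>i. seqs (map (job i (u div 2 ^ i + 2)) [22 * (u mod 2 ^ i)..<22 * (u mod 2 ^ i + 1)])) [0..<L])"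
    then obtain i where i: "i < L" "c = seqs (map (job i (u div 2 ^ i + 2)) [22 * (u mod 2 ^ i)..<22 * (u mod 2 ^ i + 1)])" by auto
    have "wc L c \<le> length (map (job i (u div 2 ^ i + 2)) [22 * (u mod 2 ^ i)..<22 * (u mod 2 ^ i + 1)]) * (480 * H) + 1"
      unfolding i(2) using wc_job[OF i(1) assms] by (intro wc_seqs) auto
    also have "\<dots> = 22 * (480 * H) + 1" by simp
    finally show "wc L c \<le> 10561 * H" using H_ge by linarith
  qed simp
  also have "\<dots> \<le> 10562 * (H * (L + 1))" using H_ge by (simp add: algebra_simps)
  finally show ?thesis .
qed

lemma wc_touch:
  assumes "u < 2 ^ L"
  shows "wc L (touch u) \<le> 103 * (L + 1)"
proof -
  have ln: "length (unames u js) = 2 * length js" for js by (induction js) (auto simp: unames_def)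
  have leaf: "wc L (tleaf u j) \<le> 12 * L + 82" if "j < L" for j
    using chain_ok(1)[OF that assms, of "u div 2 ^ j"] chain_ok(1)[OF that assms, of "u div 2 ^ j + 1"]
    by (simp add: tleaf_def)
  have "wc L (tsel u js) \<le> 11 * length js + 12 * L + 82" if "\<forall>j\<in>set js. j < L" for js
    using that
  proof (induction js)
    case (Cons j js)
    then show ?case using leaf[of j] by simp
  qed simp
  from this[of "[0..<L]"] have "wc L (tsel u [0..<L]) \<le> 23 * L + 82" by simp
  then show ?thesis by (simp add: touch_def ln)
qed

text \<open>The \<open>33 * (G + 1)\<close> slots per level, over \<open>L\<close> levels, need one
  refresh of cost \<open>O(L)\<close> each; the other source of the squared logarithm.\<close>

lemma wc_sweep:
  assumes "u < 2 ^ L"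
  shows "wc L (sweep u) \<le> 3763 * (H * (L + 1))"
proof -
  have len: "length (entries u) = L * (33 * (G + 1))"
  proof -
    have "length (concat (map f is)) = length is * m" if "\<And>i. length (f i) = m" for f :: "nat \<Rightarrow> (nat \<times> nat \<times> nat) list" and "is" m
      using that by (induction "is") auto
    from this[of "\<lambda>i. concat (map (\<lambda>k. map (\<lambda>q. (i, k, q))
      [11 * (G + 1) * (u mod 2 ^ i)..<11 * (G + 1) * (u mod 2 ^ i + 1)])
      [u div 2 ^ i - 1, u div 2 ^ i, u div 2 ^ i + 1])" "33 * (G + 1)" "[0..<L]"]
    show ?thesis unfolding entries_def by simp
  qed
  have "wc L (refresh u x) \<le> 114 * (L + 1)" for x
    using wc_touch[OF assms] by (cases x) (simp add: refresh_def)
  then have "wc L (sweep u) \<le> length (map (refresh u) (entries u)) * (114 * (L + 1)) + 1"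
    unfolding sweep_def by (intro wc_seqs) auto
  also have "\<dots> = 3762 * (H * L) + 1" by (simp add: len H_def algebra_simps)
  also have "\<dots> \<le> 3763 * (H * (L + 1))" using H_ge by (simp add: algebra_simps)
  finally show ?thesis .
qed

lemma wc_topc: "wc L (topc t) \<le> 3300 * H"
proof -
  have r: "cost L (rdt (K n)) \<le> 236" "cost L (rdt (rdt (K n))) \<le> 236" for n by (simp_all add: rdt_def)
  have w: "wc L (wtt f) \<le> 22" for f by (simp add: wtt_def)
  have "wc L (call rdt wtt (inc_insert A) G e) \<le> 504 * H + cost L e" for e
    by (rule wc_call_bound[OF r w]) simp
  from this[of "Rd 9 (Op (-) (Vr scratch 2) (K 1))"]
  have call: "wc L (call rdt wtt (inc_insert A) G (Rd 9 (Op (-) (Vr scratch 2) (K 1)))) \<le> 504 * H + 11" by simp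
  have "wc L (titem t j) \<le> 540 * H" for j using call H_ge by (auto simp: titem_def max_def)
  then have "wc L (topc t) \<le> length (map (titem t) [0..<6]) * (540 * H) + 1"
    unfolding topc_def by (intro wc_seqs) auto
  then show ?thesis using H_ge by simp
qed

lemma wc_rest:
  assumes "u < 2 ^ L"
  shows "wc L (rest u) \<le> 17700 * (H * (L + 1))"
proof -
  have "H * 1 \<le> H * (L + 1)" by (rule mult_left_mono) auto
  then show ?thesis
    using wc_sweep[OF assms] wc_jobs[OF assms] wc_topc[of "Suc u"] H_ge by (simp add: rest_def)
qed

lemma wc_disp: "(\<And>u. lo \<le> u \<Longrightarrow> u < lo + 2 ^ h \<Longrightarrow> wc L (f u) \<le> b) \<Longrightarrow> wc L (disp f lo h) \<le> b + 6 * h"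
proof (induction h arbitrary: lo)
  case (Suc h)
  have "wc L (disp f lo h) \<le> b + 6 * h" by (rule Suc.IH) (use Suc.prems in auto)
  moreover have "wc L (disp f (lo + 2 ^ h) h) \<le> b + 6 * h" by (rule Suc.IH) (use Suc.prems in auto)
  ultimately show ?case by simp
qed simp

definition OPC :: nat where "OPC = 17800 * (H * (L + 1))"

lemma wc_ops: "wc L INS \<le> OPC" "wc L DELMIN \<le> OPC"
proof -
  have H1: "H \<le> H * (L + 1)" "L + 1 \<le> H * (L + 1)" using H_ge by simp_all
  have "wc L (Seq (pins u) (rest u)) \<le> 17790 * (H * (L + 1))" "wc L (Seq (pdel u) (rest u)) \<le> 17790 * (H * (L + 1))"
    if "u < 2 ^ L" for u
    using wc_rest[OF that] wc_ins[of L "W 5 0 0" L 0 u] wc_ext[of L "W 5 0 0" L 0] H1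
    by (simp_all add: pins_def pdel_def)
  then have "wc L INS \<le> 17790 * (H * (L + 1)) + 6 * L" "wc L DELMIN \<le> 17790 * (H * (L + 1)) + 6 * L"
    unfolding INS_def DELMIN_def by (intro wc_disp; simp)+
  then show "wc L INS \<le> OPC" "wc L DELMIN \<le> OPC" using H1 unfolding OPC_def by linarith+
qed

lemma okc_call_top:
  assumes "{(+), (-)} \<subseteq> F" "uses_arith F P" "oke L F e"
  shows "okc L F (call rdt wtt P f e)"
  using assms by (intro okc_call) (auto simp: rdt_def wtt_def scratch_def)

lemma okc_rest:
  assumes F: "{(+), (-)} \<subseteq> F" and P: "uses_arith F (inc_insert A)" and uL: "u < 2 ^ L"
  shows "okc L F (rest u)"
proof -
  have pm: "(+) \<in> F" "(-) \<in> F" using F by auto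
  have LL: "L < 2 ^ L" by simp
  have job: "okc L F (job i (u div 2 ^ i + 2) c)" if i: "i < L" for i c
  proof -
    let ?k = "u div 2 ^ i + 2"
    note ok = chain_ok[OF i uL order.refl]
    have W: "okn L (W c' i ?k)" if "c' < 7" for c' using ok(3,4) that by simp
    have "?k div 2 \<le> ?k" by (rule div_le_dividend)
    moreover have "Suc i < 2 ^ L" using i LL by linarith
    ultimately have W': "okn L (W 2 (Suc i) (?k div 2))" using ok(3) by simp
    have call: "okc L F (call (rdj i ?k) (wtj i ?k c') (inc_insert A) G e)" if "oke L F e" for c' e
      using that pm ok(2) W by (intro okc_call[OF P]) (auto simp: rdj_def wtj_def scratch_def simp del: okn.simps(2))
    show ?thesis
      using pm W W' call okc_ins[of L "W 3 i ?k" F] okc_ext[of L "W 3 i ?k" F]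
      by (simp add: job_def loadc_def extrc_def scratch_def del: okn.simps(2))
  qed
  have touch: "okc L F (touch u)"
  proof -
    have n: "okn L n \<and> wide n" if n: "n \<in> set (unames u [0..<L])" for n
    proof -
      obtain j k where "j < L" "n = W 1 j k" "k \<le> u div 2 ^ j + 2" using n by (fastforce simp: unames_def)
      then show ?thesis using chain_ok(3,4)[of j L u k] uL by simp
    qed
    have "okc L F (tsel u js)" if "\<forall>j\<in>set js. j < L" for js
      using that
    proof (induction js)
      case (Cons j js)
      have j: "j < L" using Cons.prems by simp
      show ?case using Cons pm chain_ok(2)[OF j uL, of "u div 2 ^ j"] chain_ok(2)[OF j uL, of "u div 2 ^ j + 1"]
        by (simp add: tleaf_def scratch_def)
    qed (simp add: scratch_def)
    then show ?thesis using n by (simp add: touch_def scratch_def)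
  qed
  have "okc L F (sweep u)"
  proof -
    have "okn L (W 4 i k)" if "(i, k, q) \<in> set (entries u)" for i k q
    proof -
      have "i < L" "k \<le> u div 2 ^ i + 2" using that by (auto simp: entries_def)
      then show ?thesis using chain_ok(3,4)[of i L u k] uL by simp
    qed
    then show ?thesis using touch pm by (auto simp: sweep_def refresh_def scratch_def simp del: okn.simps(2))
  qed
  moreover have "okc L F (jobs u)" using job by (auto simp: jobs_def)
  moreover have "okc L F (topc (Suc u))"
  proof -
    have "Suc u < 2 ^ (L + 2)" using uL by (simp add: power_add)
    then show ?thesis using pm okc_call_top[OF F P] by (auto simp: topc_def titem_def scratch_def)
  qed
  ultimately show ?thesis by (simp add: rest_def)
qed

end

section \<open>Deletions and queries\<close>

text \<open>Reinsertion after a temporary deletion gives an item a new name. What persists is the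
  element with its prediction, so the outside world is related to these pairs only.\<close>

definition pairs :: "(nat \<Rightarrow> vop) \<Rightarrow> nat \<Rightarrow> (nat \<times> nat) set" where
  "pairs g t = (\<lambda>y. (elem g y, key g y)) ` alive g t"

context params
begin

lemma state_inv_frame:
  assumes "state_inv g t s" "\<And>n. n \<notin> {scratch, Q 0, Q 1, Q 7, Q 8, Q 14} \<Longrightarrow> s' n = s n" "s' (Q 14) 0 = s (Q 14) 0"
  shows "state_inv g t s'"
proof -
  have W: "s' (W c i k) = s (W c i k)" for c i k using assms(2) by (simp add: scratch_def)
  have Q: "s' (Q r) = s (Q r)" if "r \<in> {2, 3, 4, 5, 6, 9, 10, 12}" for r using that assms(2) by (auto simp: scratch_def)
  have c: "first s' (chain i k) a = first s (chain i k) a" for i k a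
    using chain_level W by (intro first_cong) fastforce
  have "node_inv g i k d s' \<longleftrightarrow> node_inv g i k d s" for i k d by (simp add: node_inv_def logged_def W c)
  then have "nodes_ok g t s' \<longleftrightarrow> nodes_ok g t s" by (simp add: nodes_ok_def)
  moreover have "null_ok s' \<longleftrightarrow> null_ok s" by (simp add: null_ok_def W)
  moreover have "cache_inv t s' \<longleftrightarrow> cache_inv t s" by (simp add: cache_inv_def cspec_def swept_def hit_def W c Q)
  moreover have "tview s' = tview s" using assms(3) by (auto simp: tview_def Q)
  then have "top_inv g t s' \<longleftrightarrow> top_inv g t s" using assms(3) by (simp add: top_inv_def Q)
  moreover have "item_inv g t s' \<longleftrightarrow> item_inv g t s" by (simp add: item_inv_def keys_def Q)
  ultimately show ?thesis using assms(1,3) by (simp add: state_inv_def W)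
qed

text \<open>The sequence is prolonged at \<open>t\<close> by the insertion. A fresh prediction keeps
  the keys injective, so that minima are unique.\<close>

lemma do_ins:
  assumes I: "state_inv g t s" and tL: "Suc t < 2 ^ L" and ep: "s (Q 14) 2 = e" "s (Q 14) 3 = p"
    and new: "p \<notin> snd ` pairs g t"
  defines "g' \<equiv> g(t := VI e p)"
  shows "state_inv g' (Suc t) (exec INS s)" "pairs g' (Suc t) = insert (e, p) (pairs g t)"
    "inj_on (elem g) (alive g t) \<Longrightarrow> e \<notin> fst ` pairs g t \<Longrightarrow> inj_on (elem g') (alive g' (Suc t))"
    "j \<noteq> 0 \<Longrightarrow> exec INS s (Q 14) j = s (Q 14) j"
proof -
  have I': "state_inv g' t s" by (rule state_inv_cong[OF I]) (simp add: g'_def)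
  have alive: "alive g' t = alive g t" by (rule alive_cong) (simp add: g'_def)
  have ke: "key g' y = key g y" "elem g' y = elem g y" if "y \<in> alive g t" for y
    using alive_less[OF that] by (auto simp: g'_def key_def elem_def)
  have kt: "key g' t = p" "elem g' t = e" by (auto simp: g'_def key_def elem_def)
  have als: "alive g' (Suc t) = insert t (alive g t)" using alive by (simp add: g'_def)
  have gd: "good g' t" using I' by (simp add: state_inv_def)
  have "inj_on (key g') (insert t (alive g t))"
  proof -
    have "inj_on (key g') (alive g t)" using gd alive by (auto simp: good_def)
    moreover have "key g' t \<notin> key g' ` (alive g t)" using new ke kt by (force simp: pairs_def)
    ultimately show ?thesis by (auto simp: inj_on_insert)
  qed
  then have gd': "good g' (Suc t)" using gd als by (auto simp: good_def le_Suc_eq less_Suc_eq g'_def)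
  have gt: "g' t = VI (s (Q 14) 2) (s (Q 14) 3)" using ep by (simp add: g'_def)
  show "state_inv g' (Suc t) (exec INS s)" "j \<noteq> 0 \<Longrightarrow> exec INS s (Q 14) j = s (Q 14) j"
    using INS_correct[OF I' gd' gt tL] by blast+
  show "pairs g' (Suc t) = insert (e, p) (pairs g t)"
    unfolding pairs_def als using ke kt by (auto simp: image_iff)
  assume *: "inj_on (elem g) (alive g t)" "e \<notin> fst ` pairs g t"
  have "inj_on (elem g') (alive g t)" using *(1) ke(2) by (simp cong: inj_on_cong)
  moreover have "elem g' t \<notin> elem g' ` alive g t" using *(2) ke kt by (force simp: pairs_def)
  ultimately show "inj_on (elem g') (alive g' (Suc t))" unfolding als by (auto simp: inj_on_insert)
qed

lemma do_del:
  assumes I: "state_inv g t s" and tL: "Suc t < 2 ^ L" and ne: "alive g t \<noteq> {}" and elem: "inj_on (elem g) (alive g t)"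
  defines "g' \<equiv> g(t := VD)" and "m \<equiv> argmin (key g) (alive g t)"
  shows "state_inv g' (Suc t) (exec DELMIN s)" "pairs g' (Suc t) = pairs g t - {(elem g m, key g m)}"
    "inj_on (elem g') (alive g' (Suc t))"
    "j \<noteq> 0 \<Longrightarrow> exec DELMIN s (Q 14) j = s (Q 14) j"
proof -
  have I': "state_inv g' t s" by (rule state_inv_cong[OF I]) (simp add: g'_def)
  have alive: "alive g' t = alive g t" by (rule alive_cong) (simp add: g'_def)
  have ke: "key g' y = key g y" "elem g' y = elem g y" if "y \<in> alive g t" for y
    using alive_less[OF that] by (auto simp: g'_def key_def elem_def)
  have mm: "argmin (key g') (alive g t) = m" unfolding m_def argmin_def by (intro arg_cong[of _ _ hd] sorted_by_cong ke)
  have als: "alive g' (Suc t) = alive g t - {m}" using alive mm by (simp add: g'_def)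
  have gd: "good g' t" using I' by (simp add: state_inv_def)
  have "inj_on (key g') (alive g t - {m})" using gd alive by (auto simp: good_def inj_on_diff)
  then have gd': "good g' (Suc t)" using gd als ne alive by (auto simp: good_def le_Suc_eq less_Suc_eq)
  have gt: "g' t = VD" by (simp add: g'_def)
  show "state_inv g' (Suc t) (exec DELMIN s)" "j \<noteq> 0 \<Longrightarrow> exec DELMIN s (Q 14) j = s (Q 14) j"
    using DELMIN_correct[OF I' gd' gt tL] by blast+
  have m: "m \<in> alive g t" unfolding m_def using ne by (intro argmin_in) auto
  show "pairs g' (Suc t) = pairs g t - {(elem g m, key g m)}"
    unfolding pairs_def als using ke elem m by (auto simp: image_iff dest: inj_onD)
  have "inj_on (elem g') (alive g t)" using elem ke(2) by (simp cong: inj_on_cong)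
  then show "inj_on (elem g') (alive g' (Suc t))" unfolding als by (rule inj_on_diff)
qed

text \<open>A recursion unrolled to depth \<open>n\<close>: remove the minimum, delete in the rest,
  insert the minimum again. Each depth keeps the removed item in a register of its own; its name
  suffices, as element and prediction remain stored under it.\<close>

fun del :: "nat \<Rightarrow> com" where
  "del 0 = DELMIN"
| "del (Suc n) = If (ne (Rd 9 (Op (-) (Vr (W 5 0 0) 0) (K 1))) (Vr (Q 14) 4))
    (Seq (SetV (Q 14) (5 + n) (Vr (W 5 0 0) 0)) (Seq DELMIN (Seq (del n)
      (Seq (SetV (Q 14) 2 (Rd 9 (Op (-) (Vr (Q 14) (5 + n)) (K 1))))
      (Seq (SetV (Q 14) 3 (Rd 10 (Op (-) (Vr (Q 14) (5 + n)) (K 1)))) INS)))))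
    DELMIN"

lemma state_inv_reg: "state_inv g t s \<Longrightarrow> j \<noteq> 0 \<Longrightarrow> state_inv g t (put s (Q 14) j v)"
  by (erule state_inv_frame) auto

lemma inj_snd_pairs: "state_inv g t s \<Longrightarrow> (a, p) \<in> pairs g t \<Longrightarrow> (b, p) \<in> pairs g t \<Longrightarrow> a = b"
  by (auto simp: state_inv_def good_def pairs_def inj_on_def)

text \<open>Removing the minimum lowers the rank \<open>r\<close> of \<open>x\<close> by one and
  contributes one deletion and one insertion; at rank 0 the item is itself the minimum. This gives
  \<open>2 * r + 1\<close> operations.\<close>

lemma del_correct:
  assumes "state_inv g t s" "inj_on (elem g) (alive g t)" "x \<in> alive g t" "s (Q 14) 4 = elem g x"
    "card {y \<in> alive g t. key g y < key g x} = r" "r \<le> n" "t + 2 * r + 1 < 2 ^ L"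
  shows "\<exists>g'. state_inv g' (t + 2 * r + 1) (exec (del n) s) \<and> (\<forall>u<t. g' u = g u) \<and>
    inj_on (elem g') (alive g' (t + 2 * r + 1)) \<and> pairs g' (t + 2 * r + 1) = pairs g t - {(elem g x, key g x)} \<and>
    (\<forall>j. j = 1 \<or> j = 4 \<or> 5 + n \<le> j \<longrightarrow> exec (del n) s (Q 14) j = s (Q 14) j) \<and>
    time L (del n) s \<le> (2 * r + 1) * OPC + 61 * (r + 1)"
  using assms
proof (induction n arbitrary: g t s x r)
  case 0
  note pr = "0.prems"
  have r: "r = 0" using pr(6) by simp
  have inj: "inj_on (key g) (alive g t)" using pr(1) by (simp add: state_inv_def good_def)
  have "{y \<in> alive g t. key g y < key g x} = {}" using pr(5) r by (subst card_0_eq[symmetric]) auto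
  then have m: "argmin (key g) (alive g t) = x" using pr(3) inj by (intro argmin_eqI) (auto simp: not_less)
  have ne: "alive g t \<noteq> {}" and tL: "Suc t < 2 ^ L" using pr(3,7) r by auto
  define g' where "g' = g(t := VD)"
  note d = do_del[OF pr(1) tL ne pr(2), unfolded m, folded g'_def]
  have "\<forall>u<t. g' u = g u" by (simp add: g'_def)
  then show ?case
    using d r order_trans[OF time_le_wc wc_ops(2), of s] by (intro exI[of _ g']) (simp del: alive.simps)
next
  case (Suc n)
  note pr = Suc.prems
  let ?m = "argmin (key g) (alive g t)"
  have inj: "inj_on (key g) (alive g t)" using pr(1) by (simp add: state_inv_def good_def)
  have ne: "alive g t \<noteq> {}" and tL: "Suc t < 2 ^ L" using pr(3,7) by auto
  have m: "?m \<in> alive g t" using argmin_in[OF finite_alive ne] .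
  have mt: "?m < t" using alive_less[OF m] .
  have root: "s (W 5 0 0) 0 = Suc ?m"
  proof -
    have "trep (key g) L 0 (s (W 5 0 0)) (alive g t) t" using pr(1) by (simp add: state_inv_def)
    from trep_root[OF this] show ?thesis using ne by (simp add: winner_def)
  qed
  have item_inv: "item_inv g t s" using pr(1) by (simp add: state_inv_def)
  have elm: "s (Q 9) ?m = elem g ?m" using item_inv_keys[OF item_inv order.refl m] by simp
  have guard: "eval (ne (Rd 9 (Op (-) (Vr (W 5 0 0) 0) (K 1))) (Vr (Q 14) 4)) s = 0 \<longleftrightarrow> ?m = x"
    unfolding eval_ne using root elm pr(2,3,4) m by (auto dest: inj_onD)
  show ?case
  proof (cases "?m = x")
    case True
    have e0: "{y \<in> alive g t. key g y < key g x} = {}" using argmin_le[of "alive g t" _ "key g"] True by (auto simp: not_less)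
    have r: "r = 0" using pr(5) unfolding e0 by simp
    have e: "exec (del (Suc n)) s = exec DELMIN s" "time L (del (Suc n)) s = 31 + time L DELMIN s"
      using True guard by simp_all
    define g' where "g' = g(t := VD)"
    note d = do_del[OF pr(1) tL ne pr(2), unfolded True, folded g'_def]
    have "\<forall>u<t. g' u = g u" by (simp add: g'_def)
    then show ?thesis
      unfolding e using d r order_trans[OF time_le_wc wc_ops(2), of s] by (intro exI[of _ g']) (simp del: alive.simps)
  next
    case False
    define s1 where "s1 = put s (Q 14) (5 + n) (Suc ?m)"
    define s2 where "s2 = exec DELMIN s1"
    define s3 where "s3 = exec (del n) s2"
    define g1 where "g1 = g(t := VD)"
    have I1: "state_inv g t s1" unfolding s1_def using state_inv_reg[OF pr(1)] by simp
    note d = do_del[OF I1 tL ne pr(2)]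
    have I2: "state_inv g1 (Suc t) s2" and p2: "pairs g1 (Suc t) = pairs g t - {(elem g ?m, key g ?m)}"
      and el2: "inj_on (elem g1) (alive g1 (Suc t))" and r2: "\<And>j. j \<noteq> 0 \<Longrightarrow> s2 (Q 14) j = s1 (Q 14) j"
      using d unfolding g1_def s2_def by blast+
    have al1: "alive g1 t = alive g t" unfolding g1_def by (rule alive_cong) simp
    have ke: "key g1 y = key g y" "elem g1 y = elem g y" if "y \<in> alive g t" for y
      using alive_less[OF that] by (auto simp: g1_def key_def elem_def)
    have "argmin (key g1) (alive g t) = ?m" unfolding argmin_def by (intro arg_cong[of _ _ hd] sorted_by_cong ke)
    then have als: "alive g1 (Suc t) = alive g t - {?m}" using al1 by (simp add: g1_def)
    have x1: "x \<in> alive g1 (Suc t)" using als pr(3) False by auto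
    have kmx: "key g ?m < key g x"
      using argmin_le[of "alive g t" x "key g"] pr(3) inj m False by (metis finite_alive inj_onD le_neq_implies_less)
    have set1: "{y \<in> alive g1 (Suc t). key g1 y < key g1 x} = {y \<in> alive g t. key g y < key g x} - {?m}"
      using als ke pr(3) by auto
    have r1: "card {y \<in> alive g1 (Suc t). key g1 y < key g1 x} = r - 1" "1 \<le> r"
    proof -
      have mem: "?m \<in> {y \<in> alive g t. key g y < key g x}" using m kmx by simp
      then show "card {y \<in> alive g1 (Suc t). key g1 y < key g1 x} = r - 1"
        unfolding set1 using pr(5) by (simp add: card_Diff_singleton)
      have "card {y \<in> alive g t. key g y < key g x} \<noteq> 0" using mem by (subst card_0_eq) auto
      then show "1 \<le> r" using pr(5) by simp
    qed
    have "\<exists>g'. state_inv g' (Suc t + 2 * (r - 1) + 1) (exec (del n) s2) \<and> (\<forall>u<Suc t. g' u = g1 u) \<and>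
      inj_on (elem g') (alive g' (Suc t + 2 * (r - 1) + 1)) \<and>
      pairs g' (Suc t + 2 * (r - 1) + 1) = pairs g1 (Suc t) - {(elem g1 x, key g1 x)} \<and>
      (\<forall>j. j = 1 \<or> j = 4 \<or> 5 + n \<le> j \<longrightarrow> exec (del n) s2 (Q 14) j = s2 (Q 14) j) \<and>
      time L (del n) s2 \<le> (2 * (r - 1) + 1) * OPC + 61 * (r - 1 + 1)"
    proof (rule Suc.IH[OF I2 el2 x1 _ r1(1)])
      show "s2 (Q 14) 4 = elem g1 x" using r2[of 4] pr(3,4) ke by (simp add: s1_def)
    qed (use pr(6,7) r1(2) in auto)
    moreover have t2: "Suc t + 2 * (r - 1) + 1 = t + 2 * r" using r1(2) by simp
    ultimately obtain g2 where I3: "state_inv g2 (t + 2 * r) s3" and ag: "\<forall>u<Suc t. g2 u = g1 u"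
      and el3: "inj_on (elem g2) (alive g2 (t + 2 * r))"
      and p3: "pairs g2 (t + 2 * r) = pairs g1 (Suc t) - {(elem g1 x, key g1 x)}"
      and r3: "\<And>j. j = 1 \<or> j = 4 \<or> 5 + n \<le> j \<Longrightarrow> s3 (Q 14) j = s2 (Q 14) j"
      and tm: "time L (del n) s2 \<le> (2 * (r - 1) + 1) * OPC + 61 * (r - 1 + 1)"
      unfolding s3_def t2 by blast
    \<comment> \<open>The nested call leaves all registers from \<open>5 + n\<close> on
      untouched.\<close>
    have stash: "s3 (Q 14) (5 + n) = Suc ?m" using r3 r2 by (simp add: s1_def)
    have g2m: "g2 ?m = g ?m" using ag mt by (simp add: g1_def)
    have BI3: "item_inv g2 (t + 2 * r) s3" using I3 by (simp add: state_inv_def)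
    obtain e p where gm: "g ?m = VI e p" using alive_VI[OF m] by blast
    then have epm: "e = elem g ?m" "p = key g ?m" by (auto simp: elem_def key_def)
    have rd: "s3 (Q 9) ?m = e" "s3 (Q 10) ?m = p"
      using BI3 g2m gm mt unfolding item_inv_def keys_def by auto
    define s4 where "s4 = put (put s3 (Q 14) 2 e) (Q 14) 3 p"
    have I4: "state_inv g2 (t + 2 * r) s4" unfolding s4_def using state_inv_reg[OF state_inv_reg[OF I3, of 2], of 3] by simp
    have pm: "(e, p) \<in> pairs g t" using m epm by (auto simp: pairs_def)
    have p3': "pairs g2 (t + 2 * r) = pairs g t - {(e, p)} - {(elem g x, key g x)}"
      unfolding p3 p2 using ke pr(3) epm by simp
    have np: "p \<notin> snd ` pairs g2 (t + 2 * r)"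
      using inj_snd_pairs[OF pr(1) _ pm] unfolding p3' by force
    have nE: "e \<notin> fst ` pairs g2 (t + 2 * r)"
    proof
      assume "e \<in> fst ` pairs g2 (t + 2 * r)"
      then obtain q where "(e, q) \<in> pairs g t" "q \<noteq> p" unfolding p3' by force
      then obtain y where "y \<in> alive g t" "elem g y = elem g ?m" "key g y \<noteq> key g ?m" using epm by (auto simp: pairs_def)
      then show False using pr(2) m by (metis inj_onD)
    qed
    have tL3: "Suc (t + 2 * r) < 2 ^ L" using pr(7) by simp
    have s4r: "s4 (Q 14) 2 = e" "s4 (Q 14) 3 = p" by (simp_all add: s4_def)
    define g3 where "g3 = g2(t + 2 * r := VI e p)"
    note di = do_ins[OF I4 tL3 s4r np, folded g3_def]
    have ex: "exec (del (Suc n)) s = exec INS s4"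
      using False guard root rd stash by (simp add: s1_def s2_def s3_def s4_def)
    have xm: "(elem g x, key g x) \<noteq> (e, p)" using kmx epm by auto
    have "pairs g3 (Suc (t + 2 * r)) = pairs g t - {(elem g x, key g x)}"
      unfolding di(2) p3' using pm xm by auto
    moreover have "\<forall>j. j = 1 \<or> j = 4 \<or> 5 + Suc n \<le> j \<longrightarrow> exec INS s4 (Q 14) j = s (Q 14) j"
    proof (intro allI impI)
      fix j assume j: "j = 1 \<or> j = 4 \<or> 5 + Suc n \<le> j"
      have "exec INS s4 (Q 14) j = s4 (Q 14) j" using di(4)[of j] j by auto
      also have "\<dots> = s3 (Q 14) j" using j by (auto simp: s4_def)
      also have "\<dots> = s2 (Q 14) j" using j by (intro r3) auto
      also have "\<dots> = s1 (Q 14) j" using j by (intro r2) auto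
      also have "\<dots> = s (Q 14) j" using j by (auto simp: s1_def)
      finally show "exec INS s4 (Q 14) j = s (Q 14) j" .
    qed
    moreover have "time L (del (Suc n)) s \<le> (2 * r + 1) * OPC + 61 * (r + 1)"
    proof -
      \<comment> \<open>The 61 units are 31 for the test and 30 for the three assignments to
        registers.\<close>
      have "time L (del (Suc n)) s \<le> 61 + time L DELMIN s1 + time L (del n) s2 + time L INS s4"
        using False guard root rd stash by (simp add: s1_def s2_def s3_def s4_def)
      also have "\<dots> \<le> 61 + OPC + ((2 * (r - 1) + 1) * OPC + 61 * (r - 1 + 1)) + OPC"
        using tm order_trans[OF time_le_wc wc_ops(1)] order_trans[OF time_le_wc wc_ops(2)]
        by (intro add_mono) auto
      also have "\<dots> = (2 * r + 1) * OPC + 61 * (r + 1)"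
      proof -
        obtain r' where "r = Suc r'" using r1(2) by (cases r) auto
        then show ?thesis by (simp add: algebra_simps)
      qed
      finally show ?thesis .
    qed
    moreover have "\<forall>u<t. g3 u = g u" using ag by (simp add: g1_def g3_def)
    ultimately show ?thesis
      using di(1) di(3)[OF el3 nE] unfolding ex by (intro exI[of _ g3]) (simp del: alive.simps del.simps)
  qed
qed

section \<open>Queries, run in an overlay of their own\<close>

definition rdq :: "ex \<Rightarrow> ex" where
  "rdq e = IfE (ne (Rd 7 e) (Vr (Q 14) 1)) (rdt e) (Rd 8 e)"

definition wtq :: "nat \<Rightarrow> com" where
  "wtq f = Seq (Set (Q 8) (Vr scratch 0) (Vr scratch 1)) (Set (Q 7) (Vr scratch 0) (Vr (Q 14) 1))"

definition qview :: "st \<Rightarrow> nat \<Rightarrow> nat" where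
  "qview s a = (if s (Q 7) a = s (Q 14) 1 then s (Q 8) a else tview s a)"

lemma eval_rdq: "eval (rdq e) s = qview s (eval e s)"
  unfolding rdq_def qview_def by (simp add: eval_rdt)

lemma tview_frame: "(\<And>r. r \<in> {2, 3, 4, 5, 6} \<Longrightarrow> s' (Q r) = s (Q r)) \<Longrightarrow> s' (Q 14) 0 = s (Q 14) 0 \<Longrightarrow> tview s' = tview s"
  by (simp add: tview_def fun_eq_iff)

lemma memory_view_query: "memory_view rdq wtq qview (\<lambda>_ s. \<forall>a. s (Q 7) a \<le> s (Q 14) 1) N"
proof
  fix f e s j v
  show "eval (rdq e) s = qview s (eval e s)" by (rule eval_rdq)
  have "tview (put s scratch j v) = tview s" by (rule tview_frame) (auto simp: scratch_def)
  then show "qview (put s scratch j v) = qview s" by (auto simp: qview_def scratch_def)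
  have "tview (exec (wtq f) s) = tview s" by (rule tview_frame) (auto simp: wtq_def scratch_def)
  then show "qview (exec (wtq f) s) = (qview s)(s scratch 0 := s scratch 1)"
    by (auto simp: qview_def wtq_def scratch_def)
qed (auto simp: scratch_def wtq_def)

text \<open>A query program may write to memory, and these writes must be forgotten afterwards. They
  are stamped with the number of the query; raising that number first makes all older stamps
  invalid, so nothing has to be undone and the overhead is constant per step.\<close>

definition qry :: com where
  "qry = Seq (SetV (Q 14) 1 (Op (+) (Vr (Q 14) 1) (K 1)))
    (Seq (call rdq wtq (inc_query A) Gq (Vr (Q 0) 0)) (SetV (Q 0) 0 (rdq (K 0))))"

lemma qry_correct:
  assumes I: "state_inv g t s" and st: "\<And>a. s (Q 7) a \<le> s (Q 14) 1"
  shows "state_inv g t (exec qry s)" "exec qry s (Q 7) a \<le> exec qry s (Q 14) 1"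
    "\<exists>ys. set ys = alive g t \<and> distinct ys \<and>
      exec qry s (Q 0) 0 = frun (inc_query A) Gq 0 ((AM g ys)(0 := s (Q 0) 0)) 0"
proof -
  interpret memory_view rdq wtq qview "\<lambda>_ s. \<forall>a. s (Q 7) a \<le> s (Q 14) 1" Gq by (rule memory_view_query)
  define s1 where "s1 = put s (Q 14) 1 (Suc (s (Q 14) 1))"
  let ?c = "call rdq wtq (inc_query A) Gq (Vr (Q 0) 0)"
  define s2 where "s2 = exec ?c s1"
  have I1: "\<forall>a. s1 (Q 7) a \<le> s1 (Q 14) 1" using st by (simp add: s1_def le_SucI)
  have tv: "tview s1 = tview s" by (rule tview_frame) (auto simp: s1_def)
  have "s1 (Q 7) a \<noteq> s1 (Q 14) 1" for a using st[of a] by (simp add: s1_def)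
  then have q1: "qview s1 = tview s" by (auto simp: qview_def tv)
  have e: "exec qry s = put s2 (Q 0) 0 (qview s2 0)"
    by (simp add: qry_def s2_def s1_def eval_rdq)
  have q2: "qview s2 = frun (inc_query A) Gq 0 ((tview s)(0 := s (Q 0) 0))"
    unfolding s2_def call(2)[OF I1] q1 by (simp add: s1_def)
  have I2: "\<forall>a. s2 (Q 7) a \<le> s2 (Q 14) 1" unfolding s2_def by (rule call(1)[OF I1])
  have "wr ?c \<subseteq> {scratch, Q 7, Q 8}" using wr_call[of rdq wtq "inc_query A" Gq "Vr (Q 0) 0"] by (auto simp: wtq_def)
  then have f2: "s2 n = s1 n" if "n \<notin> {scratch, Q 7, Q 8}" for n
    unfolding s2_def using that by (intro exec_frame) blast
  show "state_inv g t (exec qry s)"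
    by (rule state_inv_frame[OF I]) (use f2 in \<open>auto simp: e s1_def scratch_def\<close>)
  show "exec qry s (Q 7) a \<le> exec qry s (Q 14) 1" using I2 by (simp add: e)
  obtain ys where "set ys = alive g t" "distinct ys" "tview s = AM g ys"
    using I unfolding state_inv_def top_inv_def by blast
  then show "\<exists>ys. set ys = alive g t \<and> distinct ys \<and>
      exec qry s (Q 0) 0 = frun (inc_query A) Gq 0 ((AM g ys)(0 := s (Q 0) 0)) 0"
    using q2 by (auto simp: e)
qed

lemma wc_qry: "1 \<le> Gq \<Longrightarrow> wc L qry \<le> 2200 * Gq"
proof -
  assume "1 \<le> Gq"
  have r: "cost L (rdq (K n)) \<le> 505" "cost L (rdq (rdq (K n))) \<le> 505" for n by (simp_all add: rdq_def rdt_def)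
  have w: "wc L (wtq f) \<le> 22" for f by (simp add: wtq_def)
  have "wc L (call rdq wtq (inc_query A) Gq (Vr (Q 0) 0)) \<le> (Gq + 1) * (2 * 505 + 22 + 10) + cost L (Vr (Q 0) 0)"
    by (rule wc_call[OF r w])
  moreover have "cost L (rdq (K 0)) \<le> 73" by (simp add: rdq_def rdt_def)
  ultimately show ?thesis using \<open>1 \<le> Gq\<close> by (simp add: qry_def)
qed

definition insp :: com where
  "insp = Seq (SetV (Q 14) 2 (Vr (Q 0) 0)) (Seq (SetV (Q 14) 3 (Vr (Q 1) 0)) INS)"

definition delp :: "nat \<Rightarrow> com" where
  "delp n = Seq (SetV (Q 14) 4 (Vr (Q 0) 0)) (del n)"

lemma okc_progs:
  assumes F: "{(+), (-)} \<subseteq> F" and P: "uses_arith F (inc_insert A)" "uses_arith F (inc_query A)"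
  shows "okc L F insp" "okc L F (delp n)" "okc L F qry"
proof -
  have pm: "(+) \<in> F" "(-) \<in> F" using F by auto
  have W5: "okn L (W 5 0 0)" by simp
  have dsp: "okc L F (disp f lo h)" if "\<And>u. u < lo + 2 ^ h \<Longrightarrow> okc L F (f u)" for f lo h
    using that
  proof (induction h arbitrary: lo)
    case (Suc h)
    have "okc L F (disp f lo h)" by (rule Suc.IH) (use Suc.prems in auto)
    moreover have "okc L F (disp f (lo + 2 ^ h) h)" by (rule Suc.IH) (use Suc.prems in auto)
    ultimately show ?case using pm by simp
  qed simp
  have INS: "okc L F INS"
    unfolding INS_def using okc_rest[OF F P(1)] okc_ins[OF W5 pm(2)]
    by (intro dsp) (auto simp: pins_def scratch_def keys_def)
  have DEL: "okc L F DELMIN"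
    unfolding DELMIN_def using okc_rest[OF F P(1)] okc_ext[OF W5 pm] pm
    by (intro dsp) (auto simp: pdel_def scratch_def)
  show "okc L F insp" using INS by (simp add: insp_def)
  have "okc L F (del n)" by (induction n) (use INS DEL pm in auto)
  then show "okc L F (delp n)" by (simp add: delp_def)
  have "okc L F (call rdq wtq (inc_query A) Gq (Vr (Q 0) 0))"
    using pm by (intro okc_call[OF P(2)]) (auto simp: rdq_def rdt_def wtq_def scratch_def)
  then show "okc L F qry" using pm by (auto simp: qry_def rdq_def rdt_def)
qed

lemma frame_ops: "exec INS s (Q 7) = s (Q 7)" "exec DELMIN s (Q 7) = s (Q 7)" "exec (del n) s (Q 7) = s (Q 7)"
proof -
  have r: "Q 7 \<notin> wr (rest u)" for u
    using wr_sweep[of u] wr_jobs[of u] wr_top[of "Suc u"] by (auto simp: rest_def jnames_def scratch_def)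
  have d: "Q 7 \<notin> wr (disp f lo h)" if "\<And>u. Q 7 \<notin> wr (f u)" for f lo h
    using that by (induction h arbitrary: lo) auto
  have I: "Q 7 \<notin> wr INS" unfolding INS_def using r by (intro d) (auto simp: pins_def scratch_def keys_def)
  have D: "Q 7 \<notin> wr DELMIN" unfolding DELMIN_def using r by (intro d) (auto simp: pdel_def scratch_def)
  have "Q 7 \<notin> wr (del n)" by (induction n) (use I D in auto)
  then show "exec INS s (Q 7) = s (Q 7)" "exec DELMIN s (Q 7) = s (Q 7)" "exec (del n) s (Q 7) = s (Q 7)"
    using I D by (auto intro: exec_frame)
qed

end

section \<open>Request sequences\<close>

lemma current_0 [simp]: "current xs 0 = {}"
  by (simp add: current_def)

lemma current_Suc: "n < length xs \<Longrightarrow> current xs (Suc n) = apply_request (current xs n) (xs ! n)"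
  by (simp add: current_def take_Suc_conv_app_nth)

lemma num_updates_Suc:
  "n < length xs \<Longrightarrow> num_updates (take (Suc n) xs) = num_updates (take n xs) + (if is_update (xs ! n) then 1 else 0)"
  by (simp add: num_updates_def take_Suc_conv_app_nth)

lemma num_updates_take: "num_updates (take n xs) \<le> num_updates xs"
proof -
  have "num_updates xs = num_updates (take n xs) + num_updates (drop n xs)"
    unfolding num_updates_def by (metis append_take_drop_id filter_append length_append)
  then show ?thesis by simp
qed

lemma current_bounds:
  assumes "valid Pb xs"
  shows "n \<le> length xs \<Longrightarrow> finite (current xs n) \<and> card (current xs n) \<le> num_updates (take n xs) \<and> current xs n \<subseteq> elements Pb"
proof (induction n)
  case (Suc n)
  then have IH: "finite (current xs n)" "card (current xs n) \<le> num_updates (take n xs)" "current xs n \<subseteq> elements Pb"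
    and n: "n < length xs" by auto
  show ?case
  proof (cases "xs ! n")
    case (Insert e)
    then have "e \<in> elements Pb" using assms n by (auto simp: valid_def split: request.splits)
    then show ?thesis using IH n Insert by (auto simp: current_Suc num_updates_Suc card_insert_if)
  next
    case (Delete e)
    then show ?thesis using IH n card_Diff1_le[of "current xs n" e]
      by (auto simp: current_Suc num_updates_Suc intro: le_trans)
  next
    case (Query q)
    then show ?thesis using IH n by (auto simp: current_Suc num_updates_Suc)
  qed
qed simp

text \<open>So far only \<open>frun\<close> with limited fuel was simulated, whatever the program
  does. Here the guarantee of the incremental algorithm enters: it is applied to the insertions in
  the order \<open>ys\<close> followed by the query, and its time bounds show that the fuel suffices
  for complete runs.\<close>

lemma inc_answers:
  assumes inc: "incremental_algorithm F Pb T G Gq A" and d: "distinct (map (elem g) ys)"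
    and e: "elem g ` set ys \<subseteq> elements Pb" and l: "length ys \<le> T" and q: "q \<in> queries Pb"
  shows "frun (inc_query A) Gq 0 ((amem (inc_insert A) G g ys)(0 := q)) 0 \<in> answers Pb (elem g ` set ys) q"
proof -
  let ?n = "length ys"
  define xs where "xs = map (\<lambda>y. Insert (elem g y)) ys @ [Query q]"
  have len: "length xs = Suc ?n" by (simp add: xs_def)
  have nth: "xs ! j = Insert (elem g (ys ! j))" if "j < ?n" for j using that by (simp add: xs_def nth_append)
  have nq: "xs ! ?n = Query q" by (simp add: xs_def nth_append)
  have cur: "j \<le> ?n \<Longrightarrow> current xs j = elem g ` set (take j ys)" for j
  proof (induction j)
    case (Suc j)
    then show ?case using nth[of j] len by (simp add: current_Suc take_Suc_conv_app_nth)
  qed simp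
  have "valid Pb xs"
    unfolding valid_def
  proof (intro allI impI)
    fix j assume j: "j < length xs"
    show "case xs ! j of Insert e \<Rightarrow> e \<in> elements Pb \<and> e \<notin> current xs j
      | Delete e \<Rightarrow> e \<in> current xs j | Query q \<Rightarrow> q \<in> queries Pb"
    proof (cases "j < ?n")
      case True
      have "elem g (ys ! j) \<notin> elem g ` set (take j ys)"
      proof
        assume "elem g (ys ! j) \<in> elem g ` set (take j ys)"
        then obtain k where "k < j" "elem g (ys ! k) = elem g (ys ! j)" using True by (auto simp: in_set_conv_nth)
        then show False using d True by (simp add: distinct_conv_nth)
      qed
      then show ?thesis using True nth cur e by (auto simp: image_subset_iff)
    next
      case False
      then have "j = ?n" using j len by simp
      then show ?thesis using nq q by simp
    qed
  qed
  moreover have "\<forall>e. Delete e \<notin> set xs" by (auto simp: xs_def)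
  moreover have "num_updates xs \<le> T"
  proof -
    have "filter is_update (map (\<lambda>y. Insert (elem g y)) ys) = map (\<lambda>y. Insert (elem g y)) ys" by (induction ys) auto
    then show ?thesis using l by (simp add: num_updates_def xs_def)
  qed
  ultimately obtain Ms ts where tr: "trace (map (inc_call A) xs) Ms ts" and ac: "answers_correctly Pb xs Ms"
    and tm: "\<forall>t<length xs. case xs ! t of Insert e \<Rightarrow> ts ! t \<le> G | Delete e \<Rightarrow> True | Query q \<Rightarrow> ts ! t \<le> Gq"
    using inc unfolding incremental_algorithm_def by blast
  have la: "load_args [a] M = M(0 := a)" for a M by (auto simp: load_args_def)
  have run: "runs (fst (inc_call A (xs ! j))) 0 (load_args (snd (inc_call A (xs ! j))) (Ms ! j)) (ts ! j) (Ms ! Suc j)"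
    if "j < length xs" for j
    using tr that unfolding trace_def by simp
  have M: "j \<le> ?n \<Longrightarrow> Ms ! j = amem (inc_insert A) G g (take j ys)" for j
  proof (induction j)
    case 0
    then show ?case using tr by (simp add: trace_def)
  next
    case (Suc j)
    have j: "j < ?n" "j < length xs" using Suc.prems len by auto
    have "ts ! j \<le> G" using tm j nth[OF j(1)] by force
    then have "frun (inc_insert A) G 0 ((Ms ! j)(0 := elem g (ys ! j))) = Ms ! Suc j"
      using run[OF j(2)] nth[OF j(1)] by (intro frun_runs) (auto simp: la)
    then show ?case using Suc j by (simp add: take_Suc_conv_app_nth amem_snoc)
  qed
  have "ts ! ?n \<le> Gq" using tm nq len by force
  then have "frun (inc_query A) Gq 0 ((Ms ! ?n)(0 := q)) = Ms ! Suc ?n"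
    using run[of ?n] nq len by (intro frun_runs) (auto simp: la)
  moreover have "(Ms ! Suc ?n) 0 \<in> answers Pb (current xs ?n) q"
    using ac nq len unfolding answers_correctly_def by auto
  ultimately show ?thesis using M[of ?n] cur[of ?n] by simp
qed

section \<open>Items that are present, and the prediction error\<close>

definition live :: "request list \<Rightarrow> nat \<Rightarrow> nat \<Rightarrow> nat \<Rightarrow> bool" where
  "live xs n i e \<longleftrightarrow> i < n \<and> xs ! i = Insert e \<and> (\<forall>t. i < t \<and> t < n \<longrightarrow> xs ! t \<noteq> Delete e)"

definition link :: "request list \<Rightarrow> (nat \<Rightarrow> nat) \<Rightarrow> nat \<Rightarrow> (nat \<times> nat) set \<Rightarrow> bool" where
  "link xs pred n P \<longleftrightarrow> fst ` P = current xs n \<and> (\<forall>e p. (e, p) \<in> P \<longrightarrow> (\<exists>i. live xs n i e \<and> p = pred i))"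

lemma live_Suc: "live xs n i e \<Longrightarrow> xs ! n \<noteq> Delete e \<Longrightarrow> live xs (Suc n) i e"
  by (auto simp: live_def less_Suc_eq)

lemma live_current: "live xs n i e \<Longrightarrow> n \<le> length xs \<Longrightarrow> e \<in> current xs n"
proof (induction n)
  case (Suc n)
  show ?case
  proof (cases "i = n")
    case True
    then show ?thesis using Suc.prems by (simp add: current_Suc live_def)
  next
    case False
    then have "live xs n i e" "xs ! n \<noteq> Delete e" using Suc.prems(1) by (auto simp: live_def)
    then have "e \<in> current xs n" "xs ! n \<noteq> Delete e" using Suc by auto
    then show ?thesis using Suc.prems(2) by (cases "xs ! n") (auto simp: current_Suc)
  qed
qed (simp add: live_def)

lemma live_deletion: "live xs n i e \<Longrightarrow> enat n \<le> deletion_time xs i"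
  unfolding deletion_time_def
proof (rule Inf_greatest)
  fix x assume l: "live xs n i e" and "x \<in> enat ` {t. i < t \<and> t < length xs \<and> (\<exists>e. xs ! i = Insert e \<and> xs ! t = Delete e)}"
  then obtain t where "x = enat t" "i < t" "xs ! t = Delete e" by (auto simp: live_def)
  then show "enat n \<le> x" using l by (auto simp: live_def not_less[symmetric])
qed

lemma live_coexist:
  assumes "live xs n i e" "live xs n j e'" "n \<le> length xs"
  shows "coexist xs i j"
proof -
  have "i < n" "j < n" using assms by (auto simp: live_def)
  then have "enat i < deletion_time xs j" "enat j < deletion_time xs i"
    using live_deletion[OF assms(1)] live_deletion[OF assms(2)] by (meson enat_ord_simps(2) less_le_trans)+
  then show ?thesis using assms \<open>i < n\<close> \<open>j < n\<close> by (auto simp: coexist_def inserted_items_def live_def)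
qed

lemma live_unique:
  assumes "valid Pb xs" "n \<le> length xs" "live xs n i e" "live xs n j e"
  shows "i = j"
proof -
  have "\<not> i < j" if "live xs n i e" "live xs n j e" for i j
  proof
    assume "i < j"
    then have "live xs j i e" using that by (auto simp: live_def)
    moreover have "j < length xs" "xs ! j = Insert e" using that assms(2) by (auto simp: live_def)
    ultimately have "e \<in> current xs j" "e \<notin> current xs j"
      using live_current[of xs j i e] assms(1) by (auto simp: valid_def split: request.splits)
    then show False by blast
  qed
  then show ?thesis using assms by (meson linorder_neqE_nat)
qed

lemma live_of_deletion_time:
  assumes "deletion_time xs i = enat n"
  shows "n < length xs \<and> (\<exists>e. xs ! n = Delete e \<and> live xs n i e)"
proof -
  let ?D = "{t. i < t \<and> t < length xs \<and> (\<exists>e. xs ! i = Insert e \<and> xs ! t = Delete e)}"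
  have inf: "Inf (enat ` ?D) = enat n" using assms by (simp add: deletion_time_def)
  have "?D \<noteq> {}"
  proof
    assume "?D = {}"
    then have "Inf (enat ` ?D) = \<infinity>" by (simp only: image_empty Inf_enat_def) simp
    then show False using inf by simp
  qed
  then obtain d where "d \<in> ?D" by blast
  \<comment> \<open>A nonempty set of extended naturals attains its infimum.\<close>
  then have "Inf (enat ` ?D) \<in> enat ` ?D" using wellorder_InfI[of "enat d" "enat ` ?D"] by blast
  then have n: "n \<in> ?D" using inf by auto
  then obtain e where e: "xs ! i = Insert e" "xs ! n = Delete e" "i < n" "n < length xs" by auto
  have "xs ! t \<noteq> Delete e" if "i < t" "t < n" for t
  proof
    assume "xs ! t = Delete e"
    then have "enat t \<in> enat ` ?D" using that e by auto
    from Inf_lower[OF this] have "enat n \<le> enat t" unfolding inf .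
    then show False using that by simp
  qed
  then show ?thesis using e by (auto simp: live_def)
qed

lemma link_insert:
  assumes "link xs pred n P" "n < length xs" "xs ! n = Insert e"
  shows "link xs pred (Suc n) (insert (e, pred n) P)"
  unfolding link_def
proof (intro conjI allI impI)
  show "fst ` insert (e, pred n) P = current xs (Suc n)" using assms by (simp add: link_def current_Suc)
  fix e' p assume "(e', p) \<in> insert (e, pred n) P"
  then consider "e' = e" "p = pred n" | "(e', p) \<in> P" by auto
  then show "\<exists>i. live xs (Suc n) i e' \<and> p = pred i"
  proof cases
    case 1
    then show ?thesis using assms(3) by (auto simp: live_def)
  next
    case 2
    then obtain i where "live xs n i e'" "p = pred i" using assms(1) unfolding link_def by blast
    then show ?thesis using live_Suc[of xs n i e'] assms(3) by auto
  qed
qed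

lemma link_delete:
  assumes "link xs pred n P" "n < length xs" "xs ! n = Delete e" "(e, p) \<in> P" "inj_on fst P"
  shows "link xs pred (Suc n) (P - {(e, p)})"
  unfolding link_def
proof (intro conjI allI impI)
  have "fst ` (P - {(e, p)}) = fst ` P - {e}" using inj_on_image_set_diff[OF assms(5), of P "{(e, p)}"] assms(4) by simp
  then show "fst ` (P - {(e, p)}) = current xs (Suc n)" using assms by (simp add: link_def current_Suc)
  fix e' p' assume a: "(e', p') \<in> P - {(e, p)}"
  then have "e' \<noteq> e" using inj_onD[OF assms(5), of "(e', p')" "(e, p)"] assms(4) by auto
  moreover obtain i where "live xs n i e'" "p' = pred i" using a assms(1) unfolding link_def by blast
  ultimately show "\<exists>i. live xs (Suc n) i e' \<and> p' = pred i" using live_Suc[of xs n i e'] assms(3) by auto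
qed

lemma link_query: "link xs pred n P \<Longrightarrow> n < length xs \<Longrightarrow> xs ! n = Query q \<Longrightarrow> link xs pred (Suc n) P"
  using live_Suc[of xs n] by (fastforce simp: link_def current_Suc)

text \<open>The new item coexists with every item still present, so the absence of ties applies.
  This keeps the keys of the virtual items injective.\<close>

lemma link_new_key:
  assumes "link xs pred n P" "n < length xs" "xs ! n = Insert e" "predicts_order xs pred"
  shows "pred n \<notin> snd ` P"
proof
  assume "pred n \<in> snd ` P"
  then obtain e' i where i: "live xs n i e'" "pred n = pred i" using assms(1) by (force simp: link_def)
  have "live xs (Suc n) i e'" using live_Suc[OF i(1)] assms(3) by simp
  moreover have "live xs (Suc n) n e" using assms(3) by (auto simp: live_def)
  ultimately have "coexist xs i n" using assms(2) by (intro live_coexist) auto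
  moreover have "i \<noteq> n" using i(1) by (auto simp: live_def)
  ultimately show False using assms(4) i(2) unfolding predicts_order_def by metis
qed

text \<open>An item that is present with a smaller prediction when item \<open>i\<close> is deleted
  was predicted to go earlier and goes later, so it is counted by the error of \<open>i\<close>. The
  choice \<open>ph\<close> of an original item for each virtual one is injective, as it determines
  the element.\<close>

lemma rank_le_error:
  assumes v: "valid Pb xs" and n: "n < length xs" "xs ! n = Delete e" "live xs n i e"
    and lk: "link xs pred n (pairs g t)" and inj: "inj_on (elem g) (alive g t)" and x: "x \<in> alive g t" "elem g x = e"
  shows "card {y \<in> alive g t. key g y < key g x} \<le> prediction_error xs pred i"
proof -
  have it: "\<exists>j. live xs n j (elem g y) \<and> key g y = pred j" if "y \<in> alive g t" for y
    using lk that unfolding link_def pairs_def by blast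
  obtain i0 where "live xs n i0 e" "key g x = pred i0" using it[OF x(1)] x(2) by auto
  then have kx: "key g x = pred i" using live_unique[OF v _ n(3)] n(1) by (metis less_imp_le)
  define ph where "ph y = (SOME j. live xs n j (elem g y) \<and> key g y = pred j)" for y
  have ph: "live xs n (ph y) (elem g y)" "key g y = pred (ph y)" if "y \<in> alive g t" for y
    using someI_ex[OF it[OF that]] unfolding ph_def by auto
  show ?thesis
    unfolding prediction_error_def
  proof (rule card_inj_on_le)
    show "inj_on ph {y \<in> alive g t. key g y < key g x}"
    proof (rule inj_onI)
      fix y z assume yz: "y \<in> {y \<in> alive g t. key g y < key g x}" "z \<in> {y \<in> alive g t. key g y < key g x}" "ph y = ph z"
      then have "elem g y = elem g z" using ph(1)[of y] ph(1)[of z] by (auto simp: live_def)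
      then show "y = z" using inj yz by (auto dest: inj_onD)
    qed
    show "ph ` {y \<in> alive g t. key g y < key g x} \<subseteq> {j. coexist xs i j \<and> pred j < pred i \<and> deletion_time xs i < deletion_time xs j}"
    proof
      fix j assume "j \<in> ph ` {y \<in> alive g t. key g y < key g x}"
      then obtain y where y: "j = ph y" "y \<in> alive g t" "key g y < key g x" by auto
      have ne: "elem g y \<noteq> e" using y x inj by (auto dest: inj_onD)
      have j: "live xs n j (elem g y)" "pred j < pred i" using ph[OF y(2)] y kx by auto
      have "coexist xs i j" using live_coexist[OF n(3) j(1)] n(1) by simp
      moreover have "deletion_time xs i \<le> enat n"
        unfolding deletion_time_def using n by (intro Inf_lower) (auto simp: live_def)
      moreover have "enat (Suc n) \<le> deletion_time xs j"
        using live_deletion[OF live_Suc[OF j(1)]] n(2) ne by auto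
      then have "enat n < deletion_time xs j" by (meson enat_ord_simps(2) lessI less_le_trans)
      ultimately show "j \<in> {j. coexist xs i j \<and> pred j < pred i \<and> deletion_time xs i < deletion_time xs j}"
        using j(2) by auto
    qed
    show "finite {j. coexist xs i j \<and> pred j < pred i \<and> deletion_time xs i < deletion_time xs j}"
      by (rule finite_subset[of _ "{..<length xs}"]) (auto simp: coexist_def inserted_items_def)
  qed
qed

section \<open>The fully dynamic algorithm\<close>

lemma rel_load_args:
  "rel L s M \<Longrightarrow> rel L (put s (Q 0) 0 a) (load_args [a] M)"
  "rel L s M \<Longrightarrow> rel L (put (put s (Q 0) 0 a) (Q 1) 0 b) (load_args [a, b] M)"
proof -
  have a: "addr L (Q 0) 0 = 0" "addr L (Q 1) 0 = 1" by (simp_all add: addr_def)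
  have "load_args [a] M = M(addr L (Q 0) 0 := a)" by (auto simp: load_args_def a)
  then show "rel L s M \<Longrightarrow> rel L (put s (Q 0) 0 a) (load_args [a] M)" by (simp add: rel_put del: put_apply)
  have "load_args [a, b] M = M(addr L (Q 0) 0 := a, addr L (Q 1) 0 := b)"
    unfolding a by (auto simp: load_args_def less_Suc_eq fun_eq_iff)
  then show "rel L s M \<Longrightarrow> rel L (put (put s (Q 0) 0 a) (Q 1) 0 b) (load_args [a, b] M)"
    by (simp add: rel_put del: put_apply)
qed

lemma inj_on_fst_pairs: "inj_on (elem g) (alive g t) \<Longrightarrow> inj_on fst (pairs g t)"
  by (auto simp: inj_on_def pairs_def)

context params
begin

text \<open>Virtual time runs faster than the updates. Each update takes at most
  \<open>2 * T + 1\<close> virtual operations, because the rank of a deleted item never exceeds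
  \<open>T\<close>.\<close>

definition sim_inv :: "request list \<Rightarrow> (nat \<Rightarrow> nat) \<Rightarrow> nat \<Rightarrow> nat \<Rightarrow> st \<Rightarrow> bool" where
  "sim_inv xs pred T n s \<longleftrightarrow> (\<exists>g t. state_inv g t s \<and> (\<forall>a. s (Q 7) a \<le> s (Q 14) 1) \<and> inj_on (elem g) (alive g t) \<and>
     link xs pred n (pairs g t) \<and> t \<le> num_updates (take n xs) * (2 * T + 1))"

definition algo :: "nat \<Rightarrow> dyn_alg" where
  "algo T = \<lparr>dyn_insert = prog L insp, dyn_delete = prog L (delp T), dyn_query = prog L qry\<rparr>"

lemma OPC_ge: "61 \<le> OPC"
proof -
  have "1 \<le> H" "1 \<le> L + 1" using H_ge by auto
  then have "1 * 1 \<le> H * (L + 1)" by (rule mult_le_mono)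
  then show ?thesis unfolding OPC_def by linarith
qed

lemma sim_insert:
  assumes S: "sim_inv xs pred T n s" and n: "n < length xs" "xs ! n = Insert e" and v: "valid Pb xs"
    and T: "num_updates xs = T" and po: "predicts_order xs pred" and TL: "T * (2 * T + 1) < 2 ^ L"
    and s0: "s0 = put (put s (Q 0) 0 e) (Q 1) 0 (pred n)"
  shows "sim_inv xs pred T (Suc n) (exec insp s0)" "time L insp s0 \<le> 2 * OPC"
proof -
  obtain g t where I: "state_inv g t s" and st: "\<And>a. s (Q 7) a \<le> s (Q 14) 1" and inj: "inj_on (elem g) (alive g t)"
    and lk: "link xs pred n (pairs g t)" and t: "t \<le> num_updates (take n xs) * (2 * T + 1)"
    using S unfolding sim_inv_def by blast
  have nu: "num_updates (take n xs) + 1 \<le> T" "num_updates (take (Suc n) xs) = num_updates (take n xs) + 1"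
    using num_updates_take[of "Suc n" xs] n T by (simp_all add: num_updates_Suc)
  have "(num_updates (take n xs) + 1) * (2 * T + 1) \<le> T * (2 * T + 1)" using nu(1) by (rule mult_right_mono) simp
  then have tL: "Suc t < 2 ^ L" using t TL by simp
  define s1 where "s1 = put (put s0 (Q 14) 2 e) (Q 14) 3 (pred n)"
  have e: "exec insp s0 = exec INS s1" by (simp add: insp_def s1_def s0)
  have I1: "state_inv g t s1" by (rule state_inv_frame[OF I]) (auto simp: s1_def s0)
  have r: "s1 (Q 14) 2 = e" "s1 (Q 14) 3 = pred n" by (simp_all add: s1_def)
  note d = do_ins[OF I1 tL r link_new_key[OF lk n po]]
  have "e \<notin> current xs n" using v n unfolding valid_def by fastforce
  then have ne: "e \<notin> fst ` pairs g t" using lk by (simp add: link_def)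
  define g' where "g' = g(t := VI e (pred n))"
  note d = d[folded g'_def]
  have s1: "s1 (Q 7) = s (Q 7)" "s1 (Q 14) 1 = s (Q 14) 1" by (simp_all add: s1_def s0)
  have "exec INS s1 (Q 7) a \<le> exec INS s1 (Q 14) 1" for a
    using st[of a] d(4)[of 1] frame_ops(1)[of s1] s1 by simp
  moreover have "link xs pred (Suc n) (pairs g' (Suc t))" unfolding d(2) by (rule link_insert[OF lk n])
  moreover have "Suc t \<le> num_updates (take (Suc n) xs) * (2 * T + 1)" using t nu(2) by simp
  ultimately show "sim_inv xs pred T (Suc n) (exec insp s0)"
    unfolding sim_inv_def e using d(1) d(3)[OF inj ne] by blast
  show "time L insp s0 \<le> 2 * OPC"
    using order_trans[OF time_le_wc wc_ops(1), of s1] OPC_ge by (simp add: insp_def s1_def s0)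
qed

lemma sim_delete:
  assumes S: "sim_inv xs pred T n s" and n: "n < length xs" "xs ! n = Delete e" and v: "valid Pb xs"
    and T: "num_updates xs = T" and TL: "T * (2 * T + 1) < 2 ^ L"
    and s0: "s0 = put s (Q 0) 0 e"
  shows "sim_inv xs pred T (Suc n) (exec (delp T) s0)"
    "deletion_time xs i = enat n \<Longrightarrow> time L (delp T) s0 \<le> 4 * (1 + prediction_error xs pred i) * OPC"
proof -
  obtain g t where I: "state_inv g t s" and st: "\<And>a. s (Q 7) a \<le> s (Q 14) 1" and inj: "inj_on (elem g) (alive g t)"
    and lk: "link xs pred n (pairs g t)" and t: "t \<le> num_updates (take n xs) * (2 * T + 1)"
    using S unfolding sim_inv_def by blast
  have nu: "num_updates (take n xs) + 1 \<le> T" "num_updates (take (Suc n) xs) = num_updates (take n xs) + 1"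
    using num_updates_take[of "Suc n" xs] n T by (simp_all add: num_updates_Suc)
  have "e \<in> current xs n" using v n unfolding valid_def by fastforce
  then have "e \<in> fst ` pairs g t" using lk by (simp add: link_def)
  then obtain x where x: "x \<in> alive g t" "elem g x = e" by (auto simp: pairs_def)
  define r where "r = card {y \<in> alive g t. key g y < key g x}"
  have "elem g ` alive g t = current xs n" using lk by (auto simp: link_def pairs_def image_image)
  then have "card (alive g t) = card (current xs n)" using card_image[OF inj] by simp
  moreover have "r \<le> card (alive g t)" unfolding r_def by (rule card_mono) auto
  \<comment> \<open>The rank is bounded by the number of present elements, hence by the number of
    updates made so far.\<close>
  ultimately have rn: "r \<le> num_updates (take n xs)" using current_bounds[OF v, of n] n by simp
  have "(num_updates (take n xs) + 1) * (2 * T + 1) \<le> T * (2 * T + 1)" using nu(1) by (rule mult_right_mono) simp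
  then have tr: "t + 2 * r + 1 \<le> num_updates (take (Suc n) xs) * (2 * T + 1)" "t + 2 * r + 1 < 2 ^ L"
    using t TL rn nu by simp_all
  define s1 where "s1 = put s0 (Q 14) 4 e"
  have e: "exec (delp T) s0 = exec (del T) s1" by (simp add: delp_def s1_def s0)
  have I1: "state_inv g t s1" by (rule state_inv_frame[OF I]) (auto simp: s1_def s0)
  have s4: "s1 (Q 14) 4 = elem g x" using x by (simp add: s1_def)
  have rT: "r \<le> T" using rn nu(1) by simp
  from del_correct[OF I1 inj x(1) s4 r_def[symmetric] rT tr(2)] obtain g' where
    g': "state_inv g' (t + 2 * r + 1) (exec (del T) s1)" "inj_on (elem g') (alive g' (t + 2 * r + 1))"
      "pairs g' (t + 2 * r + 1) = pairs g t - {(elem g x, key g x)}"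
      "\<And>j. j = 1 \<or> j = 4 \<or> 5 + T \<le> j \<Longrightarrow> exec (del T) s1 (Q 14) j = s1 (Q 14) j"
      "time L (del T) s1 \<le> (2 * r + 1) * OPC + 61 * (r + 1)"
    by blast
  have s1: "s1 (Q 7) = s (Q 7)" "s1 (Q 14) 1 = s (Q 14) 1" by (simp_all add: s1_def s0)
  have "exec (del T) s1 (Q 7) a \<le> exec (del T) s1 (Q 14) 1" for a
    using st[of a] g'(4)[of 1] frame_ops(3)[of T s1] s1 by simp
  moreover have "link xs pred (Suc n) (pairs g' (t + 2 * r + 1))"
    unfolding g'(3) x(2) by (rule link_delete[OF lk n _ inj_on_fst_pairs[OF inj]]) (use x in \<open>auto simp: pairs_def\<close>)
  ultimately show "sim_inv xs pred T (Suc n) (exec (delp T) s0)"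
    unfolding sim_inv_def e using g'(1,2) tr(1) by blast
  assume "deletion_time xs i = enat n"
  then have "live xs n i e" using live_of_deletion_time[of xs i n] n by auto
  from rank_le_error[OF v n this lk inj x] have "r \<le> prediction_error xs pred i" unfolding r_def .
  then have "(3 * r + 3) * OPC \<le> 4 * (1 + prediction_error xs pred i) * OPC" by (intro mult_right_mono) auto
  \<comment> \<open>\<open>2 * r + 1\<close> operations, \<open>r + 1\<close> more units of
    \<open>OPC\<close> that absorb the terms with 61, and one for the initial assignment.\<close>
  moreover have "time L (delp T) s0 \<le> (3 * r + 3) * OPC"
  proof -
    have "61 * (r + 1) \<le> OPC * (r + 1)" using OPC_ge by (rule mult_right_mono) simp
    moreover have "time L (delp T) s0 = 4 + time L (del T) s1" by (simp add: delp_def s1_def s0)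
    ultimately have "time L (delp T) s0 \<le> 4 + ((2 * r + 1) * OPC + OPC * (r + 1))" using g'(5) by linarith
    also have "\<dots> \<le> (3 * r + 3) * OPC" using OPC_ge by (simp add: algebra_simps)
    finally show ?thesis .
  qed
  ultimately show "time L (delp T) s0 \<le> 4 * (1 + prediction_error xs pred i) * OPC" by linarith
qed

lemma sim_query:
  assumes S: "sim_inv xs pred T n s" and n: "n < length xs" "xs ! n = Query q" and v: "valid Pb xs"
    and T: "num_updates xs = T" and inc: "incremental_algorithm F Pb T G Gq A" and s0: "s0 = put s (Q 0) 0 q"
  shows "sim_inv xs pred T (Suc n) (exec qry s0)" "exec qry s0 (Q 0) 0 \<in> answers Pb (current xs n) q"
proof -
  obtain g t where I: "state_inv g t s" and st: "\<And>a. s (Q 7) a \<le> s (Q 14) 1" and inj: "inj_on (elem g) (alive g t)"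
    and lk: "link xs pred n (pairs g t)" and t: "t \<le> num_updates (take n xs) * (2 * T + 1)"
    using S unfolding sim_inv_def by blast
  have I0: "state_inv g t s0" by (rule state_inv_frame[OF I]) (auto simp: s0)
  have st0: "s0 (Q 7) a \<le> s0 (Q 14) 1" for a using st by (simp add: s0)
  note qc = qry_correct[OF I0 st0]
  have "num_updates (take (Suc n) xs) = num_updates (take n xs)" using n by (simp add: num_updates_Suc)
  then show "sim_inv xs pred T (Suc n) (exec qry s0)"
    unfolding sim_inv_def using qc(1,2) inj link_query[OF lk n] t by auto
  obtain ys where ys: "set ys = alive g t" "distinct ys"
    "exec qry s0 (Q 0) 0 = frun (inc_query A) Gq 0 ((AM g ys)(0 := s0 (Q 0) 0)) 0"
    using qc(3) by blast
  have cur: "elem g ` set ys = current xs n" using lk ys(1) by (auto simp: link_def pairs_def image_image)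
  have cb: "card (current xs n) \<le> num_updates (take n xs)" "current xs n \<subseteq> elements Pb"
    using current_bounds[OF v, of n] n by auto
  have dm: "distinct (map (elem g) ys)" using ys inj by (simp add: distinct_map)
  have "length ys = card (current xs n)" using distinct_card[OF dm] cur by simp
  then have "length ys \<le> T" using cb(1) num_updates_take[of n xs] T by simp
  moreover have "q \<in> queries Pb" using v n unfolding valid_def by fastforce
  ultimately show "exec qry s0 (Q 0) 0 \<in> answers Pb (current xs n) q"
    using inc_answers[OF inc dm] cb(2) cur ys(3) by (simp add: s0)
qed

lemma algo_correct:
  assumes F: "{(+), (-)} \<subseteq> F" and inc: "incremental_algorithm F Pb T G Gq A" and v: "valid Pb xs"
    and T: "num_updates xs = T" and po: "predicts_order xs pred" and TL: "T * (2 * T + 1) < 2 ^ L" and Gq: "1 \<le> Gq"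
    and L: "0 < L" and N: "N \<le> length xs"
  shows "\<exists>Ms ts s. length Ms = Suc N \<and> length ts = N \<and> Ms ! 0 = (\<lambda>_. 0) \<and> rel L s (Ms ! N) \<and> sim_inv xs pred T N s \<and>
    (\<forall>n<N. runs (fst (dyn_call (algo T) pred n (xs ! n))) 0
        (load_args (snd (dyn_call (algo T) pred n (xs ! n))) (Ms ! n)) (ts ! n) (Ms ! Suc n) \<and>
      (case xs ! n of Insert e \<Rightarrow> ts ! n \<le> 2 * OPC
       | Delete e \<Rightarrow> (\<forall>i. deletion_time xs i = enat n \<longrightarrow> ts ! n \<le> 4 * (1 + prediction_error xs pred i) * OPC)
       | Query q \<Rightarrow> ts ! n \<le> 2200 * Gq \<and> (Ms ! Suc n) 0 \<in> answers Pb (current xs n) q))"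
  using N
proof (induction N)
  case 0
  have "sim_inv xs pred T 0 (\<lambda>_ _. 0)"
    unfolding sim_inv_def using state_inv_init[OF L, of "\<lambda>_. VD"]
    by (intro exI[of _ "\<lambda>_. VD"] exI[of _ 0]) (auto simp: link_def pairs_def)
  moreover have "rel L (\<lambda>_ _. 0) (\<lambda>_. 0)" by (simp add: rel_def)
  ultimately show ?case by (intro exI[of _ "[\<lambda>_. 0]"] exI[of _ "[]"] exI[of _ "\<lambda>_ _. 0"]) simp
next
  case (Suc N)
  then obtain Ms ts s where IH: "length Ms = Suc N" "length ts = N" "Ms ! 0 = (\<lambda>_. 0)" "rel L s (Ms ! N)" "sim_inv xs pred T N s"
    and st: "\<And>n. n < N \<Longrightarrow> runs (fst (dyn_call (algo T) pred n (xs ! n))) 0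
        (load_args (snd (dyn_call (algo T) pred n (xs ! n))) (Ms ! n)) (ts ! n) (Ms ! Suc n) \<and>
      (case xs ! n of Insert e \<Rightarrow> ts ! n \<le> 2 * OPC
       | Delete e \<Rightarrow> (\<forall>i. deletion_time xs i = enat n \<longrightarrow> ts ! n \<le> 4 * (1 + prediction_error xs pred i) * OPC)
       | Query q \<Rightarrow> ts ! n \<le> 2200 * Gq \<and> (Ms ! Suc n) 0 \<in> answers Pb (current xs n) q)"
    by auto
  have n: "N < length xs" using Suc.prems by simp
  have ua: "uses_arith F (inc_insert A)" "uses_arith F (inc_query A)" using inc by (auto simp: incremental_algorithm_def)
  note ok = okc_progs[OF F ua]
  have "\<exists>k M' s'. runs (fst (dyn_call (algo T) pred N (xs ! N))) 0
        (load_args (snd (dyn_call (algo T) pred N (xs ! N))) (Ms ! N)) k M' \<and> rel L s' M' \<and> sim_inv xs pred T (Suc N) s' \<and>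
      (case xs ! N of Insert e \<Rightarrow> k \<le> 2 * OPC
       | Delete e \<Rightarrow> (\<forall>i. deletion_time xs i = enat N \<longrightarrow> k \<le> 4 * (1 + prediction_error xs pred i) * OPC)
       | Query q \<Rightarrow> k \<le> 2200 * Gq \<and> M' 0 \<in> answers Pb (current xs N) q)"
  proof (cases "xs ! N")
    case (Insert e)
    define s0 where "s0 = put (put s (Q 0) 0 e) (Q 1) 0 (pred N)"
    have "rel L s0 (load_args [e, pred N] (Ms ! N))" unfolding s0_def by (rule rel_load_args(2)[OF IH(4)])
    then obtain k M' where "runs (prog L insp) 0 (load_args [e, pred N] (Ms ! N)) k M'" "rel L (exec insp s0) M'" "k \<le> time L insp s0"
      using runs_prog[OF _ ok(1)] by blast
    then show ?thesis using sim_insert[OF IH(5) n Insert v T po TL s0_def] Insert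
      by (intro exI[of _ k] exI[of _ M'] exI[of _ "exec insp s0"]) (simp add: algo_def)
  next
    case (Delete e)
    define s0 where "s0 = put s (Q 0) 0 e"
    have "rel L s0 (load_args [e] (Ms ! N))" unfolding s0_def by (rule rel_load_args(1)[OF IH(4)])
    then obtain k M' where "runs (prog L (delp T)) 0 (load_args [e] (Ms ! N)) k M'" "rel L (exec (delp T) s0) M'" "k \<le> time L (delp T) s0"
      using runs_prog[OF _ ok(2)] by blast
    then show ?thesis using sim_delete[OF IH(5) n Delete v T TL s0_def] Delete
      by (intro exI[of _ k] exI[of _ M'] exI[of _ "exec (delp T) s0"]) (auto simp: algo_def intro: le_trans)
  next
    case (Query q)
    define s0 where "s0 = put s (Q 0) 0 q"
    have "rel L s0 (load_args [q] (Ms ! N))" unfolding s0_def by (rule rel_load_args(1)[OF IH(4)])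
    then obtain k M' where k: "runs (prog L qry) 0 (load_args [q] (Ms ! N)) k M'" "rel L (exec qry s0) M'" "k \<le> time L qry s0"
      using runs_prog[OF _ ok(3)] by blast
    have "M' 0 = exec qry s0 (Q 0) 0"
    proof -
      have "addr L (Q 0) 0 = 0" by (simp add: addr_def)
      then show ?thesis using k(2) unfolding rel_def by (metis okn.simps(1) zero_less_numeral)
    qed
    moreover have "k \<le> 2200 * Gq" using k(3) time_le_wc[of L qry s0] wc_qry[OF Gq] by linarith
    ultimately show ?thesis using k sim_query[OF IH(5) n Query v T inc s0_def] Query
      by (intro exI[of _ k] exI[of _ M'] exI[of _ "exec qry s0"]) (simp add: algo_def)
  qed
  then obtain k M' s' where new: "runs (fst (dyn_call (algo T) pred N (xs ! N))) 0
        (load_args (snd (dyn_call (algo T) pred N (xs ! N))) (Ms ! N)) k M'" "rel L s' M'" "sim_inv xs pred T (Suc N) s'"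
      "case xs ! N of Insert e \<Rightarrow> k \<le> 2 * OPC
       | Delete e \<Rightarrow> (\<forall>i. deletion_time xs i = enat N \<longrightarrow> k \<le> 4 * (1 + prediction_error xs pred i) * OPC)
       | Query q \<Rightarrow> k \<le> 2200 * Gq \<and> M' 0 \<in> answers Pb (current xs N) q"
    by blast
  let ?Ms = "Ms @ [M']" and ?ts = "ts @ [k]"
  have "runs (fst (dyn_call (algo T) pred n (xs ! n))) 0
        (load_args (snd (dyn_call (algo T) pred n (xs ! n))) (?Ms ! n)) (?ts ! n) (?Ms ! Suc n) \<and>
      (case xs ! n of Insert e \<Rightarrow> ?ts ! n \<le> 2 * OPC
       | Delete e \<Rightarrow> (\<forall>i. deletion_time xs i = enat n \<longrightarrow> ?ts ! n \<le> 4 * (1 + prediction_error xs pred i) * OPC)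
       | Query q \<Rightarrow> ?ts ! n \<le> 2200 * Gq \<and> (?Ms ! Suc n) 0 \<in> answers Pb (current xs n) q)" if "n < Suc N" for n
  proof (cases "n = N")
    case True
    have eq: "?Ms ! N = Ms ! N" "?ts ! N = k" "?Ms ! Suc N = M'" using IH by (simp_all add: nth_append)
    show ?thesis unfolding True eq using new by blast
  next
    case False
    then have nN: "n < N" using that by simp
    then have eq: "?Ms ! n = Ms ! n" "?ts ! n = ts ! n" "?Ms ! Suc n = Ms ! Suc n" using IH by (simp_all add: nth_append)
    show ?thesis unfolding eq by (rule st[OF nN])
  qed
  moreover have "length ?Ms = Suc (Suc N)" "length ?ts = Suc N" "?Ms ! 0 = (\<lambda>_. 0)" "rel L s' (?Ms ! Suc N)"
    using IH new(2) by (simp_all add: nth_append)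
  ultimately show ?case using new(3) by blast
qed

end

theorem theorem1p5:
  "\<exists>C::real. 0 < C \<and>
    (\<forall>(F :: (nat \<Rightarrow> nat \<Rightarrow> nat) set) (Pb :: problem) (T :: nat) (\<Gamma> :: nat) (\<Gamma>q :: nat) (A :: inc_alg).
      {(+), (-)} \<subseteq> F \<and> 2 \<le> T \<and> 1 \<le> \<Gamma> \<and> 1 \<le> \<Gamma>q \<and> incremental_algorithm F Pb T \<Gamma> \<Gamma>q A \<longrightarrow>
      (\<exists>B :: dyn_alg. fully_dynamic_algorithm F Pb T
          (C * real \<Gamma> * (log 2 (real T))\<^sup>2)
          (\<lambda>\<eta>. C * (1 + real \<eta>) * real \<Gamma> * (log 2 (real T))\<^sup>2)
          (C * real \<Gamma>q)
          B))"
\<comment> \<open>Deletions need \<open>4 * 1744400 = 6977600\<close>, insertions half of it, and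
  queries 2200; the constant is rounded up.\<close>
proof (intro exI[of _ "7200000::real"] conjI allI impI)
  show "(0::real) < 7200000" by simp
  fix F :: "(nat \<Rightarrow> nat \<Rightarrow> nat) set" and Pb T \<Gamma> \<Gamma>q A
  assume "{(+), (-)} \<subseteq> F \<and> 2 \<le> T \<and> 1 \<le> \<Gamma> \<and> 1 \<le> \<Gamma>q \<and> incremental_algorithm F Pb T \<Gamma> \<Gamma>q A"
  then have F: "{(+), (-)} \<subseteq> F" and T2: "2 \<le> T" and G1: "1 \<le> \<Gamma>" and Gq: "1 \<le> \<Gamma>q"
    and inc: "incremental_algorithm F Pb T \<Gamma> \<Gamma>q A" by auto
  define l where "l = nat \<lceil>log 2 (real T)\<rceil>"
  \<comment> \<open>With \<open>T <= 2^l\<close> the number of virtual operations satisfies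
    \<open>T (2 T + 1) < 4 T^2 <= 2^(2 l + 2)\<close>.\<close>
  define L where "L = 2 * l + 2"
  define lg where "lg = log 2 (real T)"
  interpret params L \<Gamma> \<Gamma>q A .
  have lg1: "1 \<le> lg" using T2 by (simp add: lg_def le_log_iff)
  have l_le: "real l \<le> lg + 1" unfolding l_def lg_def[symmetric] using lg1 by linarith
  have "lg \<le> real l" unfolding l_def lg_def[symmetric] by linarith
  then have "real T \<le> 2 powr real l" using T2 by (simp add: lg_def log_le_iff)
  then have Tl: "T \<le> 2 ^ l" by (simp add: powr_realpow)
  have "T * (2 * T + 1) < 4 * (T * T)" using T2 by (simp add: algebra_simps)
  also have "\<dots> \<le> 4 * (2 ^ l * 2 ^ l)" using Tl by (intro mult_le_mono) auto
  also have "\<dots> = 2 ^ L" by (simp add: L_def power_add mult_2)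
  finally have TL: "T * (2 * T + 1) < 2 ^ L" .
  have L0: "0 < L" by (simp add: L_def)
  \<comment> \<open>\<open>L + 1 = 2 l + 3 <= 2 lg + 5 <= 7 lg\<close> and
    \<open>G + 1 <= 2 G\<close> give the factor \<open>2 * 49 = 98\<close>, and
    \<open>17800 * 98 = 1744400\<close>.\<close>
  have OPC: "real OPC \<le> 1744400 * real \<Gamma> * lg\<^sup>2"
  proof -
    have "real (L + 1) \<le> 7 * lg" using l_le lg1 by (simp add: L_def)
    then have sq: "real (L + 1) * real (L + 1) \<le> (7 * lg) * (7 * lg)" using lg1 by (intro mult_mono) auto
    have G2: "real (\<Gamma> + 1) \<le> 2 * real \<Gamma>" using G1 by simp
    have "real (\<Gamma> + 1) * (real (L + 1) * real (L + 1)) \<le> (2 * real \<Gamma>) * ((7 * lg) * (7 * lg))"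
      by (rule mult_mono[OF G2 sq]) auto
    moreover have "real OPC = 17800 * (real (\<Gamma> + 1) * (real (L + 1) * real (L + 1)))"
      unfolding OPC_def H_def of_nat_mult by (simp only: of_nat_numeral mult.assoc)
    moreover have "(2 * real \<Gamma>) * ((7 * lg) * (7 * lg)) = 98 * (real \<Gamma> * lg\<^sup>2)" by (simp add: power2_eq_square)
    ultimately have "real OPC \<le> 1744400 * (real \<Gamma> * lg\<^sup>2)" by linarith
    then show ?thesis by (simp only: mult.assoc)
  qed
  have nn: "0 \<le> real \<Gamma> * lg\<^sup>2" by simp
  have ua: "uses_arith F (inc_insert A)" "uses_arith F (inc_query A)" using inc by (auto simp: incremental_algorithm_def)
  have pl: "(+) \<in> F" using F by auto
  note ok = okc_progs[OF F ua]
  have "fully_dynamic_algorithm F Pb T (7200000 * real \<Gamma> * lg\<^sup>2)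
     (\<lambda>\<eta>. 7200000 * (1 + real \<eta>) * real \<Gamma> * lg\<^sup>2) (7200000 * real \<Gamma>q) (algo T)"
    unfolding fully_dynamic_algorithm_def
  proof (intro conjI allI impI)
    show "uses_arith F (dyn_insert (algo T))" "uses_arith F (dyn_delete (algo T))" "uses_arith F (dyn_query (algo T))"
      using ok pl by (simp_all add: algo_def uses_arith_prog)
    fix xs pred assume "valid Pb xs \<and> num_updates xs = T \<and> predicts_order xs pred"
    then have v: "valid Pb xs" and nT: "num_updates xs = T" and po: "predicts_order xs pred" by auto
    from algo_correct[OF F inc v nT po TL Gq L0 order.refl] obtain Ms ts where
      M: "length Ms = Suc (length xs)" "length ts = length xs" "Ms ! 0 = (\<lambda>_. 0)"
      and st: "\<And>n. n < length xs \<Longrightarrow> runs (fst (dyn_call (algo T) pred n (xs ! n))) 0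
        (load_args (snd (dyn_call (algo T) pred n (xs ! n))) (Ms ! n)) (ts ! n) (Ms ! Suc n) \<and>
      (case xs ! n of Insert e \<Rightarrow> ts ! n \<le> 2 * OPC
       | Delete e \<Rightarrow> (\<forall>i. deletion_time xs i = enat n \<longrightarrow> ts ! n \<le> 4 * (1 + prediction_error xs pred i) * OPC)
       | Query q \<Rightarrow> ts ! n \<le> 2200 * \<Gamma>q \<and> (Ms ! Suc n) 0 \<in> answers Pb (current xs n) q)"
      by blast
    show "\<exists>Ms ts. trace (dyn_calls (algo T) pred xs) Ms ts \<and> answers_correctly Pb xs Ms \<and>
       (\<forall>t<length xs. case xs ! t of Insert e \<Rightarrow> real (ts ! t) \<le> 7200000 * real \<Gamma> * lg\<^sup>2
         | Delete e \<Rightarrow> \<forall>i. deletion_time xs i = enat t \<longrightarrow>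
             real (ts ! t) \<le> 7200000 * (1 + real (prediction_error xs pred i)) * real \<Gamma> * lg\<^sup>2
         | Query q \<Rightarrow> real (ts ! t) \<le> 7200000 * real \<Gamma>q)"
    proof (intro exI conjI allI impI)
      show "trace (dyn_calls (algo T) pred xs) Ms ts"
        using M st by (simp add: trace_def dyn_calls_def)
      show "answers_correctly Pb xs Ms"
        unfolding answers_correctly_def using st by fastforce
      fix n assume n: "n < length xs"
      show "case xs ! n of Insert e \<Rightarrow> real (ts ! n) \<le> 7200000 * real \<Gamma> * lg\<^sup>2
         | Delete e \<Rightarrow> \<forall>i. deletion_time xs i = enat n \<longrightarrow>
             real (ts ! n) \<le> 7200000 * (1 + real (prediction_error xs pred i)) * real \<Gamma> * lg\<^sup>2
         | Query q \<Rightarrow> real (ts ! n) \<le> 7200000 * real \<Gamma>q"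
      proof (cases "xs ! n")
        case (Insert e)
        then have "real (ts ! n) \<le> real (2 * OPC)" using st[OF n] by (simp only: request.simps of_nat_le_iff)
        then show ?thesis using Insert OPC nn by simp
      next
        case (Delete e)
        have "real (ts ! n) \<le> 7200000 * (1 + real (prediction_error xs pred i)) * real \<Gamma> * lg\<^sup>2"
          if "deletion_time xs i = enat n" for i
        proof -
          let ?h = "prediction_error xs pred i"
          have "ts ! n \<le> 4 * (1 + ?h) * OPC" using st[OF n] Delete that by simp
          then have "real (ts ! n) \<le> real (4 * (1 + ?h) * OPC)" by (simp only: of_nat_le_iff)
          also have "\<dots> = 4 * (1 + real ?h) * real OPC" by simp
          also have "\<dots> \<le> 4 * (1 + real ?h) * (1744400 * real \<Gamma> * lg\<^sup>2)" by (intro mult_left_mono OPC) simp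
          also have "\<dots> = 6977600 * ((1 + real ?h) * (real \<Gamma> * lg\<^sup>2))" by simp
          also have "\<dots> \<le> 7200000 * ((1 + real ?h) * (real \<Gamma> * lg\<^sup>2))" by (intro mult_right_mono) auto
          finally show ?thesis by (simp only: mult.assoc)
        qed
        then show ?thesis using Delete by simp
      next
        case (Query q)
        then have "real (ts ! n) \<le> real (2200 * \<Gamma>q)" using st[OF n] by (simp only: request.simps of_nat_le_iff)
        then show ?thesis using Query by simp
      qed
    qed
  qed
  then show "\<exists>B. fully_dynamic_algorithm F Pb T (7200000 * real \<Gamma> * (log 2 (real T))\<^sup>2)
     (\<lambda>\<eta>. 7200000 * (1 + real \<eta>) * real \<Gamma> * (log 2 (real T))\<^sup>2) (7200000 * real \<Gamma>q) B"
    unfolding lg_def by blast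
qed

end
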